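(* Let $E$ be an elliptic curve defined over $\mathbb{Q}$ such that $\sqrt{\Delta(E)}\in\mathbb{Q}$. Then there exist $a,b,c,d\in\mathbb{Z}$ such that $E$ is $\mathbb{Q}$-isomorphic to $E_{alt}(a,b,c,d)$. Moreover, $E(\mathbb{Q})_{\rm tors}$ is either trivial, non-cyclic, or isomorphic to $C_3$.
   Context: $C_n$ is the cyclic group of order $n$; $E(\mathbb{Q})_{\rm tors}$ is the torsion subgroup of $E(\mathbb{Q})$. For a short Weierstrass model $Y^2=X^3+AX+B$ ($A,B\in\mathbb{Z}$) of $E$, $\Delta(E)=-2^4(4A^3+27B^2)$; whether $\Delta(E)$ is a square in $\mathbb{Q}$ (written $\sqrt{\Delta(E)}\in\mathbb{Q}$) does not depend on the chosen short model. For $a,b,c,d\in\mathbb{Z}$, $E_{alt}(a,b,c,d)$ is the curve $$Y^2=X^3-3^4(c^2+cd+d^2)(a^2+ab+b^2)X+3^5(c^2+cd+d^2)(a^3d+3a^2bc+3a^2bd+3ab^2c-b^3d).$$ Some parameter values give singular cubics; "$E$ is $\mathbb{Q}$-isomorphic to $E_{alt}(a,b,c,d)$" means that this curve is nonsingular and isomorphic to $E$ over $\mathbb{Q}$. *)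

theory Defs
  imports Complex_Main "HOL-Algebra.Elementary_Groups"
begin

text \<open>\<open>Weierstrass a1 a2 a3 a4 a6\<close> is the projective closure of
  \<open>y\<^sup>2 + a1 x y + a3 y = x\<^sup>3 + a2 x\<^sup>2 + a4 x + a6\<close>.\<close>

datatype 'a weierstrass = Weierstrass 'a 'a 'a 'a 'a

fun weierstrass_poly :: "'a::field weierstrass \<Rightarrow> 'a \<Rightarrow> 'a \<Rightarrow> 'a" where
  "weierstrass_poly (Weierstrass a1 a2 a3 a4 a6) x y =
     y^2 + a1 * x * y + a3 * y - (x^3 + a2 * x^2 + a4 * x + a6)"

fun weierstrass_poly_dx :: "'a::field weierstrass \<Rightarrow> 'a \<Rightarrow> 'a \<Rightarrow> 'a" where
  "weierstrass_poly_dx (Weierstrass a1 a2 a3 a4 a6) x y =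
     a1 * y - (3 * x^2 + 2 * a2 * x + a4)"

fun weierstrass_poly_dy :: "'a::field weierstrass \<Rightarrow> 'a \<Rightarrow> 'a \<Rightarrow> 'a" where
  "weierstrass_poly_dy (Weierstrass a1 a2 a3 a4 a6) x y = 2 * y + a1 * x + a3"

fun discriminant :: "'a::field weierstrass \<Rightarrow> 'a" where
  "discriminant (Weierstrass a1 a2 a3 a4 a6) =
     (let b2 = a1^2 + 4 * a2;
          b4 = 2 * a4 + a1 * a3;
          b6 = a3^2 + 4 * a6;
          b8 = a1^2 * a6 + 4 * a2 * a6 - a1 * a3 * a4 + a2 * a3^2 - a4^2
      in - (b2^2 * b8) - 8 * b4^3 - 27 * b6^2 + 9 * b2 * b4 * b6)"

definition elliptic_curve :: "'a::field weierstrass \<Rightarrow> bool" where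
  "elliptic_curve E \<longleftrightarrow> discriminant E \<noteq> 0"

text \<open>The point at infinity is never singular, and in characteristic \<open>0\<close> a singular point is
  rational over the base field, so \<open>elliptic_curve\<close> means geometrically nonsingular.\<close>

lemma elliptic_curve_iff_nonsingular:
  fixes E :: "'a::field_char_0 weierstrass"
  shows "elliptic_curve E \<longleftrightarrow>
    \<not> (\<exists>x y. weierstrass_poly E x y = 0 \<and> weierstrass_poly_dx E x y = 0 \<and> weierstrass_poly_dy E x y = 0)"
proof (cases E)
  case (Weierstrass a1 a2 a3 a4 a6)
  define b2 where "b2 = a1^2 + 4 * a2"
  define b4 where "b4 = 2 * a4 + a1 * a3"
  define b6 where "b6 = a3^2 + 4 * a6"
  define c4 where "c4 = b2^2 - 24 * b4"
  define c6 where "c6 = - (b2^3) + 36 * b2 * b4 - 216 * b6"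
  have c46: "c4^3 - c6^2 = 1728 * discriminant E"
    unfolding Weierstrass c4_def c6_def b2_def b4_def b6_def discriminant.simps Let_def
    by (simp add: algebra_simps) algebra
  show ?thesis
  proof
    assume "elliptic_curve E"
    then have "discriminant E \<noteq> 0" by (simp add: elliptic_curve_def)
    moreover have "discriminant E = 0"
      if "weierstrass_poly E x y = 0" "weierstrass_poly_dx E x y = 0" "weierstrass_poly_dy E x y = 0" for x y
    proof -
      have "a3 = - 2 * y - a1 * x" "a4 = a1 * y - 3 * x^2 - 2 * a2 * x"
        using that unfolding Weierstrass weierstrass_poly_dx.simps weierstrass_poly_dy.simps by algebra+
      moreover from this have "a6 = y^2 + a1 * x * y + a3 * y - x^3 - a2 * x^2 - a4 * x"
        using that(1) unfolding Weierstrass weierstrass_poly.simps by algebra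
      ultimately show ?thesis unfolding Weierstrass discriminant.simps Let_def by algebra
    qed
    ultimately show "\<not> (\<exists>x y. weierstrass_poly E x y = 0 \<and> weierstrass_poly_dx E x y = 0 \<and> weierstrass_poly_dy E x y = 0)"
      by blast
  next
    assume ns: "\<not> (\<exists>x y. weierstrass_poly E x y = 0 \<and> weierstrass_poly_dx E x y = 0 \<and> weierstrass_poly_dy E x y = 0)"
    show "elliptic_curve E"
      unfolding elliptic_curve_def
    proof
      assume d0: "discriminant E = 0"
      with c46 have c: "c4^3 = c6^2" by simp
      text \<open>With \<open>X = 12 x + b2\<close> the curve becomes \<open>432 (2y + a1 x + a3)\<^sup>2 = X\<^sup>3 - 3 c4 X - 2 c6\<close>,
        whose right-hand side has the double root \<open>- c6 / c4\<close>.\<close>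
      define X where "X = - c6 / c4"
      define x where "x = (X - b2) / 12"
      define y where "y = - (a1 * x + a3) / 2"
      have 2: "X * c4 = - c6"
        using c by (cases "c4 = 0") (auto simp: X_def)
      have 1: "X^2 = c4"
      proof (cases "c4 = 0")
        case False
        have "c4^2 * (X^2 - c4) = 0" using 2 c by algebra
        with False show ?thesis by simp
      qed (simp add: X_def)
      have "12 * x = X - b2" and y: "2 * y = - (a1 * x + a3)" by (simp_all add: x_def y_def)
      then have X: "X = 12 * x + b2" by simp
      have dy: "weierstrass_poly_dy E x y = 0" unfolding Weierstrass by (simp add: y)
      have "48 * weierstrass_poly_dx E x y = c4 - X^2"
        unfolding Weierstrass weierstrass_poly_dx.simps c4_def X b2_def b4_def using y by algebra
      then have dx: "weierstrass_poly_dx E x y = 0" using 1 by simp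
      have "1728 * weierstrass_poly E x y = - (X^3 - 3 * c4 * X - 2 * c6)"
        unfolding Weierstrass weierstrass_poly.simps c4_def c6_def X b2_def b4_def b6_def using y by algebra
      also have "X^3 = - c6" using 1 2 by (simp add: power3_eq_cube power2_eq_square mult.commute)
      finally have "weierstrass_poly E x y = 0" using 2 by (simp add: mult.assoc mult.commute[of c4])
      with dx dy ns show False by blast
    qed
  qed
qed

definition short_weierstrass :: "'a::field \<Rightarrow> 'a \<Rightarrow> 'a weierstrass" where
  "short_weierstrass A B = Weierstrass 0 0 0 A B"

lemma discriminant_short_weierstrass:
  "discriminant (short_weierstrass A B) = - (2^4) * (4 * A^3 + 27 * B^2)"
  by (simp add: short_weierstrass_def Let_def algebra_simps power_mult_distrib)

text \<open>The model obtained from the substitution \<open>x = u\<^sup>2 x' + r\<close>, \<open>y = u\<^sup>3 y' + u\<^sup>2 s x' + t\<close>.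
  For \<open>u \<noteq> 0\<close> these substitutions are exactly the isomorphisms over the base field
  between Weierstrass curves that preserve the point at infinity.\<close>

fun change_variables :: "'a::field \<Rightarrow> 'a \<Rightarrow> 'a \<Rightarrow> 'a \<Rightarrow> 'a weierstrass \<Rightarrow> 'a weierstrass" where
  "change_variables u r s t (Weierstrass a1 a2 a3 a4 a6) = Weierstrass
     ((a1 + 2 * s) / u)
     ((a2 - s * a1 + 3 * r - s^2) / u^2)
     ((a3 + r * a1 + 2 * t) / u^3)
     ((a4 - s * a3 + 2 * r * a2 - (t + r * s) * a1 + 3 * r^2 - 2 * s * t) / u^4)
     ((a6 + r * a4 + r^2 * a2 + r^3 - t * a3 - t^2 - r * t * a1) / u^6)"

lemma weierstrass_poly_change_variables:
  assumes "u \<noteq> 0"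
  shows "weierstrass_poly E (u^2 * x + r) (u^3 * y + u^2 * s * x + t) =
    u^6 * weierstrass_poly (change_variables u r s t E) x y"
proof (cases E)
  case (Weierstrass a1 a2 a3 a4 a6)
  have "\<exists>b1 b2 b3 b4 b6. change_variables u r s t E = Weierstrass b1 b2 b3 b4 b6 \<and>
     u * b1 = a1 + 2 * s \<and> u^2 * b2 = a2 - s * a1 + 3 * r - s^2 \<and>
     u^3 * b3 = a3 + r * a1 + 2 * t \<and>
     u^4 * b4 = a4 - s * a3 + 2 * r * a2 - (t + r * s) * a1 + 3 * r^2 - 2 * s * t \<and>
     u^6 * b6 = a6 + r * a4 + r^2 * a2 + r^3 - t * a3 - t^2 - r * t * a1"
    using assms by (simp add: Weierstrass)
  then obtain b1 b2 b3 b4 b6 where b: "change_variables u r s t E = Weierstrass b1 b2 b3 b4 b6"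
     "u * b1 = a1 + 2 * s" "u^2 * b2 = a2 - s * a1 + 3 * r - s^2"
     "u^3 * b3 = a3 + r * a1 + 2 * t"
     "u^4 * b4 = a4 - s * a3 + 2 * r * a2 - (t + r * s) * a1 + 3 * r^2 - 2 * s * t"
     "u^6 * b6 = a6 + r * a4 + r^2 * a2 + r^3 - t * a3 - t^2 - r * t * a1"
    by blast
  show ?thesis
    unfolding b(1) unfolding Weierstrass weierstrass_poly.simps using b(2-) by algebra
qed

lemma discriminant_change_variables:
  assumes "u \<noteq> 0"
  shows "discriminant E = u^12 * discriminant (change_variables u r s t E)"
proof (cases E)
  case (Weierstrass a1 a2 a3 a4 a6)
  have "\<exists>b1 b2 b3 b4 b6. change_variables u r s t E = Weierstrass b1 b2 b3 b4 b6 \<and>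
     u * b1 = a1 + 2 * s \<and> u^2 * b2 = a2 - s * a1 + 3 * r - s^2 \<and>
     u^3 * b3 = a3 + r * a1 + 2 * t \<and>
     u^4 * b4 = a4 - s * a3 + 2 * r * a2 - (t + r * s) * a1 + 3 * r^2 - 2 * s * t \<and>
     u^6 * b6 = a6 + r * a4 + r^2 * a2 + r^3 - t * a3 - t^2 - r * t * a1"
    using assms by (simp add: Weierstrass)
  then obtain b1 b2 b3 b4 b6 where b: "change_variables u r s t E = Weierstrass b1 b2 b3 b4 b6"
     "u * b1 = a1 + 2 * s" "u^2 * b2 = a2 - s * a1 + 3 * r - s^2"
     "u^3 * b3 = a3 + r * a1 + 2 * t"
     "u^4 * b4 = a4 - s * a3 + 2 * r * a2 - (t + r * s) * a1 + 3 * r^2 - 2 * s * t"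
     "u^6 * b6 = a6 + r * a4 + r^2 * a2 + r^3 - t * a3 - t^2 - r * t * a1"
    by blast
  let ?b2 = "a1^2 + 4 * a2" and ?b4 = "2 * a4 + a1 * a3" and ?b6 = "a3^2 + 4 * a6"
  let ?b8 = "a1^2 * a6 + 4 * a2 * a6 - a1 * a3 * a4 + a2 * a3^2 - a4^2"
  let ?d2 = "b1^2 + 4 * b2" and ?d4 = "2 * b4 + b1 * b3" and ?d6 = "b3^2 + 4 * b6"
  let ?d8 = "b1^2 * b6 + 4 * b2 * b6 - b1 * b3 * b4 + b2 * b3^2 - b4^2"
  have d2: "u^2 * ?d2 = ?b2 + 12 * r" using b(2-) by algebra
  have d4: "u^4 * ?d4 = ?b4 + r * ?b2 + 6 * r^2" using b(2-) by algebra
  have d6: "u^6 * ?d6 = ?b6 + 2 * r * ?b4 + r^2 * ?b2 + 4 * r^3" using b(2-) by algebra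
  have d8: "u^8 * ?d8 = ?b8 + 3 * r * ?b6 + 3 * r^2 * ?b4 + r^3 * ?b2 + 3 * r^4" using b(2-) by algebra
  have "u^12 * (- (?d2^2 * ?d8) - 8 * ?d4^3 - 27 * ?d6^2 + 9 * ?d2 * ?d4 * ?d6) =
    - ((u^2 * ?d2)^2 * (u^8 * ?d8)) - 8 * (u^4 * ?d4)^3 - 27 * (u^6 * ?d6)^2
    + 9 * (u^2 * ?d2) * (u^4 * ?d4) * (u^6 * ?d6)"
    by algebra
  also have "\<dots> = - (?b2^2 * ?b8) - 8 * ?b4^3 - 27 * ?b6^2 + 9 * ?b2 * ?b4 * ?b6"
    unfolding d2 d4 d6 d8 by algebra
  finally show ?thesis
    unfolding b(1) unfolding Weierstrass discriminant.simps Let_def by simp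
qed

definition weierstrass_isomorphic :: "'a::field weierstrass \<Rightarrow> 'a weierstrass \<Rightarrow> bool" where
  "weierstrass_isomorphic E E' \<longleftrightarrow> (\<exists>u r s t. u \<noteq> 0 \<and> E' = change_variables u r s t E)"

text \<open>\<open>\<Delta>(E)\<close> is taken from an integral short model of \<open>E\<close>. Such a model always exists, and by
  \<open>discriminant_change_variables\<close> the choice does not matter.\<close>

definition square_discriminant :: "rat weierstrass \<Rightarrow> bool" where
  "square_discriminant E \<longleftrightarrow>
     (\<exists>A B :: int. weierstrass_isomorphic E (short_weierstrass (of_int A) (of_int B)) \<and>
        (\<exists>q :: rat. q^2 = of_int (- (2^4) * (4 * A^3 + 27 * B^2))))"

datatype 'a point = Infinity | Affine 'a 'a

fun on_curve :: "'a::field weierstrass \<Rightarrow> 'a point \<Rightarrow> bool" where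
  "on_curve E Infinity \<longleftrightarrow> True"
| "on_curve E (Affine x y) \<longleftrightarrow> weierstrass_poly E x y = 0"

text \<open>Chord-tangent addition. The first test on affine points says that the second point is the
  negative of the first. Otherwise \<open>l\<close> is the slope of the chord or tangent through them, which
  meets the curve a third time at \<open>(x3, y1 + l * (x3 - x1))\<close>; the sum is the negative of that point.\<close>

fun add_point :: "'a::field weierstrass \<Rightarrow> 'a point \<Rightarrow> 'a point \<Rightarrow> 'a point" where
  "add_point E Infinity Q = Q"
| "add_point E (Affine x1 y1) Infinity = Affine x1 y1"
| "add_point (Weierstrass a1 a2 a3 a4 a6) (Affine x1 y1) (Affine x2 y2) =
     (if x1 = x2 \<and> y2 = - y1 - a1 * x1 - a3 then Infinity
      else
        let l = (if x1 = x2
                 then (3 * x1^2 + 2 * a2 * x1 + a4 - a1 * y1) / (2 * y1 + a1 * x1 + a3)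
                 else (y2 - y1) / (x2 - x1));
            x3 = l^2 + a1 * l - a2 - x1 - x2
        in Affine x3 (- (y1 + l * (x3 - x1)) - a1 * x3 - a3))"

definition point_group :: "'a::field weierstrass \<Rightarrow> 'a point monoid" where
  "point_group E = \<lparr>carrier = {P. on_curve E P}, mult = add_point E, one = Infinity\<rparr>"

definition torsion_subgroup :: "('a, 'b) monoid_scheme \<Rightarrow> ('a, 'b) monoid_scheme" where
  "torsion_subgroup G =
     G\<lparr>carrier := {x \<in> carrier G. \<exists>n::nat. n > 0 \<and> x [^]\<^bsub>G\<^esub> n = \<one>\<^bsub>G\<^esub>}\<rparr>"

definition E_alt :: "int \<Rightarrow> int \<Rightarrow> int \<Rightarrow> int \<Rightarrow> rat weierstrass" where
  "E_alt a b c d = short_weierstrass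
     (of_int (- (3^4) * (c^2 + c * d + d^2) * (a^2 + a * b + b^2)))
     (of_int (3^5 * (c^2 + c * d + d^2) *
        (a^3 * d + 3 * a^2 * b * c + 3 * a^2 * b * d + 3 * a * b^2 * c - b^3 * d)))"

end

theory Submission
  imports Defs "HOL-Computational_Algebra.Primes" "HOL-Computational_Algebra.Nth_Powers"
begin

text \<open>If the discriminant is a square, the curve is a scaling of \<open>y\<^sup>2 = x\<^sup>3 - 9 N x + 9 N d\<close> with
  \<open>N = c\<^sup>2 + c d + d\<^sup>2\<close>, which is already of the required shape with \<open>a = 1\<close>, \<open>b = 0\<close>.

  A rational 2-torsion point makes all three roots of the cubic rational, so the torsion subgroup
  is not cyclic. Otherwise the roots generate a cyclic cubic field \<open>K\<close>, some prime \<open>p\<close> ramifies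
  in \<open>K\<close>, and for \<open>p \<noteq> 3\<close> this means that the exponent of \<open>p\<close> in \<open>N\<close> is not divisible by 3
  (take \<open>c\<close>, \<open>d\<close> coprime). At such a prime the curve acquires a reduction \<open>y\<^sup>2 = x\<^sup>3 + e\<close> after
  a ramified scaling, so that \<open>3 P\<close> lies in the kernel of reduction for every rational point \<open>P\<close>.
  Torsion in this kernel has \<open>p\<close>-power order, and for \<open>p \<ge> 11\<close> there is none. Hence
  \<open>3 P = 0\<close> for every torsion point \<open>P\<close> unless \<open>p\<close> is 3 or 7. If both 3 and 7 ramify the two
  conclusions combine; if only one of them does, 2 is inert in \<open>K\<close>, and the reduction at 2 shows
  again that torsion of odd order is killed by 3.\<close>

section \<open>The group law\<close>

text \<open>By Cardano, the roots of the cubic are \<open>u + conj u\<close> with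
  \<open>u^3 = (sqrt (- 3))^3 * N * (c - d \<omega>)\<close>, so it splits over Q exactly when
  \<open>N * (c - d \<omega>)\<close> is a cube in Q(\<omega>). Hence no number field is
  constructed: the factorisation of \<open>c - d \<omega>\<close> in the Eisenstein integers, up to
  cubes, carries what is needed about the roots. Once the norm is a cube prime to 3, only a unit
  factor remains open, and it is visible modulo 2: the unit group of the residue field F_4 has order
  3, so every cube of odd norm is 1 modulo 2. An odd \<open>d\<close> therefore makes 2 inert, while
  an even \<open>d\<close> leaves only the trivial unit and yields a rational root. The prime 7 is
  the obstacle. The formal logarithm involves \<open>t^5 / 5\<close> and \<open>t^7 / 7\<close>; 5
  is inert in the Eisenstein integers and divides no primitive norm, but 7 splits. For even
  \<open>d\<close>, ramification at 7 alone is excluded by multiplying with a prime of norm 7 that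
  is 1 modulo 3 and not 1 modulo 2.\<close>

abbreviation wcurve :: "'a::field \<Rightarrow> 'a \<Rightarrow> 'a \<Rightarrow> 'a weierstrass" where
  "wcurve a b c \<equiv> Weierstrass 0 a 0 b c"

text \<open>The second equation makes \<open>l\<close> the slope of the tangent when the two points coincide, so
  that chords and tangents need not be distinguished below.\<close>

definition slope :: "'a::field \<Rightarrow> 'a \<Rightarrow> 'a \<times> 'a \<Rightarrow> 'a \<times> 'a \<Rightarrow> 'a \<Rightarrow> bool" where
  "slope a b = (\<lambda>(x1, y1) (x2, y2) l. y1 - y2 = l * (x1 - x2) \<and>
     l * (y1 + y2) = x1^2 + x1 * x2 + x2^2 + a * (x1 + x2) + b)"

fun neg_point :: "'a::field point \<Rightarrow> 'a point" where
  "neg_point Infinity = Infinity"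
| "neg_point (Affine x y) = Affine x (- y)"

lemma on_wcurve: "on_curve (wcurve a b c) (Affine x y) \<longleftrightarrow> y^2 = x^3 + a * x^2 + b * x + c"
  by simp

lemma add_point_slope:
  fixes a b :: "'a::field_char_0"
  assumes "slope a b (x1, y1) (x2, y2) l" "\<not> (x1 = x2 \<and> y2 = - y1)"
  shows "add_point (wcurve a b c) (Affine x1 y1) (Affine x2 y2) =
    Affine (l^2 - a - x1 - x2) (- (y1 + l * (l^2 - a - x1 - x2 - x1)))"
proof (cases "x1 = x2")
  case True
  then have y: "y2 = y1" and y0: "y1 \<noteq> 0"
    using assms by (auto simp: slope_def)
  have "l * (2 * y1) = 3 * x1^2 + 2 * a * x1 + b"
    using assms(1) True y by (simp add: slope_def algebra_simps power2_eq_square)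
  then have "l = (3 * x1^2 + 2 * a * x1 + b) / (2 * y1)"
    using y0 by (simp add: field_simps)
  then show ?thesis
    using True y assms(2) by (simp add: Let_def)
next
  case False
  then have "l = (y2 - y1) / (x2 - x1)"
    using assms(1) by (simp add: slope_def field_simps)
  with False show ?thesis by (simp add: Let_def)
qed

lemma slope_exists:
  fixes a b c :: "'a::field_char_0"
  assumes "on_curve (wcurve a b c) (Affine x1 y1)" "on_curve (wcurve a b c) (Affine x2 y2)"
    and "\<not> (x1 = x2 \<and> y2 = - y1)"
  obtains l where "slope a b (x1, y1) (x2, y2) l"
proof (cases "x1 = x2")
  case True
  have "(y1 - y2) * (y1 + y2) = 0"
    using assms(1,2) True unfolding on_wcurve by algebra
  then have y: "y2 = y1" and y0: "y1 \<noteq> 0"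
    using assms(3) True by (auto simp: eq_neg_iff_add_eq_0 add.commute)
  have "slope a b (x1, y1) (x2, y2) ((3 * x1^2 + 2 * a * x1 + b) / (2 * y1))"
    using True y y0 by (simp add: slope_def field_simps power2_eq_square)
  then show ?thesis by (rule that)
next
  case False
  define l where "l = (y1 - y2) / (x1 - x2)"
  have l: "y1 - y2 = l * (x1 - x2)" using False by (simp add: l_def)
  have "(x1 - x2) * (l * (y1 + y2)) = (x1 - x2) * (x1^2 + x1 * x2 + x2^2 + a * (x1 + x2) + b)"
    using assms(1,2) l unfolding on_wcurve by algebra
  then have "slope a b (x1, y1) (x2, y2) l"
    using l False by (simp add: slope_def)
  then show ?thesis by (rule that)
qed

lemma slope_commute: "slope a b P Q l \<longleftrightarrow> slope a b Q P l"
  by (cases P; cases Q) (auto simp: slope_def algebra_simps)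

lemma on_curve_add_slope:
  fixes a b c :: "'a::field_char_0"
  assumes "slope a b (x1, y1) (x2, y2) l" "on_curve (wcurve a b c) (Affine x1 y1)"
  shows "on_curve (wcurve a b c)
    (Affine (l^2 - a - x1 - x2) (- (y1 + l * (l^2 - a - x1 - x2 - x1))))"
  using assms unfolding on_wcurve slope_def prod.case by algebra

lemma slope_neg_sum:
  fixes a b c :: "'a::field_char_0"
  assumes "slope a b (x1, y1) (x2, y2) l"
  shows "slope a b (x1, - y1) (l^2 - a - x1 - x2, - (y1 + l * (l^2 - a - x1 - x2 - x1))) (- l)"
  using assms unfolding slope_def prod.case by algebra

lemma on_curve_neg [simp]: "on_curve (wcurve a b c) (neg_point P) \<longleftrightarrow> on_curve (wcurve a b c) P"
  by (cases P) auto

lemma add_Infinity_right [simp]: "add_point E P Infinity = P"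
  by (cases P) auto

lemma add_neg_right [simp]: "add_point (wcurve a b c) P (neg_point P) = Infinity"
  by (cases P) auto

lemma add_neg_left [simp]: "add_point (wcurve a b c) (neg_point P) P = Infinity"
  by (cases P) auto

lemma neg_neg_point [simp]: "neg_point (neg_point P) = P"
  by (cases P) auto

lemma neg_eq_Infinity_iff [simp]: "neg_point P = Infinity \<longleftrightarrow> P = Infinity"
  by (cases P) auto

declare add_point.simps(3) [simp del]

lemma add_cases [consumes 2, case_names left right opposite slope]:
  fixes a b c :: "'a::field_char_0"
  assumes "on_curve (wcurve a b c) P" "on_curve (wcurve a b c) Q"
  obtains (left) "P = Infinity" | (right) "Q = Infinity" | (opposite) "Q = neg_point P"
  | (slope) x1 y1 x2 y2 l where "P = Affine x1 y1" "Q = Affine x2 y2" "slope a b (x1, y1) (x2, y2) l"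
    "\<not> (x1 = x2 \<and> y2 = - y1)"
    "add_point (wcurve a b c) P Q = Affine (l^2 - a - x1 - x2) (- (y1 + l * (l^2 - a - x1 - x2 - x1)))"
  using assms by (cases P; cases Q) (metis slope_exists add_point_slope neg_point.simps)+

lemma add_point_closed:
  fixes a b c :: "'a::field_char_0"
  assumes "on_curve (wcurve a b c) P" "on_curve (wcurve a b c) Q"
  shows "on_curve (wcurve a b c) (add_point (wcurve a b c) P Q)"
  using assms
proof (cases rule: add_cases)
  case (slope x1 y1 x2 y2 l)
  then show ?thesis using on_curve_add_slope[OF slope(3)] assms(1) by simp
qed (use assms in auto)

lemma add_point_commute:
  fixes a b c :: "'a::field_char_0"
  assumes "on_curve (wcurve a b c) P" "on_curve (wcurve a b c) Q"
  shows "add_point (wcurve a b c) P Q = add_point (wcurve a b c) Q P"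
  using assms
proof (cases rule: add_cases)
  case (slope x1 y1 x2 y2 l)
  have "y1 - y2 = l * (x1 - x2)" using slope(3) by (simp add: slope_def)
  then have "y2 + l * (l^2 - a - x1 - x2 - x2) = y1 + l * (l^2 - a - x1 - x2 - x1)"
    by algebra
  moreover have "l^2 - a - x2 - x1 = l^2 - a - x1 - x2" by simp
  moreover have "\<not> (x2 = x1 \<and> y1 = - y2)" using slope(4) by auto
  then have "add_point (wcurve a b c) Q P =
     Affine (l^2 - a - x2 - x1) (- (y2 + l * (l^2 - a - x2 - x1 - x2)))"
    using add_point_slope[of a b x2 y2 x1 y1 l c] slope(1,2,3) slope_commute by metis
  ultimately show ?thesis using slope(5) by simp
qed auto

lemma add_point_neg:
  fixes a b c :: "'a::field_char_0"
  assumes "on_curve (wcurve a b c) P" "on_curve (wcurve a b c) Q"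
  shows "add_point (wcurve a b c) (neg_point P) (neg_point Q) = neg_point (add_point (wcurve a b c) P Q)"
  using assms
proof (cases rule: add_cases)
  case (slope x1 y1 x2 y2 l)
  have "slope a b (x1, - y1) (x2, - y2) (- l)"
    using slope(3) unfolding slope_def prod.case by algebra
  moreover have "\<not> (x1 = x2 \<and> - y2 = - (- y1))" using slope(4) by auto
  ultimately have "add_point (wcurve a b c) (Affine x1 (- y1)) (Affine x2 (- y2)) =
    Affine ((- l)^2 - a - x1 - x2) (- (- y1 + (- l) * ((- l)^2 - a - x1 - x2 - x1)))"
    by (rule add_point_slope)
  then show ?thesis using slope(1,2,5) by simp
qed auto

text \<open>Nonsingularity enters the group law here; the cases of associativity with opposite
  points are reduced to this cancellation.\<close>

lemma neg_add_cancel: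
  fixes a b c :: "'a::field_char_0"
  assumes E: "elliptic_curve (wcurve a b c)"
    and on: "on_curve (wcurve a b c) P" "on_curve (wcurve a b c) Q"
  shows "add_point (wcurve a b c) (neg_point P) (add_point (wcurve a b c) P Q) = Q"
  using on
proof (cases rule: add_cases)
  case (slope x1 y1 x2 y2 l)
  define x3 where "x3 = l^2 - a - x1 - x2"
  define y3 where "y3 = - (y1 + l * (x3 - x1))"
  have sum: "add_point (wcurve a b c) P Q = Affine x3 y3"
    using slope by (simp add: x3_def y3_def)
  have sl: "slope a b (x1, - y1) (x3, y3) (- l)"
    using slope_neg_sum[OF slope(3)] by (simp add: x3_def y3_def)
  \<comment> \<open>If the sum were \<open>P\<close> itself, then \<open>y1 = 0\<close>, and the
    second slope equation would make \<open>P\<close> a singular point.\<close>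
  have "\<not> (x1 = x3 \<and> y3 = y1)"
  proof
    assume eq: "x1 = x3 \<and> y3 = y1"
    then have "x1 = x3" "y3 = y1" by blast+
    then have "y1 = - y1" using y3_def by simp
    then have "2 * y1 = 0" unfolding mult_2 eq_neg_iff_add_eq_0 .
    then have y1: "y1 = 0" by simp
    have "3 * x1^2 + 2 * a * x1 + b = 0"
      using sl eq y1 unfolding slope_def by (simp add: algebra_simps power2_eq_square)
    then have "weierstrass_poly (wcurve a b c) x1 y1 = 0 \<and> weierstrass_poly_dx (wcurve a b c) x1 y1 = 0
       \<and> weierstrass_poly_dy (wcurve a b c) x1 y1 = 0"
      using on(1) slope(1) y1 by (simp add: algebra_simps)
    then show False using E elliptic_curve_iff_nonsingular by blast
  qed
  then have "add_point (wcurve a b c) (Affine x1 (- y1)) (Affine x3 y3) =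
     Affine ((- l)^2 - a - x1 - x3) (- (- y1 + (- l) * ((- l)^2 - a - x1 - x3 - x1)))"
    using add_point_slope[OF sl, of c] by simp
  moreover have "(- l)^2 - a - x1 - x3 = x2" by (simp add: x3_def)
  moreover have "- (- y1 + (- l) * (x2 - x1)) = y2"
    using slope(3) by (simp add: slope_def algebra_simps)
  ultimately have "add_point (wcurve a b c) (Affine x1 (- y1)) (Affine x3 y3) = Affine x2 y2"
    by (simp only:)
  then show ?thesis unfolding sum unfolding slope(1,2) by simp
qed auto

text \<open>The slopes \<open>l\<close>, \<open>m\<close>, \<open>n\<close> belong to the pairs P,
  Q; Q, R; and P + Q, R. Multiplied by \<open>x12 - x3\<close> or by \<open>y12 + y3\<close>, the
  identity is a polynomial consequence of the slope equations, and \<open>ne\<close> says that these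
  two factors do not both vanish.\<close>

lemma add_assoc_slope:
  fixes a b c :: "'a::field_char_0"
  assumes l: "slope a b (x1, y1) (x2, y2) l" and m: "slope a b (x2, y2) (x3, y3) m"
    and x12: "x12 = l^2 - a - x1 - x2" and y12: "y12 = - (y1 + l * (x12 - x1))"
    and n: "slope a b (x12, y12) (x3, y3) n" and ne: "\<not> (x12 = x3 \<and> y3 = - y12)"
  shows "(n + l) * (l - m) = x1 - x3"
proof -
  note eqs = l[unfolded slope_def prod.case] m[unfolded slope_def prod.case]
    n[unfolded slope_def prod.case]
  have "(x12 - x3) * ((n + l) * (l - m)) = (x12 - x3) * (x1 - x3)"
    using eqs x12 y12 by algebra
  moreover have "(y12 + y3) * ((n + l) * (l - m)) = (y12 + y3) * (x1 - x3)"
    using eqs x12 y12 by algebra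
  ultimately show ?thesis
    using ne by (metis eq_iff_diff_eq_0 mult_cancel_left add.commute eq_neg_iff_add_eq_0)
qed

lemma add_point_assoc_generic:
  fixes a b c :: "'a::field_char_0"
  defines "W \<equiv> wcurve a b c"
  assumes on: "on_curve W P" "on_curve W Q" "on_curve W R"
    and O: "P \<noteq> Infinity" "Q \<noteq> Infinity" "R \<noteq> Infinity"
    and PQ: "Q \<noteq> neg_point P" and QR: "R \<noteq> neg_point Q"
    and PQR: "R \<noteq> neg_point (add_point W P Q)" "P \<noteq> neg_point (add_point W Q R)"
  shows "add_point W (add_point W P Q) R = add_point W P (add_point W Q R)"
proof -
  obtain x1 y1 x2 y2 x3 y3 where pts: "P = Affine x1 y1" "Q = Affine x2 y2" "R = Affine x3 y3"
    using O by (cases P; cases Q; cases R) auto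
  obtain l where l: "slope a b (x1, y1) (x2, y2) l"
    using slope_exists[of a b c x1 y1 x2 y2] on PQ pts unfolding W_def by auto
  obtain m where m: "slope a b (x2, y2) (x3, y3) m"
    using slope_exists[of a b c x2 y2 x3 y3] on QR pts unfolding W_def by auto
  define x12 y12 where 12: "x12 = l^2 - a - x1 - x2" "y12 = - (y1 + l * (x12 - x1))"
  define x23 y23 where 23: "x23 = m^2 - a - x2 - x3" "y23 = - (y2 + m * (x23 - x2))"
  have sum12: "add_point W P Q = Affine x12 y12"
    using add_point_slope[OF l, of c] PQ pts 12 unfolding W_def by auto
  have sum23: "add_point W Q R = Affine x23 y23"
    using add_point_slope[OF m, of c] QR pts 23 unfolding W_def by auto
  have ne: "\<not> (x12 = x3 \<and> y3 = - y12)" "\<not> (x23 = x1 \<and> y1 = - y23)" "\<not> (x1 = x23 \<and> y23 = - y1)"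
    using PQR pts sum12 sum23 by auto
  have on12: "on_curve W (Affine x12 y12)" and on23: "on_curve W (Affine x23 y23)"
    using add_point_closed on unfolding sum12[symmetric] sum23[symmetric] W_def by blast+
  obtain n where n: "slope a b (x12, y12) (x3, y3) n"
    using slope_exists on12 on(3) ne(1) pts unfolding W_def by metis
  obtain k where k: "slope a b (x1, y1) (x23, y23) k"
    using slope_exists on23 on(1) ne(3) pts unfolding W_def by metis
  have nl: "(n + l) * (l - m) = x1 - x3" by (rule add_assoc_slope[OF l m 12 n ne(1)])
  have y23': "y23 = - (y3 + m * (x23 - x3))" using 23(2) m unfolding slope_def prod.case by algebra
  \<comment> \<open>The identity \<open>nl\<close>, read for the points in the order R, Q, P,
    determines \<open>k\<close>; comparison gives \<open>k = n + l - m\<close> unless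
    \<open>l = m\<close>.\<close>
  have "slope a b (x3, y3) (x2, y2) m" "slope a b (x2, y2) (x1, y1) l" "slope a b (x23, y23) (x1, y1) k"
    using l m k slope_commute by blast+
  then have "(k + m) * (m - l) = x3 - x1"
    using add_assoc_slope[of a b x3 y3 x2 y2 m x1 y1 l x23 y23 k] y23' 23(1) ne(2)
    by (simp add: diff_diff_eq add.commute)
  then have km: "(k + m) * (l - m) = x1 - x3" by algebra
  show ?thesis
  proof (cases "l = m")
    \<comment> \<open>Equal slopes force \<open>R = P\<close>, and associativity becomes
      commutativity.\<close>
    case True
    then have "x1 = x3" using nl by simp
    moreover have "y1 = y3" using l m True calculation by (simp add: slope_def) algebra
    ultimately have "R = P" using pts by simp
    then show ?thesis using on by (simp add: W_def add_point_commute add_point_closed)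
  next
    case False
    then have k': "k = n + l - m" using nl km by (metis add_diff_cancel_right' mult_cancel_right right_minus_eq)
    have X: "n^2 - a - x12 - x3 = k^2 - a - x1 - x23"
      unfolding 12 23 k' using nl by algebra
    have "add_point W (Affine x12 y12) R =
        Affine (n^2 - a - x12 - x3) (- (y12 + n * (n^2 - a - x12 - x3 - x12)))"
      using add_point_slope[OF n ne(1), of c] pts unfolding W_def by simp
    moreover have "add_point W P (Affine x23 y23) =
        Affine (k^2 - a - x1 - x23) (- (y1 + k * (k^2 - a - x1 - x23 - x1)))"
      using add_point_slope[OF k ne(3), of c] pts unfolding W_def by simp
    moreover have "(l - m) * (y12 + n * (n^2 - a - x12 - x3 - x12) - (y1 + k * (n^2 - a - x12 - x3 - x1))) = 0"
      using nl 12 k' l m unfolding slope_def prod.case by algebra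
    then have "y12 + n * (n^2 - a - x12 - x3 - x12) = y1 + k * (k^2 - a - x1 - x23 - x1)"
      using False unfolding X by simp
    ultimately show ?thesis unfolding sum12 sum23 by (simp only: X)
  qed
qed

lemma add_point_assoc:
  fixes a b c :: "'a::field_char_0"
  defines "W \<equiv> wcurve a b c"
  assumes E: "elliptic_curve W"
    and on: "on_curve W P" "on_curve W Q" "on_curve W R"
  shows "add_point W (add_point W P Q) R = add_point W P (add_point W Q R)"
proof -
  note closed = add_point_closed[of a b c, folded W_def]
  note comm = add_point_commute[of a b c, folded W_def]
  note neg = add_point_neg[of a b c, folded W_def]
  note cancel = neg_add_cancel[OF E[unfolded W_def], folded W_def]
  note onneg = on_curve_neg[of a b c, folded W_def]
  have cancel': "add_point W (add_point W A B) (neg_point B) = A"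
    if "on_curve W A" "on_curve W B" for A B
  proof -
    have "add_point W (add_point W A B) (neg_point B) = add_point W (neg_point B) (add_point W B A)"
      using that by (simp add: comm closed onneg)
    then show ?thesis using cancel[OF that(2,1)] by simp
  qed
  consider "P = Infinity \<or> Q = Infinity \<or> R = Infinity" | "Q = neg_point P" | "R = neg_point Q"
    | "R = neg_point (add_point W P Q)" | "P = neg_point (add_point W Q R)"
    | "P \<noteq> Infinity" "Q \<noteq> Infinity" "R \<noteq> Infinity" "Q \<noteq> neg_point P" "R \<noteq> neg_point Q"
      "R \<noteq> neg_point (add_point W P Q)" "P \<noteq> neg_point (add_point W Q R)"
    by blast
  then show ?thesis
  proof cases
    case 1
    then show ?thesis by auto
  next
    case 2
    then have "P = neg_point Q" by simp
    then show ?thesis using cancel[OF on(2,3)] by (simp add: W_def)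
  next
    case 3
    then show ?thesis using cancel'[OF on(1,2)] by (simp add: W_def)
  next
    case 4
    have "add_point W Q R = add_point W Q (add_point W (neg_point Q) (neg_point P))"
      using 4 neg comm on by simp
    also have "\<dots> = neg_point P"
      using cancel[of "neg_point Q" "neg_point P"] on onneg by simp
    finally have "add_point W Q R = neg_point P" .
    then show ?thesis using 4 by (simp add: W_def)
  next
    case 5
    have "add_point W P Q = add_point W (neg_point (add_point W R Q)) Q"
      using 5 comm on by simp
    also have "\<dots> = add_point W (add_point W (neg_point R) (neg_point Q)) (neg_point (neg_point Q))"
      using neg on by simp
    also have "\<dots> = neg_point R"
      using cancel' on onneg by blast
    finally have "add_point W P Q = neg_point R" .
    then show ?thesis using 5 by (simp add: W_def)
  next
    case 6
    then show ?thesis using add_point_assoc_generic on unfolding W_def by blast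
  qed
qed

theorem comm_group_point_group_wcurve:
  fixes a b c :: "'a::field_char_0"
  assumes "elliptic_curve (wcurve a b c)"
  shows "comm_group (point_group (wcurve a b c))"
proof (rule comm_groupI)
  fix P assume "P \<in> carrier (point_group (wcurve a b c))"
  then show "\<exists>Q\<in>carrier (point_group (wcurve a b c)).
      Q \<otimes>\<^bsub>point_group (wcurve a b c)\<^esub> P = \<one>\<^bsub>point_group (wcurve a b c)\<^esub>"
    by (intro bexI[of _ "neg_point P"]) (simp_all add: point_group_def)
next
  fix P Q assume "P \<in> carrier (point_group (wcurve a b c))" "Q \<in> carrier (point_group (wcurve a b c))"
  then show "P \<otimes>\<^bsub>point_group (wcurve a b c)\<^esub> Q = Q \<otimes>\<^bsub>point_group (wcurve a b c)\<^esub> P"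
    by (simp add: point_group_def add_point_commute)
qed (simp_all add: point_group_def add_point_closed add_point_assoc[OF assms])

section \<open>Transport of the group law along changes of variables\<close>

fun transport :: "'a::field \<Rightarrow> 'a \<Rightarrow> 'a \<Rightarrow> 'a \<Rightarrow> 'a point \<Rightarrow> 'a point" where
  "transport u r s t Infinity = Infinity"
| "transport u r s t (Affine x y) = Affine ((x - r) / u^2) ((y - s * (x - r) - t) / u^3)"

lemma on_curve_transport:
  assumes "u \<noteq> 0"
  shows "on_curve (change_variables u r s t E) (transport u r s t P) \<longleftrightarrow> on_curve E P"
proof (cases P)
  case (Affine x y)
  have "u^2 * ((x - r) / u^2) + r = x"
    "u^3 * ((y - s * (x - r) - t) / u^3) + u^2 * s * ((x - r) / u^2) + t = y"
    using assms by simp_all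
  then show ?thesis
    using weierstrass_poly_change_variables[OF assms, of E "(x - r) / u^2" r "(y - s * (x - r) - t) / u^3" s t]
      assms Affine by simp
qed simp

lemma bij_transport:
  assumes "u \<noteq> 0"
  shows "bij (transport u r s t)"
proof (rule bijI')
  show "(transport u r s t P = transport u r s t Q) = (P = Q)" for P Q
    using assms by (cases P; cases Q) auto
  show "\<exists>P. Q = transport u r s t P" for Q
  proof (cases Q)
    case Infinity
    then show ?thesis by (intro exI[of _ Infinity]) simp
  next
    case (Affine x y)
    then show ?thesis using assms
      by (intro exI[of _ "Affine (u^2 * x + r) (u^3 * y + u^2 * s * x + t)"]) simp
  qed
qed

lemma transport_add_point:
  fixes u :: "'a::field_char_0"
  assumes u: "u \<noteq> 0" and on: "on_curve E P" "on_curve E Q"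
  shows "transport u r s t (add_point E P Q) =
    add_point (change_variables u r s t E) (transport u r s t P) (transport u r s t Q)"
proof (cases "P = Infinity \<or> Q = Infinity")
  case True
  then show ?thesis by auto
next
  case False
  then obtain x1 y1 x2 y2 where PQ: "P = Affine x1 y1" "Q = Affine x2 y2"
    by (cases P; cases Q) auto
  obtain a1 a2 a3 a4 a6 where E: "E = Weierstrass a1 a2 a3 a4 a6" by (cases E)
  define b1 b2 b3 b4 where b: "b1 = (a1 + 2 * s) / u" "b2 = (a2 - s * a1 + 3 * r - s^2) / u^2"
     "b3 = (a3 + r * a1 + 2 * t) / u^3"
     "b4 = (a4 - s * a3 + 2 * r * a2 - (t + r * s) * a1 + 3 * r^2 - 2 * s * t) / u^4"
  define X1 Y1 X2 Y2 where XY: "X1 = (x1 - r) / u^2" "Y1 = (y1 - s * (x1 - r) - t) / u^3"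
    "X2 = (x2 - r) / u^2" "Y2 = (y2 - s * (x2 - r) - t) / u^3"
  have xX: "x1 = u^2 * X1 + r" "x2 = u^2 * X2 + r" 
    "y1 = u^3 * Y1 + s * (u^2 * X1) + t" "y2 = u^3 * Y2 + s * (u^2 * X2) + t"
    using u by (simp_all add: XY)
  have ub: "a1 = u * b1 - 2 * s" "a2 = u^2 * b2 + s * a1 - 3 * r + s^2"
    "a3 = u^3 * b3 - r * a1 - 2 * t"
    "a4 = u^4 * b4 + s * a3 - 2 * r * a2 + (t + r * s) * a1 - 3 * r^2 + 2 * s * t"
    using u by (simp_all add: b)
  have x_iff: "x1 = x2 \<longleftrightarrow> X1 = X2" using u xX by simp
  have "y2 - (- y1 - a1 * x1 - a3) = u^3 * (Y2 - (- Y1 - b1 * X1 - b3))" if "X1 = X2"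
    unfolding ub(1,3) xX that by algebra
  then have y_iff: "y2 = - y1 - a1 * x1 - a3 \<longleftrightarrow> Y2 = - Y1 - b1 * X1 - b3" if "X1 = X2"
    using u that by (metis eq_iff_diff_eq_0 mult_eq_0_iff power_not_zero)
  define l where "l = (if x1 = x2 then (3 * x1^2 + 2 * a2 * x1 + a4 - a1 * y1) / (2 * y1 + a1 * x1 + a3)
    else (y2 - y1) / (x2 - x1))"
  define L where "L = (if X1 = X2 then (3 * X1^2 + 2 * b2 * X1 + b4 - b1 * Y1) / (2 * Y1 + b1 * X1 + b3)
    else (Y2 - Y1) / (X2 - X1))"
  show ?thesis
  proof (cases "X1 = X2 \<and> Y2 = - Y1 - b1 * X1 - b3")
    case True
    then have "x1 = x2 \<and> y2 = - y1 - a1 * x1 - a3" using x_iff y_iff by blast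
    then have "add_point E P Q = Infinity" unfolding E PQ by (simp add: add_point.simps(3))
    moreover have "add_point (change_variables u r s t E) (transport u r s t P) (transport u r s t Q) = Infinity"
      using True unfolding E PQ transport.simps change_variables.simps XY[symmetric] b[symmetric]
      by (simp add: add_point.simps(3))
    ultimately show ?thesis by simp
  next
    case F: False
    then have F': "\<not> (x1 = x2 \<and> y2 = - y1 - a1 * x1 - a3)" using x_iff y_iff by blast
    \<comment> \<open>This is how dy/dx transforms under the substitution; tangent and chord are
      checked separately.\<close>
    have l: "l = u * L + s"
    proof (cases "X1 = X2")
      case True
      then have x: "x1 = x2" using x_iff by simp
      have "(y1 - y2) * (y2 - (- y1 - a1 * x1 - a3)) = 0"
        using on x unfolding E PQ on_curve.simps weierstrass_poly.simps by algebra
      then have y: "y1 = y2" using F' x by simp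
      have d: "2 * y1 + a1 * x1 + a3 = u^3 * (2 * Y1 + b1 * X1 + b3)"
        unfolding ub(1,3) xX by algebra
      have "2 * y1 + a1 * x1 + a3 \<noteq> 0"
      proof
        assume "2 * y1 + a1 * x1 + a3 = 0"
        then have "y2 = - y1 - a1 * x1 - a3" using y by algebra
        then show False using F' x by blast
      qed
      then have D: "2 * Y1 + b1 * X1 + b3 \<noteq> 0" using d by auto
      define N where "N = 3 * X1^2 + 2 * b2 * X1 + b4 - b1 * Y1"
      define D where "D = 2 * Y1 + b1 * X1 + b3"
      have n: "3 * x1^2 + 2 * a2 * x1 + a4 - a1 * y1 = u^4 * N + s * (u^3 * D)"
        unfolding N_def D_def ub(4) unfolding ub(2,3) unfolding ub(1) xX by algebra
      have "l = (u^4 * N + s * (u^3 * D)) / (u^3 * D)"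
        using x n d unfolding l_def D_def by simp
      also have "\<dots> = u * (N / D) + s"
        using u D[folded D_def] by (simp add: field_simps power_Suc[symmetric] del: power_Suc)
      finally show ?thesis using True unfolding L_def N_def D_def by simp
    next
      case False
      have "y2 - y1 = u^3 * (Y2 - Y1) + s * (u^2 * (X2 - X1))" unfolding xX by algebra
      moreover have "x2 - x1 = u^2 * (X2 - X1)" unfolding xX by algebra
      ultimately have "l = (u^3 * (Y2 - Y1) + s * (u^2 * (X2 - X1))) / (u^2 * (X2 - X1))"
        using False x_iff unfolding l_def by simp
      also have "\<dots> = u * ((Y2 - Y1) / (X2 - X1)) + s"
        using False u by (simp add: add_divide_distrib power2_eq_square power3_eq_cube)
      finally show ?thesis using False unfolding L_def by simp
    qed
    have sum1: "add_point E P Q = (let x3 = l^2 + a1 * l - a2 - x1 - x2 in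
       Affine x3 (- (y1 + l * (x3 - x1)) - a1 * x3 - a3))"
      using F' unfolding E PQ l_def by (simp add: add_point.simps(3) Let_def)
    have sum2: "add_point (change_variables u r s t E) (transport u r s t P) (transport u r s t Q) =
       (let x3 = L^2 + b1 * L - b2 - X1 - X2 in
       Affine x3 (- (Y1 + L * (x3 - X1)) - b1 * x3 - b3))"
      using F unfolding E PQ transport.simps change_variables.simps XY[symmetric] b[symmetric] L_def
      by (simp add: add_point.simps(3) Let_def)
    define x3 X3 where 3: "x3 = l^2 + a1 * l - a2 - x1 - x2" "X3 = L^2 + b1 * L - b2 - X1 - X2"
    have x3: "x3 = u^2 * X3 + r" unfolding 3 l ub(1,2) xX by algebra
    have "- (y1 + l * (x3 - x1)) - a1 * x3 - a3 - s * (x3 - r) - t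
       = u^3 * (- (Y1 + L * (X3 - X1)) - b1 * X3 - b3)"
      unfolding x3 l ub(1,3) xX by algebra
    then show ?thesis unfolding sum1 sum2 Let_def 3[symmetric] using x3 u by simp
  qed
qed


lemma elliptic_curve_change_variables:
  assumes "u \<noteq> 0"
  shows "elliptic_curve (change_variables u r s t E) \<longleftrightarrow> elliptic_curve E"
  using discriminant_change_variables[OF assms, of E r s t] assms by (simp add: elliptic_curve_def)

lemma point_group_simps [simp]:
  "carrier (point_group E) = {P. on_curve E P}"
  "P \<otimes>\<^bsub>point_group E\<^esub> Q = add_point E P Q"
  "\<one>\<^bsub>point_group E\<^esub> = Infinity"
  by (simp_all add: point_group_def)

theorem comm_group_point_group:
  fixes E :: "'a::field_char_0 weierstrass"
  assumes "elliptic_curve E"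
  shows "comm_group (point_group E)"
proof -
  obtain a1 a2 a3 a4 a6 where E: "E = Weierstrass a1 a2 a3 a4 a6" by (cases E)
  \<comment> \<open>Completing the square removes \<open>a1\<close> and \<open>a3\<close>; the group
    axioms are then pulled back from \<open>W\<close>.\<close>
  define W where "W = change_variables 1 0 (- a1 / 2) (- a3 / 2) E"
  have "\<exists>a b c. W = wcurve a b c" unfolding W_def E by simp
  then obtain a b c where W: "W = wcurve a b c" by blast
  have "elliptic_curve W"
    unfolding W_def using elliptic_curve_change_variables assms one_neq_zero by blast
  then interpret W: comm_group "point_group W"
    unfolding W by (rule comm_group_point_group_wcurve)
  define \<phi> where "\<phi> = transport 1 0 (- a1 / 2) (- a3 / 2)"
  have on: "on_curve W (\<phi> P) \<longleftrightarrow> on_curve E P" for P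
    unfolding W_def \<phi>_def by (rule on_curve_transport) simp
  have add: "\<phi> (add_point E P Q) = add_point W (\<phi> P) (\<phi> Q)" if "on_curve E P" "on_curve E Q" for P Q
    unfolding W_def \<phi>_def by (rule transport_add_point) (use that in auto)
  have bij: "bij \<phi>"
    unfolding \<phi>_def by (rule bij_transport) simp
  note eqI = bij_is_inj[OF bij, THEN injD]
  have closed: "on_curve E (add_point E P Q)" if "on_curve E P" "on_curve E Q" for P Q
    using W.m_closed[of "\<phi> P" "\<phi> Q"] that by (simp flip: on add: add)
  show ?thesis
  proof (rule comm_groupI)
    fix P assume P: "P \<in> carrier (point_group E)"
    obtain Q where Q: "\<phi> Q = neg_point (\<phi> P)"
      using bij by (metis bij_pointE)
    have "on_curve E Q"
      using P unfolding on[symmetric] Q by (simp add: W on[unfolded W])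
    moreover have "add_point E Q P = Infinity"
      using calculation P by (intro eqI[of "add_point E Q P" Infinity]) (simp_all add: add Q, simp add: W \<phi>_def)
    ultimately show "\<exists>Q\<in>carrier (point_group E). Q \<otimes>\<^bsub>point_group E\<^esub> P = \<one>\<^bsub>point_group E\<^esub>"
      by auto
  next
    fix P Q R
    assume "P \<in> carrier (point_group E)" "Q \<in> carrier (point_group E)" "R \<in> carrier (point_group E)"
    then show "P \<otimes>\<^bsub>point_group E\<^esub> Q \<otimes>\<^bsub>point_group E\<^esub> R = P \<otimes>\<^bsub>point_group E\<^esub> (Q \<otimes>\<^bsub>point_group E\<^esub> R)"
      using W.m_assoc[of "\<phi> P" "\<phi> Q" "\<phi> R"] by - (rule eqI, simp add: add on closed)
  next
    fix P Q
    assume "P \<in> carrier (point_group E)" "Q \<in> carrier (point_group E)"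
    then show "P \<otimes>\<^bsub>point_group E\<^esub> Q = Q \<otimes>\<^bsub>point_group E\<^esub> P"
      using W.m_comm[of "\<phi> P" "\<phi> Q"] by - (rule eqI, simp add: add on)
  qed (simp_all add: closed)
qed

lemma transport_pow:
  fixes u :: "'a::field_char_0"
  assumes "u \<noteq> 0" "elliptic_curve E" "on_curve E P"
  shows "transport u r s t (P [^]\<^bsub>point_group E\<^esub> (n::nat)) =
    transport u r s t P [^]\<^bsub>point_group (change_variables u r s t E)\<^esub> n"
proof -
  interpret E: comm_group "point_group E" using comm_group_point_group assms(2) .
  interpret E': comm_group "point_group (change_variables u r s t E)"
    using comm_group_point_group elliptic_curve_change_variables assms(1,2) by blast
  interpret group_hom "point_group E" "point_group (change_variables u r s t E)" "transport u r s t"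
    by unfold_locales
      (auto simp: hom_def on_curve_transport[OF assms(1)] transport_add_point[OF assms(1)])
  show ?thesis using hom_nat_pow[of P n] assms(3) by simp
qed

lemma transport_eq_Infinity_iff [simp]: "transport u r s t P = Infinity \<longleftrightarrow> P = Infinity"
  by (cases P) auto

section \<open>Valuations\<close>

text \<open>At 0 the value is 0 and not infinity, so \<open>vge\<close> treats 0 separately.\<close>

definition rval :: "nat \<Rightarrow> rat \<Rightarrow> int" where
  "rval p q = int (multiplicity (int p) (fst (quotient_of q))) - int (multiplicity (int p) (snd (quotient_of q)))"

definition vge :: "nat \<Rightarrow> int \<Rightarrow> rat \<Rightarrow> bool" where
  "vge p k q \<longleftrightarrow> q = 0 \<or> k \<le> rval p q"

lemma rat_as_quotient:
  fixes q :: rat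
  obtains a b :: int where "q = of_int a / of_int b" "b > 0"
proof -
  obtain n d where "quotient_of q = (n, d)" by fastforce
  then show ?thesis using that quotient_of_div quotient_of_denom_pos by blast
qed

lemma vge_0 [simp]: "vge p k 0"
  by (simp add: vge_def)

context
  fixes p :: nat
  assumes p: "prime p"
begin

lemma prime_int: "prime (int p)" using p by simp

lemma rval_quotient:
  assumes "a \<noteq> 0" "b \<noteq> 0"
  shows "rval p (of_int a / of_int b) = int (multiplicity (int p) a) - int (multiplicity (int p) b)"
proof -
  obtain n d where nd: "quotient_of (of_int a / of_int b) = (n, d)" by fastforce
  have d: "d > 0" using quotient_of_denom_pos[OF nd] .
  have "(of_int a / of_int b :: rat) = of_int n / of_int d" by (rule quotient_of_div[OF nd])
  then have "of_int (a * d) = (of_int (n * b) :: rat)" using assms d by (simp add: field_simps)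
  then have eq: "a * d = n * b" by linarith
  then have "n \<noteq> 0" using assms d by auto
  have "multiplicity (int p) a + multiplicity (int p) d = multiplicity (int p) n + multiplicity (int p) b"
    using prime_elem_multiplicity_mult_distrib[of "int p" a d] prime_elem_multiplicity_mult_distrib[of "int p" n b]
      eq assms d \<open>n \<noteq> 0\<close> prime_int by simp
  then show ?thesis by (simp add: rval_def nd)
qed

lemma rval_mult:
  assumes "x \<noteq> 0" "y \<noteq> 0"
  shows "rval p (x * y) = rval p x + rval p y"
proof -
  obtain a b where x: "x = of_int a / of_int b" "b > 0" using rat_as_quotient .
  obtain c d where y: "y = of_int c / of_int d" "d > 0" using rat_as_quotient .
  have nz: "a \<noteq> 0" "c \<noteq> 0" "b \<noteq> 0" "d \<noteq> 0" using assms x y by auto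
  have "rval p (of_int (a * c) / of_int (b * d)) = rval p x + rval p y"
    using nz prime_int unfolding x(1) y(1)
    by (subst (1 2 3) rval_quotient) (auto simp: prime_elem_multiplicity_mult_distrib)
  then show ?thesis unfolding x(1) y(1) by simp
qed

lemma rval_1 [simp]: "rval p 1 = 0"
  by (simp add: rval_def)

lemma rval_uminus [simp]: "rval p (- x) = rval p x"
proof -
  have "rval p (- 1) = 0" using rval_mult[of "- 1" "- 1"] by simp
  then show ?thesis using rval_mult[of "- 1" x] by (cases "x = 0") simp_all
qed

lemma rval_power [simp]: "x \<noteq> 0 \<Longrightarrow> rval p (x ^ n) = int n * rval p x"
  by (induction n) (simp_all add: rval_mult algebra_simps)

lemma rval_inverse: "x \<noteq> 0 \<Longrightarrow> rval p (1 / x) = - rval p x"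
  using rval_mult[of x "1 / x"] by simp

lemma rval_divide: "x \<noteq> 0 \<Longrightarrow> y \<noteq> 0 \<Longrightarrow> rval p (x / y) = rval p x - rval p y"
  using rval_mult[of x "1 / y"] rval_inverse[of y] by simp

lemma rval_of_int: "n \<noteq> 0 \<Longrightarrow> rval p (of_int n) = int (multiplicity (int p) n)"
  using rval_quotient[of n 1] by simp

lemma vge_uminus [simp]: "vge p k (- x) \<longleftrightarrow> vge p k x"
  by (simp add: vge_def)

lemma vge_add:
  assumes "vge p k x" "vge p k y"
  shows "vge p k (x + y)"
proof (cases "x = 0 \<or> y = 0 \<or> x + y = 0")
  case False
  obtain a b where x: "x = of_int a / of_int b" "b > 0" using rat_as_quotient .
  obtain c d where y: "y = of_int c / of_int d" "d > 0" using rat_as_quotient .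
  have nz: "a \<noteq> 0" "c \<noteq> 0" "b \<noteq> 0" "d \<noteq> 0" using False x y by auto
  have xs: "x = of_int (a * d) / of_int (b * d)" "y = of_int (c * b) / of_int (b * d)"
    using nz x y by simp_all
  then have sum: "x + y = of_int (a * d + c * b) / of_int (b * d)"
    by (simp add: add_divide_distrib)
  then have nz': "a * d + c * b \<noteq> 0" using False by (metis divide_eq_0_iff of_int_0)
  define m where "m = min (multiplicity (int p) (a * d)) (multiplicity (int p) (c * b))"
  have "int p ^ m dvd a * d + c * b"
    by (intro dvd_add multiplicity_dvd') (auto simp: m_def)
  then have m: "m \<le> multiplicity (int p) (a * d + c * b)"
    using nz' prime_int by (intro multiplicity_geI) auto
  have "rval p x = int (multiplicity (int p) (a * d)) - int (multiplicity (int p) (b * d))"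
    "rval p y = int (multiplicity (int p) (c * b)) - int (multiplicity (int p) (b * d))"
    "rval p (x + y) = int (multiplicity (int p) (a * d + c * b)) - int (multiplicity (int p) (b * d))"
    by (subst xs(1) xs(2) sum, rule rval_quotient; use nz nz' in simp)+
  moreover have "k \<le> rval p x" "k \<le> rval p y" using assms False by (auto simp: vge_def)
  ultimately show ?thesis using m unfolding vge_def m_def by linarith
qed (use assms in \<open>auto simp: vge_def\<close>)

lemma vge_diff: "vge p k x \<Longrightarrow> vge p k y \<Longrightarrow> vge p k (x - y)"
  using vge_add[of k x "- y"] by simp

lemma vge_mult: "vge p i x \<Longrightarrow> vge p j y \<Longrightarrow> vge p (i + j) (x * y)"
  by (cases "x = 0 \<or> y = 0") (auto simp: vge_def rval_mult)

lemma vge_mono: "vge p i x \<Longrightarrow> j \<le> i \<Longrightarrow> vge p j x"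
  by (auto simp: vge_def)

lemma vge_mult0: "vge p 0 x \<Longrightarrow> vge p j y \<Longrightarrow> vge p j (x * y)" "vge p j x \<Longrightarrow> vge p 0 y \<Longrightarrow> vge p j (x * y)"
  using vge_mult[of 0 x j y] vge_mult[of j x 0 y] by auto

lemma vge_of_int [simp]: "vge p 0 (of_int n)"
  by (cases "n = 0") (simp_all add: vge_def rval_of_int)

lemma vge_numeral [simp]: "vge p 0 (numeral n)" "vge p 0 1" "vge p 0 (of_nat k)"
  using vge_of_int[of "numeral n"] vge_of_int[of 1] vge_of_int[of "int k"] by simp_all

lemma vge_power: "vge p 0 x \<Longrightarrow> vge p 0 (x ^ n)"
  by (induction n) (simp_all add: vge_mult0)

lemma vge_power_pos: "vge p 1 x \<Longrightarrow> vge p 1 (x ^ Suc n)"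
  using vge_mult0(2)[of 1 x "x ^ n"] vge_power[of x n] vge_mono[of 1 x 0] by simp

lemma vge_1_of_int: "vge p 1 (of_int n) \<longleftrightarrow> int p dvd n"
proof (cases "n = 0")
  case False
  have "multiplicity (int p) n \<ge> 1 \<longleftrightarrow> int p dvd n"
    using False prime_int multiplicity_gt_zero_iff[of n "int p"] not_prime_unit[of "int p"]
    by (metis One_nat_def Suc_le_eq)
  then show ?thesis using False by (simp add: vge_def rval_of_int)
qed simp

lemma vge_1_of_nat: "vge p 1 (of_nat n) \<longleftrightarrow> p dvd n"
  using vge_1_of_int[of "int n"] by simp

lemma rval_add_eq:
  assumes "x \<noteq> 0" "vge p (rval p x + 1) y"
  shows "x + y \<noteq> 0" "rval p (x + y) = rval p x"
proof -
  have not: "\<not> vge p (rval p x + 1) x" using assms(1) by (simp add: vge_def)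
  then have not': "\<not> vge p (rval p x + 1) (x + y)"
    using vge_diff[of "rval p x + 1" "x + y" y] assms(2) by auto
  then show "x + y \<noteq> 0" by auto
  have "vge p (rval p x) (x + y)"
    using vge_add[of "rval p x" x y] vge_mono[OF assms(2), of "rval p x"] by (simp add: vge_def)
  with not' show "rval p (x + y) = rval p x" by (auto simp: vge_def)
qed

lemma unit_1_add:
  assumes "vge p 1 e"
  shows "1 + e \<noteq> 0" "rval p (1 + e) = 0"
  using rval_add_eq[of 1 e] assms by simp_all

lemma vge_divide_unit: "rval p d = 0 \<Longrightarrow> d \<noteq> 0 \<Longrightarrow> vge p k (x / d) \<longleftrightarrow> vge p k x"
  by (cases "x = 0") (auto simp: vge_def rval_divide)

lemmas vge_intros = vge_add vge_diff vge_uminus[THEN iffD2] vge_mult0(2) vge_power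

text \<open>In the coordinates \<open>t = x / y\<close>, \<open>w = 1 / y\<close> the curve is
  \<open>w = t\<^sup>3 + a t\<^sup>2 w + b t w\<^sup>2 + c w\<^sup>3\<close>. The line through the two points is \<open>w = l t + m\<close>,
  and the sum of the \<open>t\<close>-coordinates of its three intersections with the curve is read off
  from the resulting cubic, with leading coefficient \<open>d\<close>.\<close>

lemma add_point_tw:
  fixes a b c x1 y1 x2 y2 :: rat
  defines "W \<equiv> wcurve a b c"
  assumes abc: "vge p 1 a" "vge p 1 b" "vge p 1 c"
    and on: "on_curve W (Affine x1 y1)" "on_curve W (Affine x2 y2)"
    and y: "y1 \<noteq> 0" "y2 \<noteq> 0"
    and int: "vge p 0 (x1 / y1)" "vge p 0 (1 / y1)" "vge p 0 (1 / y2)"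
    and t2: "x2 = y2" and opp: "\<not> (x1 = x2 \<and> y2 = - y1)"
  obtains x3 y3 l m d where "add_point W (Affine x1 y1) (Affine x2 y2) = Affine x3 y3" "y3 \<noteq> 0"
    "vge p 0 l" "vge p 0 m" "d = 1 + a * l + b * l^2 + c * l^3"
    "d * (x3 / y3 - x1 / y1 - 1) = (a + 2 * b * l + 3 * c * l^2) * m"
    "1 / y3 = l * (x3 / y3) - m" "m = 1 / y1 - l * (x1 / y1)"
    "l * (1 - a - b * (1 / y1 + 1 / y2) - c * ((1 / y1)^2 + 1 / y1 * (1 / y2) + (1 / y2)^2)) =
      (x1 / y1)^2 + x1 / y1 + 1 + a * (x1 / y1 + 1) * (1 / y1) + b * (1 / y1)^2"
proof -
  define t w v where "t = x1 / y1" and "w = 1 / y1" and "v = 1 / y2"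
  have xy: "x1 = t * y1" "w * y1 = 1" "v * y2 = 1" "w \<noteq> 0" "v \<noteq> 0"
    using y by (simp_all add: t_def w_def v_def)
  have int': "vge p 0 t" "vge p 0 w" "vge p 0 v"
    using int by (simp_all add: t_def w_def v_def)
  have cw: "w = t^3 + a * t^2 * w + b * t * w^2 + c * w^3"
  proof -
    have "y1^2 = x1^3 + a * x1^2 + b * x1 + c" using on(1) unfolding W_def on_wcurve .
    moreover have "y1^3 * (w - (t^3 + a * t^2 * w + b * t * w^2 + c * w^3)) =
        y1^2 * (w * y1) - (x1^3 + a * x1^2 * (w * y1) + b * x1 * (w * y1)^2 + c * (w * y1)^3)"
      unfolding xy(1) by (simp add: algebra_simps power2_eq_square power3_eq_cube)
    ultimately have "y1^3 * (w - (t^3 + a * t^2 * w + b * t * w^2 + c * w^3)) = 0"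
      unfolding xy(2) by simp
    then show ?thesis using y(1) by simp
  qed
  have cv: "v = 1 + a * v + b * v^2 + c * v^3"
  proof -
    have "y2^2 = x2^3 + a * x2^2 + b * x2 + c" using on(2) unfolding W_def on_wcurve .
    moreover have "y2^3 * (v - (1 + a * v + b * v^2 + c * v^3)) =
        y2^2 * (v * y2) - (y2^3 + a * y2^2 * (v * y2) + b * y2 * (v * y2)^2 + c * (v * y2)^3)"
      by (simp add: algebra_simps power2_eq_square power3_eq_cube)
    ultimately have "y2^3 * (v - (1 + a * v + b * v^2 + c * v^3)) = 0"
      unfolding xy(3) t2 by simp
    then show ?thesis using y(2) by simp
  qed
  \<comment> \<open>Subtracting the two curve equations gives
    \<open>U * (w - v) = V * (t - 1)\<close>. Since \<open>U\<close> is a unit, the quotient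
    \<open>V / U\<close> also serves as the slope of the tangent.\<close>
  define U where "U = 1 + - (a + b * (w + v) + c * (w^2 + w * v + v^2))"
  define V where "V = t^2 + t + 1 + a * (t + 1) * w + b * w^2"
  define l where "l = V / U"
  define m where "m = w - l * t"
  define d where "d = 1 + (a * l + b * l^2 + c * l^3)"
  have U: "U \<noteq> 0" "rval p U = 0"
    unfolding U_def by (rule unit_1_add; intro vge_intros int' abc)+
  have lU: "l * U = V" using U by (simp add: l_def)
  have V: "vge p 0 V"
    unfolding V_def using abc[THEN vge_mono, of 0] by (intro vge_intros int') auto
  then have l: "vge p 0 l" unfolding l_def using vge_divide_unit[OF U(2,1)] by simp
  then have m: "vge p 0 m" unfolding m_def by (intro vge_intros int')
  have d: "d \<noteq> 0" unfolding d_def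
    by (rule unit_1_add; intro vge_intros l abc)
  have "U * (w - v) = V * (t - 1)"
    using cw cv unfolding U_def V_def by algebra
  then have "U * (w - v - l * (t - 1)) = 0" using lU by algebra
  then have chord: "w - v = l * (t - 1)" using U by simp
  \<comment> \<open>If \<open>m = 0\<close>, the line passes through the origin of the
    \<open>(t, w)\<close> plane, the point at infinity. The curve equation then leaves
    \<open>t = - 1\<close>, where the points are opposite, and the impossible values
    \<open>t = 0\<close> and \<open>t = 1\<close>.\<close>
  have m0: "m \<noteq> 0"
  proof
    assume "m = 0"
    then have w: "w = l * t" and v: "v = l" using chord by (auto simp: m_def algebra_simps)
    have ld: "l = d" using cv unfolding v d_def by simp
    have "t * (1 - t^2) * d = 0" using cw w ld unfolding d_def by algebra
    then have "t = 0 \<or> (t - 1) * (t + 1) = 0" using d by (auto simp: power2_eq_square algebra_simps)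
    then consider "t = 0" | "t = 1" | "t = - 1" by (auto simp: eq_neg_iff_add_eq_0)
    then show False
    proof cases
      case 1
      then show False using w xy by simp
    next
      case 2
      then have "l * (1 - a - 2 * b * l - 3 * c * l^2) = 3 + 2 * a * l + b * l^2"
        using lU w v unfolding U_def V_def by algebra
      then have "l = 0" using ld d_def by algebra
      then show False using ld d by simp
    next
      case 3
      then have "w = - v" using w v by simp
      then have "y2 = - y1" using y unfolding w_def v_def by (simp add: field_simps)
      then show False using 3 xy t2 opp by simp
    qed
  qed
  \<comment> \<open>In the original coordinates \<open>w = l * t + m\<close> reads
    \<open>1 = l * x + m * y\<close>, a line of slope \<open>- l / m\<close>.\<close>
  define k where "k = - l / m"
  have km: "k * m = - l" using m0 by (simp add: k_def)
  have line1: "l * x1 + m * y1 = 1" using xy(1,2) m_def by algebra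
  have line2: "l * x2 + m * y2 = 1" using xy(3) m_def chord t2 by algebra
  have k1: "y1 - y2 = k * (x1 - x2)"
  proof -
    have "m * (y1 - y2) = m * (k * (x1 - x2))" using line1 line2 km by algebra
    then show ?thesis using m0 by simp
  qed
  have k2: "k * (y1 + y2) = x1^2 + x1 * x2 + x2^2 + a * (x1 + x2) + b"
  proof (cases "x1 = x2")
    case True
    then have yy: "y1 = y2" using k1 by simp
    have "v = w" "t = 1" using yy True t2 y by (simp_all add: w_def v_def t_def)
    then have "l * (1 - a - 2 * b * w - 3 * c * w^2) = 3 + 2 * a * w + b * w^2"
      using lU unfolding U_def V_def by (simp add: algebra_simps power2_eq_square)
    then have "y1^2 * (l * (1 - a - 2 * b * w - 3 * c * w^2)) = y1^2 * (3 + 2 * a * w + b * w^2)"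
      by simp
    then have "l * (y1^2 - a * x1^2 - 2 * b * x1 - 3 * c) = 3 * x1^2 + 2 * a * x1 + b"
      using xy(2) True yy t2 by algebra
    moreover have "y1^2 = x1^3 + a * x1^2 + b * x1 + c" using on(1) unfolding W_def on_wcurve .
    ultimately have "(m * y1) * (k * (y1 + y2) - (x1^2 + x1 * x2 + x2^2 + a * (x1 + x2) + b)) = 0"
      using km line1 yy True by algebra
    then show ?thesis using m0 y by simp
  next
    case False
    have "(x1 - x2) * (k * (y1 + y2)) = (x1 - x2) * (x1^2 + x1 * x2 + x2^2 + a * (x1 + x2) + b)"
      using on k1 unfolding W_def on_wcurve by algebra
    then show ?thesis using False by simp
  qed
  have sl: "slope a b (x1, y1) (x2, y2) k" using k1 k2 by (simp add: slope_def)
  define x3 where "x3 = k^2 - a - x1 - x2"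
  define y3 where "y3 = - (y1 + k * (x3 - x1))"
  have sum: "add_point W (Affine x1 y1) (Affine x2 y2) = Affine x3 y3"
    using add_point_slope[OF sl opp, of c] by (simp add: W_def x3_def y3_def)
  have on3: "y3^2 = x3^3 + a * x3^2 + b * x3 + c"
    using on_curve_add_slope[OF sl, of c] on(1) unfolding W_def x3_def[symmetric] y3_def[symmetric] on_wcurve by blast
  have line3: "l * x3 - m * y3 = 1" using line1 km y3_def by algebra
  have y3: "y3 \<noteq> 0"
  proof
    assume "y3 = 0"
    then have "d = 0" using on3 line3 d_def by algebra
    then show False using d by simp
  qed
  \<comment> \<open>Vieta for \<open>x^3 + a x^2 + b x + c = (k x + n)^2\<close>. Since
    \<open>1 - l x = m y\<close> on the line, the symmetric functions of the three \<open>x\<close>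
    also give the sum of the three quotients \<open>x / y\<close>.\<close>
  define n where "n = y1 - k * x1"
  have mn: "m * n = 1" using line1 km unfolding n_def by algebra
  have e1: "x1 + x2 + x3 = k^2 - a" by (simp add: x3_def)
  have e2: "x1 * x2 + x1 * x3 + x2 * x3 = b - 2 * k * n"
    using k1 k2 unfolding x3_def n_def by algebra
  have e3: "x1 * x2 * x3 = n^2 - c"
    using k1 k2 on(1) unfolding x3_def n_def W_def on_wcurve by algebra
  have "m^2 * ((1 - l * x1) * (1 - l * x2) * (1 - l * x3) - d) = 0"
    using e1 e2 e3 mn km unfolding d_def by algebra
  then have prod: "(1 - l * x1) * (1 - l * x2) * (1 - l * x3) = d" using m0 by simp
  have "m^2 * (x1 * (1 - l * x2) * (1 - l * x3) + x2 * (1 - l * x1) * (1 - l * x3)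
      + x3 * (1 - l * x1) * (1 - l * x2) + (a + 2 * b * l + 3 * c * l^2)) = 0"
    using e1 e2 e3 mn km by algebra
  then have sum3: "x1 * (1 - l * x2) * (1 - l * x3) + x2 * (1 - l * x1) * (1 - l * x3)
      + x3 * (1 - l * x1) * (1 - l * x2) = - (a + 2 * b * l + 3 * c * l^2)" using m0 by algebra
  define u where "u = x3 / y3"
  have u: "x3 = u * y3" using y3 by (simp add: u_def)
  have z: "1 - l * x1 = m * y1" "1 - l * x2 = m * y2" "1 - l * x3 = - m * y3"
    using line1 line2 line3 by algebra+
  have d': "d = (m * y1) * (m * y2) * (- m * y3)"
    using prod unfolding z by simp
  have "d * (u - t - 1) = m * (- (x3 * (m * y1) * (m * y2) + x1 * (m * y2) * (- m * y3) + x2 * (m * y1) * (- m * y3)))"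
    unfolding d' u xy(1) t2 by algebra
  also have "\<dots> = (a + 2 * b * l + 3 * c * l^2) * m"
    using sum3 unfolding z by algebra
  finally have "d * (x3 / y3 - t - 1) = (a + 2 * b * l + 3 * c * l^2) * m"
    unfolding u_def .
  moreover have "1 / y3 = l * (x3 / y3) - m" using line3 y3 by (simp add: field_simps)
  moreover have "l * (1 - a - b * (w + v) - c * (w^2 + w * v + v^2)) = t^2 + t + 1 + a * (t + 1) * w + b * w^2"
    using lU unfolding U_def V_def by (simp add: algebra_simps)
  ultimately show ?thesis
    using that[OF sum y3 l m, of d] m_def d_def unfolding t_def w_def v_def by simp
qed

end

section \<open>Reduction modulo a prime\<close>

fun tpar :: "rat point \<Rightarrow> rat" where
  "tpar Infinity = 0"
| "tpar (Affine x y) = x / y"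

text \<open>For \<open>a = 0\<close> the logarithm of the formal group modulo \<open>p\<^sup>2\<close> is
  \<open>t + 2/5 b t\<^sup>5 + 3/7 c t\<^sup>7\<close> as soon as \<open>p\<close> divides \<open>b\<close> and \<open>c\<close>; here it is cleared of denominators.\<close>

definition formal_log :: "rat \<Rightarrow> rat \<Rightarrow> rat \<Rightarrow> rat" where
  "formal_log b c t = 35 * t + 14 * b * t^5 + 15 * c * t^7"

context
  fixes p :: nat
  assumes p: "prime p"
begin

text \<open>With coefficients divisible by \<open>p\<close> the reduction is the cuspidal curve
  \<open>w = t^3\<close>, whose smooth points form the additive group with coordinate
  \<open>t\<close>. The predicate says that \<open>Q\<close> reduces to the smooth point with
  parameter \<open>n\<close>; the cusp has no finite \<open>w\<close> and is excluded by
  integrality.\<close>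

definition near :: "nat \<Rightarrow> rat point \<Rightarrow> bool" where
  "near n Q \<longleftrightarrow> vge p 1 (tpar Q - of_nat n) \<and>
     (Q = Infinity \<or> (\<exists>x y. Q = Affine x y \<and> y \<noteq> 0 \<and> vge p 0 (x / y) \<and> vge p 0 (1 / y)))"

lemmas vge_rules = vge_intros[OF p] vge_numeral[OF p]

text \<open>Additivity of the logarithm modulo \<open>p^2\<close> when the second point has
  parameter 1. For the cusp itself, slope and intercept are \<open>\<kappa>\<close> and
  \<open>\<mu>\<close>, so \<open>t3\<close> exceeds \<open>t + 1\<close> by about
  \<open>(2 b \<kappa> + 3 c \<kappa>^2) \<mu>\<close>. The identities \<open>a5\<close> and
  \<open>a7\<close> show that the terms in \<open>t^5\<close> and \<open>t^7\<close> cancel exactly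
  this; every remaining error has two factors divisible by \<open>p\<close>.\<close>

lemma formal_log_step:
  assumes bc: "vge p 1 b" "vge p 1 c"
    and int: "vge p 0 t" "vge p 0 w" "vge p 0 v" "vge p 0 l" "vge p 0 m"
    and cw: "w = t^3 + b * t * w^2 + c * w^3"
    and l: "l * (1 - b * (w + v) - c * (w^2 + w * v + v^2)) = t^2 + t + 1 + b * w^2"
    and m: "m = w - l * t" and d: "d = 1 + b * l^2 + c * l^3"
    and t3: "d * (t3 - t - 1) = (2 * b * l + 3 * c * l^2) * m"
  shows "vge p 2 (formal_log b c t3 - formal_log b c t - formal_log b c 1)"
proof -
  define s \<kappa> \<mu> \<delta> where "s = t + 1" and "\<kappa> = t^2 + t + 1" and "\<mu> = - t * s" and "\<delta> = t3 - t - 1"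
  have int': "vge p 0 s" "vge p 0 \<kappa>" "vge p 0 \<mu>"
    unfolding s_def \<kappa>_def \<mu>_def by (intro vge_rules int)+
  have "l - \<kappa> = b * w^2 + b * (w + v) * l + c * (w^2 + w * v + v^2) * l"
    using l unfolding \<kappa>_def by algebra
  moreover have "vge p 1 (b * w^2 + b * (w + v) * l + c * (w^2 + w * v + v^2) * l)"
    by (intro vge_rules int bc)
  ultimately have l1: "vge p 1 (l - \<kappa>)" by simp
  have "w - t^3 = b * t * w^2 + c * w^3" using cw by simp
  moreover have "vge p 1 (b * t * w^2 + c * w^3)"
    by (intro vge_rules int bc)
  ultimately have w1: "vge p 1 (w - t^3)" by simp
  have "m - \<mu> = (w - t^3) - (l - \<kappa>) * t"
    unfolding m \<mu>_def \<kappa>_def s_def by algebra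
  moreover have "vge p 1 ((w - t^3) - (l - \<kappa>) * t)"
    by (intro vge_rules int l1 w1)
  ultimately have m1: "vge p 1 (m - \<mu>)" by simp
  have d1: "vge p 1 (d - 1)"
  proof -
    have "d - 1 = b * l^2 + c * l^3" by (simp add: d)
    moreover have "vge p 1 (b * l^2 + c * l^3)" by (intro vge_rules int bc)
    ultimately show ?thesis by simp
  qed
  then have du: "d \<noteq> 0" "rval p d = 0" using unit_1_add[OF p, of "d - 1"] by simp_all
  have "vge p 1 (d * \<delta>)"
  proof -
    have "d * \<delta> = (b * (2 * l) + c * (3 * l^2)) * m" using t3 unfolding \<delta>_def by algebra
    moreover have "vge p 1 ((b * (2 * l) + c * (3 * l^2)) * m)" by (intro vge_rules bc int)
    ultimately show ?thesis by simp
  qed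
  then have "vge p 1 (d * \<delta> / d)" using vge_divide_unit[OF p du(2,1)] by blast
  then have \<delta>: "vge p 1 \<delta>" using du by simp
  have t3': "t3 = s + \<delta>" by (simp add: \<delta>_def s_def)
  then have int3: "vge p 0 t3" using vge_mono[OF p \<delta>, of 0] int' by (simp add: vge_add[OF p])
  have two: "vge p 2 (x * y)" if "vge p 1 x" "vge p 1 y" for x y
    using vge_mult[OF p that] by simp
  have n: "vge p 0 (numeral k)" for k by (simp add: p)
  have "formal_log b c t3 - formal_log b c t - formal_log b c 1 =
    \<delta> * (35 * (1 - d)) + 70 * (b * ((l - \<kappa>) * m + (m - \<mu>) * \<kappa>))
    + 105 * (c * ((l - \<kappa>) * (l + \<kappa>) * m + (m - \<mu>) * \<kappa>^2))
    + 14 * (b * (\<delta> * (t3^4 + t3^3 * s + t3^2 * s^2 + t3 * s^3 + s^4)))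
    + 15 * (c * (\<delta> * (t3^6 + t3^5 * s + t3^4 * s^2 + t3^3 * s^3 + t3^2 * s^4 + t3 * s^5 + s^6)))"
  proof -
    have a5: "s^5 - t^5 - 1 = - 5 * \<kappa> * \<mu>" and a7: "s^7 - t^7 - 1 = - 7 * \<kappa>^2 * \<mu>"
      unfolding s_def \<kappa>_def \<mu>_def by algebra+
    have b5: "t3^5 - s^5 = \<delta> * (t3^4 + t3^3 * s + t3^2 * s^2 + t3 * s^3 + s^4)"
      unfolding t3' by algebra
    have b7: "t3^7 - s^7 = \<delta> * (t3^6 + t3^5 * s + t3^4 * s^2 + t3^3 * s^3 + t3^2 * s^4 + t3 * s^5 + s^6)"
      unfolding t3' by algebra
    have t3'': "d * \<delta> = (2 * b * l + 3 * c * l^2) * m" using t3 by (simp add: \<delta>_def)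
    have "formal_log b c t3 - formal_log b c t - formal_log b c 1 =
      35 * \<delta> + 14 * b * (t3^5 - s^5) + 14 * b * (s^5 - t^5 - 1) + 15 * c * (t3^7 - s^7) + 15 * c * (s^7 - t^7 - 1)"
      by (simp add: formal_log_def \<delta>_def algebra_simps)
    then show ?thesis unfolding a5 a7 b5 b7 using t3'' by algebra
  qed
  moreover have "vge p 2 \<dots>"
  proof -
    have "vge p 1 (35 * (1 - d))"
      using vge_uminus[OF p, of 1 "d - 1"] d1 by (intro vge_mult0(1)[OF p n]) simp
    then have g1: "vge p 2 (\<delta> * (35 * (1 - d)))" by (rule two[OF \<delta>])
    have g2: "vge p 2 (b * ((l - \<kappa>) * m + (m - \<mu>) * \<kappa>))"
      by (intro two bc vge_rules l1 m1 int int')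
    have g3: "vge p 2 (c * ((l - \<kappa>) * (l + \<kappa>) * m + (m - \<mu>) * \<kappa>^2))"
      by (intro two bc vge_rules l1 m1 int int')
    have g4: "vge p 2 (b * (\<delta> * (t3^4 + t3^3 * s + t3^2 * s^2 + t3 * s^3 + s^4)))"
      by (intro two bc vge_rules \<delta> int' int3)
    have g5: "vge p 2 (c * (\<delta> * (t3^6 + t3^5 * s + t3^4 * s^2 + t3^3 * s^3 + t3^2 * s^4 + t3 * s^5 + s^6)))"
      by (intro two bc vge_rules \<delta> int' int3)
    show ?thesis
      by (intro g1 g2 g3 g4 g5 vge_add[OF p] vge_mult0(1)[OF p n])
  qed
  ultimately show ?thesis by simp
qed

lemma near_step:
  fixes a b c :: rat
  defines "W \<equiv> wcurve a b c"
  assumes abc: "vge p 1 a" "vge p 1 b" "vge p 1 c"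
    and on: "on_curve W Q" "on_curve W (Affine x0 x0)" and x0: "x0 \<noteq> 0" "vge p 0 (1 / x0)"
    and near: "near n Q"
  shows "near (Suc n) (add_point W Q (Affine x0 x0))"
    and "a = 0 \<Longrightarrow> vge p 2 (formal_log b c (tpar Q) - of_nat n * formal_log b c 1) \<Longrightarrow>
      vge p 2 (formal_log b c (tpar (add_point W Q (Affine x0 x0))) - of_nat (Suc n) * formal_log b c 1)"
proof -
  have P1: "vge p 1 (tpar Q - of_nat n)" using near by (simp add: near_def)
  consider "Q = Infinity" | "Q = Affine x0 (- x0)" 
    | x y where "Q = Affine x y" "y \<noteq> 0" "vge p 0 (x / y)" "vge p 0 (1 / y)" "\<not> (x = x0 \<and> x0 = - y)"
    using near unfolding near_def by (metis minus_minus)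
  then have "near (Suc n) (add_point W Q (Affine x0 x0)) \<and> (a = 0 \<longrightarrow> vge p 2 (formal_log b c (tpar Q) - of_nat n * formal_log b c 1) \<longrightarrow>
      vge p 2 (formal_log b c (tpar (add_point W Q (Affine x0 x0))) - of_nat (Suc n) * formal_log b c 1))"
  proof cases
    case 1
    have "tpar (Affine x0 x0) - of_nat (Suc n) = tpar Q - of_nat n"
      "formal_log b c (tpar (Affine x0 x0)) - of_nat (Suc n) * formal_log b c 1 = 
        formal_log b c (tpar Q) - of_nat n * formal_log b c 1"
      using 1 x0 by (simp_all add: formal_log_def algebra_simps)
    then show ?thesis using P1 x0 1 p by (auto simp: near_def)
  next
    case 2
    then have sum: "add_point W Q (Affine x0 x0) = Infinity"
      by (simp add: W_def add_point.simps(3))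
    have "tpar Infinity - of_nat (Suc n) = tpar Q - of_nat n"
      "formal_log b c (tpar Infinity) - of_nat (Suc n) * formal_log b c 1 = 
        formal_log b c (tpar Q) - of_nat n * formal_log b c 1"
      using 2 x0 by (simp_all add: formal_log_def algebra_simps)
    then show ?thesis using P1 unfolding near_def sum by auto
  next
    case (3 x y)
    obtain x3 y3 l m d where *: "add_point W (Affine x y) (Affine x0 x0) = Affine x3 y3" "y3 \<noteq> 0"
      "vge p 0 l" "vge p 0 m" "d = 1 + a * l + b * l^2 + c * l^3"
      "d * (x3 / y3 - x / y - 1) = (a + 2 * b * l + 3 * c * l^2) * m"
      "1 / y3 = l * (x3 / y3) - m" "m = 1 / y - l * (x / y)"
      "l * (1 - a - b * (1 / y + 1 / x0) - c * ((1 / y)^2 + 1 / y * (1 / x0) + (1 / x0)^2)) =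
        (x / y)^2 + x / y + 1 + a * (x / y + 1) * (1 / y) + b * (1 / y)^2"
      by (rule add_point_tw[OF p abc, of x y x0 x0, folded W_def])
         (use on x0 3 in auto)
    define e where "e = a * l + b * l^2 + c * l^3"
    have e: "vge p 1 e" unfolding e_def by (intro vge_rules abc *)
    have d: "d \<noteq> 0" "rval p d = 0"
      using unit_1_add[OF p e] *(5) by (simp_all add: e_def algebra_simps)
    have "vge p 1 (d * (x3 / y3 - x / y - 1))"
    proof -
      have "d * (x3 / y3 - x / y - 1) = (a + b * (2 * l) + c * (3 * l^2)) * m" using *(6) by algebra
      moreover have "vge p 1 ((a + b * (2 * l) + c * (3 * l^2)) * m)" by (intro vge_rules abc *)
      ultimately show ?thesis by simp
    qed
    then have "vge p 1 (d * (x3 / y3 - x / y - 1) / d)" using vge_divide_unit[OF p d(2,1)] by blast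
    then have \<delta>: "vge p 1 (x3 / y3 - x / y - 1)" using d by simp
    have "x3 / y3 = (x3 / y3 - x / y - 1) + x / y + 1" by simp
    then have t3: "vge p 0 (x3 / y3)"
      using vge_add[OF p vge_add[OF p vge_mono[OF p \<delta>, of 0] 3(3)], of 1] p by simp
    have w3: "vge p 0 (1 / y3)" unfolding *(7) by (intro vge_rules * t3)
    have "x3 / y3 - of_nat (Suc n) = (x3 / y3 - x / y - 1) + (x / y - of_nat n)" by simp
    moreover have "vge p 1 (x / y - of_nat n)" using P1 3(1) by simp
    then have "vge p 1 ((x3 / y3 - x / y - 1) + (x / y - of_nat n))" by (rule vge_add[OF p \<delta>])
    ultimately have "vge p 1 (x3 / y3 - of_nat (Suc n))" by metis
    then have "near (Suc n) (Affine x3 y3)"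
      using *(2) t3 w3 by (auto simp: near_def)
    moreover have "vge p 2 (formal_log b c (x3 / y3) - of_nat (Suc n) * formal_log b c 1)"
      if "a = 0" "vge p 2 (formal_log b c (x / y) - of_nat n * formal_log b c 1)"
    proof -
      have "y^2 = x^3 + b * x + c" using on(1) unfolding W_def 3(1) on_wcurve by (simp add: that)
      then have cw: "1 / y = (x / y)^3 + b * (x / y) * (1 / y)^2 + c * (1 / y)^3"
      proof -
        have "(x / y)^3 + b * (x / y) * (1 / y)^2 + c * (1 / y)^3 = (x^3 + b * x + c) / y^3"
          by (simp add: add_divide_distrib power_divide power2_eq_square power3_eq_cube)
        also have "\<dots> = y^2 / y^3" using \<open>y^2 = x^3 + b * x + c\<close> by simp
        finally show ?thesis by (simp add: power2_eq_square power3_eq_cube)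
      qed
      have "vge p 2 (formal_log b c (x3 / y3) - formal_log b c (x / y) - formal_log b c 1)"
        by (rule formal_log_step[OF abc(2,3) 3(3,4) x0(2) *(3,4) cw _ *(8), of d])
          (use *(5,6,9) that in \<open>simp_all add: algebra_simps\<close>)
      then have "vge p 2 ((formal_log b c (x3 / y3) - formal_log b c (x / y) - formal_log b c 1) +
        (formal_log b c (x / y) - of_nat n * formal_log b c 1))"
        using that(2) by (rule vge_add[OF p])
      then show ?thesis by (simp add: algebra_simps)
    qed
    ultimately show ?thesis using *(1) 3(1) by simp
  qed
  then show "near (Suc n) (add_point W Q (Affine x0 x0))"
    and "a = 0 \<Longrightarrow> vge p 2 (formal_log b c (tpar Q) - of_nat n * formal_log b c 1) \<Longrightarrow>
      vge p 2 (formal_log b c (tpar (add_point W Q (Affine x0 x0))) - of_nat (Suc n) * formal_log b c 1)"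
    by blast+
qed

end

section \<open>Primes ramified in the field of the 2-torsion\<close>

context
  fixes p :: nat
  assumes p: "prime p"
begin

text \<open>The \<open>k\<close>-th multiple of a point with parameter 1 has parameter
  \<open>k\<close> modulo \<open>p\<close>, which gives \<open>p dvd n\<close>. One order finer,
  \<open>n * formal_log b c 1\<close> vanishes modulo \<open>p^2\<close>; this fails for
  \<open>n = p \<ge> 11\<close>, because \<open>formal_log b c 1\<close> is 35 plus a multiple of
  \<open>p\<close>, hence a unit.\<close>

lemma normalised_torsion:
  fixes a b c :: rat
  defines "W \<equiv> wcurve a b c"
  assumes E: "elliptic_curve W" and abc: "vge p 1 a" "vge p 1 b" "vge p 1 c"
    and on: "on_curve W (Affine x0 x0)" and x0: "x0 \<noteq> 0" "vge p 0 (1 / x0)"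
    and tors: "Affine x0 x0 [^]\<^bsub>point_group W\<^esub> n = Infinity"
  shows "p dvd n" and "a = 0 \<Longrightarrow> p \<ge> 11 \<Longrightarrow> n \<noteq> p"
proof -
  interpret comm_group "point_group W" using comm_group_point_group[OF E] .
  have "near p k (Affine x0 x0 [^]\<^bsub>point_group W\<^esub> k) \<and> (a = 0 \<longrightarrow>
    vge p 2 (formal_log b c (tpar (Affine x0 x0 [^]\<^bsub>point_group W\<^esub> k)) - of_nat k * formal_log b c 1))" for k
  proof (induction k)
    case 0
    then show ?case by (simp add: near_def[OF p] formal_log_def)
  next
    case (Suc k)
    have "on_curve W (Affine x0 x0 [^]\<^bsub>point_group W\<^esub> k)"
      using nat_pow_closed[of "Affine x0 x0" k] on by simp
    from near_step[OF p abc, folded W_def, OF this on x0 conjunct1[OF Suc]] show ?case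
      using Suc by (simp del: of_nat_Suc)
  qed
  from this[of n] have n: "vge p 1 (of_nat n)" "a = 0 \<Longrightarrow> vge p 2 (of_nat n * formal_log b c 1)"
    unfolding tors by (auto simp: near_def[OF p] formal_log_def vge_uminus[OF p])
  show "p dvd n" using n(1) vge_1_of_nat[OF p] by simp
  show "n \<noteq> p" if a: "a = 0" and p11: "p \<ge> 11"
  proof
    assume np: "n = p"
    define e where "e = (14 * b + 15 * c) / 35"
    have "\<not> p dvd 35"
    proof
      assume "p dvd 35"
      then have "p dvd 5 \<or> p dvd 7" using prime_dvd_mult_iff[OF p, of 5 7] by simp
      then show False using p11 by (auto dest: dvd_imp_le)
    qed
    then have "multiplicity (int p) 35 = 0"
      by (metis int_dvd_int_iff not_dvd_imp_multiplicity_0 of_nat_numeral)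
    then have r35: "rval p 35 = 0" using rval_of_int[OF p, of 35] by simp
    have "vge p 1 e" unfolding e_def
      by (subst vge_divide_unit[OF p r35]) (simp, intro vge_add[OF p] vge_mult0(1)[OF p] vge_numeral[OF p] abc)
    then have u: "1 + e \<noteq> 0" "rval p (1 + e) = 0" using unit_1_add[OF p] by auto
    have "formal_log b c 1 = 35 * (1 + e)" by (simp add: formal_log_def e_def)
    then have "vge p 2 (of_nat p * (35 * (1 + e)))" using n(2)[OF a] np by simp
    moreover have "rval p (of_nat p * (35 * (1 + e))) = 1"
      using rval_of_int[OF p, of "int p"] p u r35
      by (simp add: rval_mult[OF p] del: distrib_left_numeral)
    moreover have "of_nat p * (35 * (1 + e)) \<noteq> 0" using u p by (simp del: distrib_left_numeral)
    ultimately show False by (simp add: vge_def)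
  qed
qed

text \<open>If \<open>x\<close> dominates the coefficients, the size of the point itself provides a
  rational scaling after which all coefficients are divisible by \<open>p\<close>.\<close>

lemma kernel_torsion:
  fixes a b c x y :: rat
  defines "W \<equiv> wcurve a b c"
  assumes E: "elliptic_curve W" and on: "on_curve W (Affine x y)" and x: "x \<noteq> 0"
    and abc: "vge p 1 (a / x)" "vge p 1 (b / x^2)" "vge p 1 (c / x^3)"
    and tors: "Affine x y [^]\<^bsub>point_group W\<^esub> n = Infinity"
  shows "p dvd n" and "a = 0 \<Longrightarrow> p \<ge> 11 \<Longrightarrow> n \<noteq> p"
proof -
  define e where "e = 1 + (a / x + b / x^2 + c / x^3)"
  have e: "e \<noteq> 0" "rval p e = 0"
    unfolding e_def by (rule unit_1_add[OF p]; intro vge_add[OF p] abc)+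
  have ye: "y^2 = x^3 * e"
    using on x unfolding W_def on_wcurve e_def
    by (simp add: field_simps power2_eq_square power3_eq_cube)
  then have y: "y \<noteq> 0" using x e by auto
  \<comment> \<open>In the model scaled by \<open>u\<close> the point has equal coordinates, that
    is, parameter 1.\<close>
  define u where "u = y / x"
  have u: "u \<noteq> 0" using x y by (simp add: u_def)
  have u2: "u^2 = x * e" using ye x by (simp add: u_def power_divide power2_eq_square power3_eq_cube)
  have u4: "u^4 = x^2 * e^2" and u6: "u^6 = x^3 * e^3"
    using u2 by algebra+
  have u3: "u^3 = y * e" using u2 x by (simp add: u_def power3_eq_cube power2_eq_square)
  define x0 where "x0 = 1 / e"
  have "x / u^2 = x0" "y / u^3 = x0"
    using x e y unfolding x0_def u2 u3 by simp_all
  then have tr: "transport u 0 0 0 (Affine x y) = Affine x0 x0" by simp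
  define V where "V = wcurve (a / u^2) (b / u^4) (c / u^6)"
  have V: "change_variables u 0 0 0 W = V" by (simp add: W_def V_def)
  have EV: "elliptic_curve V" using elliptic_curve_change_variables[OF u, of 0 0 0 W] E V by simp
  have onV: "on_curve V (Affine x0 x0)" using on_curve_transport[OF u, of 0 0 0 W "Affine x y"] on tr V by simp
  have torsV: "Affine x0 x0 [^]\<^bsub>point_group V\<^esub> n = Infinity"
    using transport_pow[OF u E on, of 0 0 0 n] tors tr V by simp
  have ek: "e^k \<noteq> 0" "rval p (e^k) = 0" for k using e p by simp_all
  have v: "vge p 1 (a / u^2)" "vge p 1 (b / u^4)" "vge p 1 (c / u^6)"
    using abc vge_divide_unit[OF p ek(2,1)] vge_divide_unit[OF p e(2,1)] unfolding u2 u4 u6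
    by (simp_all flip: divide_divide_eq_left)
  have "x0 \<noteq> 0" "vge p 0 (1 / x0)" using e by (simp_all add: x0_def vge_def)
  from normalised_torsion[OF EV[unfolded V_def] v onV[unfolded V_def] this torsV[unfolded V_def]]
  show "p dvd n" "a = 0 \<Longrightarrow> p \<ge> 11 \<Longrightarrow> n \<noteq> p" by simp_all
qed

text \<open>The factor 3 accounts for the thirds of integers which occur as valuations after adjoining the
  cube root of a coefficient.\<close>

definition vgt3 :: "int \<Rightarrow> rat \<Rightarrow> bool" where
  "vgt3 r q \<longleftrightarrow> q = 0 \<or> r < 3 * rval p q"

lemma vgt3_vge: "vgt3 r q \<longleftrightarrow> vge p (r div 3 + 1) q"
proof -
  have "r < 3 * v \<longleftrightarrow> r div 3 + 1 \<le> v" for v by presburger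
  then show ?thesis by (simp add: vgt3_def vge_def)
qed

lemma vgt3_add: "vgt3 r x \<Longrightarrow> vgt3 r y \<Longrightarrow> vgt3 r (x + y)"
  unfolding vgt3_vge by (rule vge_add[OF p])

lemma vgt3_diff: "vgt3 r x \<Longrightarrow> vgt3 r y \<Longrightarrow> vgt3 r (x - y)"
  unfolding vgt3_vge by (rule vge_diff[OF p])

lemma vgt3_mult: "vgt3 r x \<Longrightarrow> vgt3 s y \<Longrightarrow> vgt3 (r + s) (x * y)"
  unfolding vgt3_def by (cases "x = 0 \<or> y = 0") (auto simp: rval_mult[OF p])

lemma vgt3_numeral: "vgt3 r x \<Longrightarrow> vgt3 r (numeral k * x)"
  unfolding vgt3_vge by (rule vge_mult0(1)[OF p]) (rule vge_numeral[OF p])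

text \<open>After the ramified scaling by the cube root of \<open>c\<close> the curve reduces to \<open>y\<^sup>2 = x\<^sup>3 + e\<close>, and
  \<open>3 P\<close> lies in the kernel of reduction because no point over the base field can reduce to
  anything but infinity or one of the two inflection points with \<open>x = 0\<close>.\<close>

lemma triple_in_kernel:
  fixes a b c x y :: rat
  defines "W \<equiv> wcurve a b c" and "near_inf \<equiv> \<lambda>P. \<exists>x y. P = Affine x y \<and> x \<noteq> 0 \<and> 3 * rval p x < rval p c"
  assumes p2: "p \<noteq> 2" and c: "c \<noteq> 0" "\<not> 3 dvd rval p c" and ab: "vgt3 (rval p c) a" "vgt3 (2 * rval p c) b"
    and on: "on_curve W (Affine x y)" and notin: "\<not> near_inf (Affine x y)"
  defines "R \<equiv> add_point W (add_point W (Affine x y) (Affine x y)) (Affine x y)"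
  shows "R = Infinity \<or> near_inf R"
proof -
  define m where "m = rval p c"
  have x: "vgt3 m x"
  proof -
    \<comment> \<open>Here the ramification is used: \<open>m\<close> is not a multiple of 3, so
      after the scaling \<open>x\<close> cannot be a unit.\<close>
    have "3 * rval p x \<noteq> m" using c(2) unfolding m_def by (metis dvd_triv_left)
    then show ?thesis using notin unfolding near_inf_def m_def vgt3_def by fastforce
  qed
  have ab': "vgt3 m a" "vgt3 (2 * m) b" using ab by (simp_all add: m_def)
  have x2: "vgt3 (2 * m) (x^2)" using vgt3_mult[OF x x] by (simp add: power2_eq_square)
  have x3: "vgt3 (3 * m) (x^3)" using vgt3_mult[OF x x2] by (simp add: power2_eq_square power3_eq_cube mult.assoc)
  have "vgt3 (3 * m) (x^3 + a * x^2 + b * x)"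
  proof -
    have "vgt3 (3 * m) (a * x^2)" using vgt3_mult[OF ab'(1) x2] by simp
    moreover have "vgt3 (3 * m) (b * x)" using vgt3_mult[OF ab'(2) x] by simp
    ultimately show ?thesis using x3 vgt3_add by blast
  qed
  then have "vge p (rval p c + 1) (x^3 + a * x^2 + b * x)" by (simp add: vgt3_vge m_def)
  then have "c + (x^3 + a * x^2 + b * x) \<noteq> 0" "rval p (c + (x^3 + a * x^2 + b * x)) = m"
    using rval_add_eq[OF p c(1)] by (simp_all add: m_def)
  moreover have "c + (x^3 + a * x^2 + b * x) = y^2"
    using on unfolding W_def on_wcurve by simp
  ultimately have "y^2 \<noteq> 0" "rval p (y^2) = m" by simp_all
  then have y: "y \<noteq> 0" and my: "m = 2 * rval p y" using p by auto
  define h where "h = rval p y"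
  have m: "m = 2 * h" using my by (simp add: h_def)
  have "multiplicity (int p) 2 = 0"
    using p p2 by (metis int_dvd_int_iff not_dvd_imp_multiplicity_0 of_nat_numeral primes_dvd_imp_eq two_is_prime_nat)
  then have "rval p 2 = 0" using rval_of_int[OF p, of 2] by simp
  then have r2y: "rval p (2 * y) = h" using y by (simp add: rval_mult[OF p] h_def)
  have "\<not> (x = x \<and> y = - y)" using y by simp
  then obtain k where k: "slope a b (x, y) (x, y) k"
    and sum2: "add_point W (Affine x y) (Affine x y) = Affine (k^2 - a - x - x) (- (y + k * (k^2 - a - x - x - x)))"
    using slope_exists[of a b c x y x y] on add_point_slope[of a b x y x y _ c] unfolding W_def by metis
  define x' where "x' = k^2 - a - x - x"
  define y' where "y' = - (y + k * (x' - x))"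
  have k2: "k * (2 * y) = 3 * x^2 + 2 * (a * x) + b"
    using k unfolding slope_def prod.case by (simp add: algebra_simps power2_eq_square)
  have "vgt3 (2 * m) (3 * x^2 + 2 * (a * x) + b)"
  proof -
    have "vgt3 (2 * m) (a * x)" using vgt3_mult[OF ab'(1) x] by simp
    then show ?thesis using x2 ab'(2) vgt3_add vgt3_numeral by blast
  qed
  then have "vgt3 (2 * m) (k * (2 * y))" using k2 by simp
  \<comment> \<open>After the scaling the tangent reduces to a horizontal one, as at the inflection
    points with \<open>x = 0\<close>.\<close>
  then have kh: "vgt3 h k"
  proof (cases "k = 0")
    case False
    then have "rval p (k * (2 * y)) = rval p k + h" using rval_mult[OF p False, of "2 * y"] y r2y by simp
    then show ?thesis using \<open>vgt3 (2 * m) (k * (2 * y))\<close> False y m unfolding vgt3_def by simp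
  qed (simp add: vgt3_def)
  have x': "vgt3 m x'"
  proof -
    have "vgt3 m (k^2)" using vgt3_mult[OF kh kh] m by (simp add: power2_eq_square)
    then show ?thesis unfolding x'_def using ab'(1) x vgt3_diff by blast
  qed
  define d where "d = x' - x"
  have d: "vgt3 m d" unfolding d_def using x x' by (rule vgt3_diff[rotated])
  have "vge p (h + 1) (k * d)" using vgt3_mult[OF kh d] m by (simp add: vgt3_vge)
  then have "vge p (rval p (2 * y) + 1) (k * d)" using r2y by simp
  then have ky: "2 * y + k * d \<noteq> 0" "rval p (2 * y + k * d) = h"
    using rval_add_eq[OF p, of "2 * y" "k * d"] y r2y by simp_all
  have yy: "y' - y = - (2 * y + k * d)" by (simp add: y'_def d_def)
  have sum2': "add_point W (Affine x y) (Affine x y) = Affine x' y'"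
    using sum2 by (simp add: x'_def y'_def)
  have on': "on_curve W (Affine x' y')"
    using add_point_closed[of a b c] on unfolding W_def[symmetric] sum2'[symmetric] by blast
  show ?thesis
  proof (cases "x' = x \<and> y = - y'")
    case True
    then have "R = Infinity" unfolding R_def sum2' by (simp add: W_def add_point.simps(3))
    then show ?thesis ..
  next
    case False
    obtain l where l: "slope a b (x', y') (x, y) l"
      using slope_exists[of a b c x' y' x y] on on' False unfolding W_def by blast
    have sum3: "R = Affine (l^2 - a - x' - x) (- (y' + l * (l^2 - a - x' - x - x')))"
      unfolding R_def sum2' using add_point_slope[OF l False, of c] by (simp add: W_def)
    \<comment> \<open>\<open>2 P\<close> and \<open>- P\<close> have the same reduction, so the
      chord through \<open>2 P\<close> and \<open>P\<close> becomes vertical: \<open>l\<close> is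
      large, and \<open>l^2\<close> dominates the \<open>x\<close>-coordinate of
      \<open>3 P\<close>.\<close>
    have ld: "l * d = - (2 * y + k * d)" using l yy unfolding slope_def prod.case d_def by simp
    then have nz: "l \<noteq> 0" "d \<noteq> 0" using ky by auto
    have "rval p l + rval p d = h"
      using rval_mult[OF p nz] ky ld rval_uminus[OF p, of "2 * y + k * d"] by simp
    then have lh: "3 * rval p l < h" using d nz m unfolding vgt3_def by auto
    have l2: "l^2 \<noteq> 0" "rval p (l^2) = 2 * rval p l" using nz p by simp_all
    have "vgt3 m (- a - x' - x)"
    proof -
      have "vgt3 m (0 - a)" by (rule vgt3_diff[OF _ ab'(1)]) (simp add: vgt3_def)
      then have "vgt3 m (0 - a - x' - x)" using x x' vgt3_diff by blast
      then show ?thesis by simp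
    qed
    then have "vge p (rval p (l^2) + 1) (- a - x' - x)"
      using lh m l2 unfolding vgt3_def vge_def by linarith
    then have "l^2 + (- a - x' - x) \<noteq> 0" "rval p (l^2 + (- a - x' - x)) = 2 * rval p l"
      using rval_add_eq[OF p l2(1)] l2 by simp_all
    moreover have "l^2 + (- a - x' - x) = l^2 - a - x' - x" by simp
    ultimately have "near_inf R" unfolding near_inf_def sum3 using lh m m_def by auto
    then show ?thesis ..
  qed
qed

text \<open>The point \<open>Q\<close> of the proof is \<open>P\<close> or \<open>3 P\<close>,
  whichever lies in the kernel of reduction after the ramified scaling; there \<open>x\<close>
  dominates the coefficients, as \<open>kernel_torsion\<close> demands.\<close>

theorem ramified_torsion:
  fixes a b c :: rat
  defines "W \<equiv> wcurve a b c"
  assumes E: "elliptic_curve W" and p2: "p \<noteq> 2" and c: "c \<noteq> 0" "\<not> 3 dvd rval p c"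
    and ab: "vgt3 (rval p c) a" "vgt3 (2 * rval p c) b"
    and on: "on_curve W P" and tors: "P [^]\<^bsub>point_group W\<^esub> n = Infinity"
    and three: "P [^]\<^bsub>point_group W\<^esub> (3::nat) \<noteq> Infinity"
  shows "p dvd n" and "a = 0 \<Longrightarrow> p \<ge> 11 \<Longrightarrow> n \<noteq> p"
proof -
  interpret comm_group "point_group W" using comm_group_point_group[OF E] .
  define R where "R = P [^]\<^bsub>point_group W\<^esub> (3::nat)"
  have P: "P \<in> carrier (point_group W)" using on by simp
  obtain x y where xy: "P = Affine x y" using three by (cases P) (auto simp: nat_pow_one[simplified])
  have R: "R = add_point W (add_point W P P) P"
    using P by (simp add: R_def numeral_3_eq_3)
  have onR: "on_curve W R" using nat_pow_closed[OF P, of 3] by (simp add: R_def)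
  have torsR: "R [^]\<^bsub>point_group W\<^esub> n = Infinity"
    using nat_pow_pow[OF P, of 3 n] nat_pow_pow[OF P, of n 3] tors nat_pow_one[of 3]
    by (simp add: R_def mult.commute)
  obtain Q x' y' where Q: "Q = Affine x' y'" "x' \<noteq> 0" "3 * rval p x' < rval p c"
    "on_curve W Q" "Q [^]\<^bsub>point_group W\<^esub> n = Infinity"
  proof (cases "x \<noteq> 0 \<and> 3 * rval p x < rval p c")
    case True
    then show ?thesis using that[of P x y] xy on tors by simp
  next
    case False
    then have "R = Infinity \<or> (\<exists>x y. R = Affine x y \<and> x \<noteq> 0 \<and> 3 * rval p x < rval p c)"
      using triple_in_kernel[OF p2 c ab, of x y] on unfolding R xy W_def by auto
    then show ?thesis using that[of R] onR torsR three unfolding R_def[symmetric] by auto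
  qed
  have "vge p 1 (a / x')" "vge p 1 (b / x'^2)" "vge p 1 (c / x'^3)"
    using ab c Q(2,3) p unfolding vgt3_def vge_def
    by (cases "a = 0"; cases "b = 0"; simp add: rval_divide[OF p])+
  from kernel_torsion[OF E[unfolded W_def] Q(4)[unfolded Q(1) W_def] Q(2) this Q(5)[unfolded Q(1) W_def]]
  show "p dvd n" and "a = 0 \<Longrightarrow> p \<ge> 11 \<Longrightarrow> n \<noteq> p" by simp_all
qed

end

section \<open>The prime 2\<close>

lemma vge_0_quotient:
  assumes p: "prime p" and x: "vge p 0 x"
  obtains a b where "x = of_int a / of_int b" "\<not> int p dvd b"
proof -
  obtain a b where q: "quotient_of x = (a, b)" by fastforce
  have b: "b > 0" "x = of_int a / of_int b" "coprime a b"
    using quotient_of_denom_pos[OF q] quotient_of_div[OF q] quotient_of_coprime[OF q] by auto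
  have "\<not> int p dvd b"
  proof
    assume pb: "int p dvd b"
    then have mb: "multiplicity (int p) b \<ge> 1"
      using b(1) p not_dvd_imp_multiplicity_0 by (metis multiplicity_gt_zero_iff One_nat_def Suc_leI less_irrefl not_prime_unit prime_int)
    have "int p dvd a"
    proof (cases "a = 0")
      case False
      then have "multiplicity (int p) a \<ge> 1"
        using x mb b rval_quotient[OF p False, of b] unfolding vge_def by auto
      then show ?thesis using not_dvd_imp_multiplicity_0 by fastforce
    qed simp
    then show False using pb b(3) p by (meson coprime_common_divisor not_prime_unit prime_int)
  qed
  then show ?thesis using that b(2) by blast
qed

text \<open>The residue field at 2 has a single nonzero element.\<close>

lemma odd_add_odd:
  assumes "vge 2 0 x" "vge 2 0 y" "\<not> vge 2 1 x" "\<not> vge 2 1 y"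
  shows "vge 2 1 (x + y)"
proof -
  note two = two_is_prime_nat
  obtain a b where x: "x = of_int a / of_int b" "odd b" using vge_0_quotient[OF two assms(1)] by auto
  obtain c d where y: "y = of_int c / of_int d" "odd d" using vge_0_quotient[OF two assms(2)] by auto
  have iff: "vge 2 1 (of_int e / of_int f) \<longleftrightarrow> even e" if "odd f" for e f :: int
  proof -
    have "rval 2 (of_int f) = 0"
      using rval_of_int[OF two, of f] that by (cases "f = 0") (auto simp: not_dvd_imp_multiplicity_0)
    moreover have "of_int f \<noteq> (0 :: rat)" using that by auto
    ultimately show ?thesis using vge_divide_unit[OF two] vge_1_of_int[OF two, of e] by simp
  qed
  have "x + y = of_int (a * d + c * b) / of_int (b * d)"
  proof -
    have "of_int b \<noteq> (0 :: rat)" "of_int d \<noteq> (0 :: rat)" using x(2) y(2) by auto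
    then show ?thesis unfolding x(1) y(1) by (simp add: add_frac_eq)
  qed
  then show ?thesis using iff x y assms(3,4) by (auto simp del: of_int_add of_int_mult)
qed

lemma vge_0_square:
  assumes p: "prime p" and "vge p 0 (x^2)"
  shows "vge p 0 x"
  using assms(2) p by (cases "x = 0") (auto simp: vge_def)

text \<open>After scaling, the cubic is \<open>X^3 + X + 1\<close> modulo 2, which has no root, so
  its values at integral arguments are units. For \<open>i = 1\<close> this gives \<open>y^2\<close>
  an odd valuation and leaves only the point at infinity. For \<open>i = 0\<close> all affine points
  of \<open>T\<close> have odd \<open>x\<close>, and a third multiple other than infinity leads to a
  contradiction modulo 4.\<close>

lemma odd_torsion_unramified_at_2_aux:
  fixes a b :: rat and n :: nat
  defines "W \<equiv> wcurve 0 a b"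
  assumes E: "elliptic_curve W" and ab: "a \<noteq> 0" "b \<noteq> 0" "rval 2 a = 2 * i" "rval 2 b = 3 * i" "i = 0 \<or> i = 1"
    and on: "on_curve W P" and tors: "P [^]\<^bsub>point_group W\<^esub> n = Infinity" and odd: "odd n"
  shows "P [^]\<^bsub>point_group W\<^esub> (3::nat) = Infinity"
proof -
  note two = two_is_prime_nat
  interpret comm_group "point_group W" using comm_group_point_group[OF E] .
  define T where "T = {Q. on_curve W Q \<and> Q [^]\<^bsub>point_group W\<^esub> n = Infinity}"
  have T_add: "add_point W Q R \<in> T" if "Q \<in> T" "R \<in> T" for Q R
    using that m_closed[of Q R] pow_mult_distrib[OF m_comm, of Q R n] nat_pow_one[of n]
    by (auto simp: T_def)
  \<comment> \<open>A point with larger denominator would lie in the kernel of reduction, where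
    torsion has even order.\<close>
  have int_x: "i \<le> rval 2 x" if "Affine x y \<in> T" "x \<noteq> 0" for x y
  proof (rule ccontr)
    assume "\<not> i \<le> rval 2 x"
    then have "vge 2 1 (a / x^2)" "vge 2 1 (b / x^3)"
      using ab \<open>x \<noteq> 0\<close> by (auto simp: vge_def rval_divide[OF two] rval_power[OF two])
    then have "2 dvd n"
      using kernel_torsion(1)[OF two E[unfolded W_def], of x y n] that by (auto simp: T_def W_def)
    then show False using odd by simp
  qed
  have even_prod: "vge 2 1 (x * (x^2 + u))" if "vge 2 0 x" "vge 2 0 u" "\<not> vge 2 1 u" for x u
  proof (cases "vge 2 1 x")
    case True
    then show ?thesis using that by (intro vge_intros[OF two])
  next
    case False
    then have "\<not> vge 2 1 (x^2)" using that(1) by (cases "x = 0") (auto simp: vge_def rval_power[OF two])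
    then have "vge 2 1 (x^2 + u)" using odd_add_odd[OF vge_power[OF two that(1)] that(2)] that(3) by blast
    then show ?thesis using vge_mult0(1)[OF two that(1)] by blast
  qed
  show ?thesis
  proof (cases "i = 0")
    case False
    then have i: "i = 1" using ab by simp
    have "P = Infinity"
    proof (cases P)
      case (Affine x y)
      have PT: "Affine x y \<in> T" using on tors Affine by (simp add: T_def)
      define X A B where "X = x / 2" and "A = a / 4" and "B = b / 8"
      have r2: "rval 2 2 = 1" using rval_of_int[OF two, of 2] by simp
      have r48: "rval 2 4 = 2" "rval 2 8 = 3"
        using rval_power[OF two, of 2 2] rval_power[OF two, of 2 3] r2 by simp_all
      have X: "vge 2 0 X" using int_x[OF PT] i r2 unfolding X_def vge_def
        by (cases "x = 0") (auto simp: rval_divide[OF two])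
      have A: "vge 2 0 A" "\<not> vge 2 1 A" and B: "B \<noteq> 0" "rval 2 B = 0"
        using ab i r48 by (auto simp: A_def B_def vge_def rval_divide[OF two])
      have "y^2 = 8 * (B + X * (X^2 + A))"
        using PT unfolding T_def W_def on_wcurve[of 0] by (simp add: X_def A_def B_def on_wcurve field_simps power2_eq_square power3_eq_cube)
      moreover have "B + X * (X^2 + A) \<noteq> 0" "rval 2 (B + X * (X^2 + A)) = 0"
        using rval_add_eq[OF two B(1)] even_prod[OF X A] B(2) by simp_all
      ultimately have "y \<noteq> 0" "rval 2 (y^2) = 3" using r48 by (auto simp: rval_mult[OF two] simp del: distrib_left_numeral)
      then have "2 * rval 2 y = 3" using rval_power[OF two, of y 2] by simp
      then show ?thesis by presburger
    qed
    then show ?thesis using nat_pow_one[of 3] by simp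
  next
    case i: True
    have A: "vge 2 0 a" "\<not> vge 2 1 a" and B: "b \<noteq> 0" "rval 2 b = 0"
      using ab i by (auto simp: vge_def)
    have fact: "vge 2 0 x \<and> y \<noteq> 0 \<and> rval 2 y = 0" if "Affine x y \<in> T" for x y
    proof -
      have x: "vge 2 0 x" using int_x[OF that] i unfolding vge_def by auto
      have "y^2 = b + x * (x^2 + a)"
        using that unfolding T_def W_def by (simp add: algebra_simps power2_eq_square power3_eq_cube)
      then have "y^2 \<noteq> 0" "rval 2 (y^2) = 0"
        using rval_add_eq[OF two B(1)] even_prod[OF x A] B(2) by simp_all
      then show ?thesis using x rval_power[OF two, of y 2] by auto
    qed
    have double: "\<exists>k. slope 0 a (x, y) (x, y) k \<and> vge 2 0 k \<and> \<not> vge 2 1 x \<and>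
        add_point W (Affine x y) (Affine x y) = Affine (k^2 - x - x) (- (y + k * (k^2 - x - x - x)))"
      if Q: "Affine x y \<in> T" for x y
    proof -
      have y: "\<not> (x = x \<and> y = - y)" using fact[OF Q] by simp
      obtain k where k: "slope 0 a (x, y) (x, y) k"
        using slope_exists[of 0 a b x y x y] y Q unfolding T_def W_def by blast
      have sum: "add_point W (Affine x y) (Affine x y) = Affine (k^2 - x - x) (- (y + k * (k^2 - x - x - x)))"
        using add_point_slope[OF k y, of b] by (simp add: W_def)
      \<comment> \<open>The double is again in \<open>T\<close>, so its \<open>x\<close> is
        integral, and so is the slope \<open>k\<close>. Then \<open>3 * x^2 + a = 2 * k * y\<close>
        is even with \<open>a\<close> odd, which makes \<open>x\<close> odd.\<close>
      have "vge 2 0 (k^2 - x - x)" using fact T_add[OF Q Q] unfolding sum by blast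
      then have "vge 2 0 (k^2 - x - x + x + x)" using fact[OF Q] by (intro vge_add[OF two]) auto
      then have k0: "vge 2 0 k" using vge_0_square[OF two] by simp
      have "k * (2 * y) = 3 * x^2 + a" using k by (simp add: slope_def power2_eq_square)
      moreover have "vge 2 1 (k * (2 * y))"
        using fact[OF Q] k0 vge_1_of_int[OF two, of 2] by (intro vge_mult0[OF two]) (auto simp: vge_def)
      ultimately have e: "vge 2 1 (3 * x^2 + a)" by simp
      have "\<not> vge 2 1 x"
      proof
        assume "vge 2 1 x"
        then have "vge 2 1 (3 * x^2)"
          using vge_power_pos[OF two, of x 1] vge_mult0(1)[OF two vge_numeral(1)[OF two], of 1 "x^2" num.One]
          by (intro vge_mult0(1)[OF two vge_numeral(1)[OF two]]) (simp add: numeral_2_eq_2)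
        then have "vge 2 1 (3 * x^2 + a - 3 * x^2)" by (rule vge_diff[OF two e])
        then show False using A by simp
      qed
      then show ?thesis using k k0 sum by blast
    qed
    have P: "P \<in> T" using on tors by (simp add: T_def)
    have triple: "P [^]\<^bsub>point_group W\<^esub> (3::nat) = add_point W (add_point W P P) P"
      using on by (simp add: numeral_3_eq_3)
    show ?thesis
    proof (cases P)
      case (Affine x y)
      have Q: "Affine x y \<in> T" using P Affine by simp
      obtain k where k: "slope 0 a (x, y) (x, y) k" "vge 2 0 k" "\<not> vge 2 1 x"
        "add_point W P P = Affine (k^2 - x - x) (- (y + k * (k^2 - x - x - x)))"
        using double[OF Q] Affine by blast
      define x' where "x' = k^2 - x - x"
      define y' where "y' = - (y + k * (x' - x))"
      have sum2: "add_point W P P = Affine x' y'" using k(4) by (simp add: x'_def y'_def)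
      have Q': "Affine x' y' \<in> T" using T_add[OF P P] sum2 by simp
      then have x': "\<not> vge 2 1 x'" using double by blast
      show ?thesis
      proof (rule ccontr)
        assume ne: "P [^]\<^bsub>point_group W\<^esub> (3::nat) \<noteq> Infinity"
        have opp: "\<not> (x' = x \<and> y = - y')"
        proof -
          have "add_point W (Affine x' y') (Affine x y) \<noteq> Infinity"
            using ne unfolding triple unfolding sum2 unfolding Affine .
          then show ?thesis by (auto simp: W_def add_point.simps(3))
        qed
        obtain l where l: "slope 0 a (x', y') (x, y) l"
          using slope_exists[of 0 a b x' y' x y] opp Q Q' unfolding T_def W_def by blast
        define x'' where "x'' = l^2 - x' - x"
        have sum3: "add_point W (Affine x' y') (Affine x y) = Affine x'' (- (y' + l * (x'' - x')))"
          using add_point_slope[OF l opp, of b] by (simp add: W_def x''_def)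
        have Q'': "Affine x'' (- (y' + l * (x'' - x'))) \<in> T" using T_add[OF Q' Q] sum3 by simp
        then have x'': "\<not> vge 2 1 x''" using double by blast
        have int: "vge 2 0 x" "vge 2 0 x'" "vge 2 0 x''" using fact Q Q' Q'' by blast+
        have odd3: "\<not> vge 2 1 (u + v + w)"
          if "vge 2 1 (u + v)" "\<not> vge 2 1 w" for u v w
          using vge_diff[OF two, of 1 "u + v + w" "u + v"] that by auto
        have "l^2 = x' + x + x''" by (simp add: x''_def)
        then have l2: "vge 2 0 (l^2)" "\<not> vge 2 1 (l^2)"
          using vge_add[OF two vge_add[OF two int(2,1)] int(3)] odd3 odd_add_odd[OF int(2,1) x' k(3)] x'' by simp_all
        have k2: "\<not> vge 2 1 (k^2)"
        proof -
          have "k^2 = x + x + x'" by (simp add: x'_def)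
          then show ?thesis using odd3[OF odd_add_odd[OF int(1,1) k(3,3)] x'] by (simp only: not_False_eq_True)
        qed
        have sq: "vge 2 1 (z^2)" if "vge 2 1 z" for z
          using vge_power_pos[OF two that, of 1] by (simp only: numeral_2_eq_2 One_nat_def)
        have lk: "vge 2 0 l" "\<not> vge 2 1 l" "\<not> vge 2 1 k"
          using l2 k2 vge_0_square[OF two l2(1)] sq by blast+
        \<comment> \<open>As \<open>l^2\<close> and \<open>k^2\<close> are sums of three odd
          numbers, \<open>l\<close> and \<open>k\<close> are odd. Both factors on the left are thus
          even, while the right side has valuation exactly 1.\<close>
        have "(l + k) * (x' - x) = - 2 * y"
          using l unfolding slope_def prod.case y'_def by (simp add: algebra_simps)
        moreover have "vge 2 1 (l + k)" using odd_add_odd lk k(2) by blast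
        moreover have "vge 2 1 (x' - x)"
          using odd_add_odd[OF int(2), of "- x"] int(1) x' k(3) by (simp add: vge_uminus[OF two])
        ultimately have "vge 2 (1 + 1) (- 2 * y)" using vge_mult[OF two] by metis
        moreover have "rval 2 (- 2 * y) = 1" "- 2 * y \<noteq> 0"
          using fact[OF Q] rval_mult[OF two, of "- 2" y] rval_uminus[OF two, of 2] rval_of_int[OF two, of 2] by simp_all
        ultimately show False by (simp add: vge_def)
      qed
    qed (use nat_pow_one[of 3] in simp)
  qed
qed

theorem odd_torsion_unramified_at_2:
  fixes a b :: rat and n :: nat
  defines "W \<equiv> wcurve 0 a b"
  assumes E: "elliptic_curve W" and ab: "a \<noteq> 0" "b \<noteq> 0" "rval 2 a = 2 * int i" "rval 2 b = 3 * int i"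
    and on: "on_curve W P" and tors: "P [^]\<^bsub>point_group W\<^esub> n = Infinity" and odd: "odd n"
  shows "P [^]\<^bsub>point_group W\<^esub> (3::nat) = Infinity"
proof -
  note two = two_is_prime_nat
  \<comment> \<open>Scaling by this power of 2 replaces \<open>i\<close> by \<open>i mod 2\<close>,
    the only part of the twist that matters.\<close>
  define u :: rat where "u = 2 ^ (i div 2)"
  have u: "u \<noteq> 0" "rval 2 u = int (i div 2)"
    using rval_power[OF two, of 2] rval_of_int[OF two, of 2] by (simp_all add: u_def)
  define V where "V = wcurve 0 (a / u^4) (b / u^6)"
  have V: "change_variables u 0 0 0 W = V" by (simp add: V_def W_def)
  have "transport u 0 0 0 P [^]\<^bsub>point_group V\<^esub> (3::nat) = Infinity"
    unfolding V_def
  proof (rule odd_torsion_unramified_at_2_aux)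
    show "elliptic_curve (wcurve 0 (a / u^4) (b / u^6))"
      using elliptic_curve_change_variables[OF u(1), of 0 0 0 W] E V V_def by simp
    show "a / u^4 \<noteq> 0" "b / u^6 \<noteq> 0" using ab u by simp_all
    show "rval 2 (a / u^4) = 2 * int (i mod 2)" "rval 2 (b / u^6) = 3 * int (i mod 2)"
      using ab u by (simp_all add: rval_divide[OF two] rval_power[OF two]) presburger+
    show "int (i mod 2) = 0 \<or> int (i mod 2) = 1" by presburger
    show "on_curve (wcurve 0 (a / u^4) (b / u^6)) (transport u 0 0 0 P)"
      using on_curve_transport[OF u(1), of 0 0 0 W P] on V V_def by simp
    show "transport u 0 0 0 P [^]\<^bsub>point_group (wcurve 0 (a / u^4) (b / u^6))\<^esub> n = Infinity"
      using transport_pow[OF u(1) E on, of 0 0 0 n] tors V V_def by simp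
  qed (rule odd)
  then show ?thesis using transport_pow[OF u(1) E on, of 0 0 0 3] V by simp
qed

section \<open>Eisenstein integers\<close>

text \<open>Fermat descent on \<open>m\<close>. The congruence \<open>m dvd a - r * b\<close>
  selects a generator of the ideal generated by \<open>m\<close> and \<open>r - \<omega>\<close>, so
  that the right one of two conjugate factors is found.\<close>

lemma eisenstein_norm_exists:
  fixes m r :: int
  assumes "m > 0" "m dvd r^2 + r + 1"
  shows "\<exists>a b. a^2 + a * b + b^2 = m \<and> m dvd a - r * b"
  using assms
proof (induction "nat m" arbitrary: m r rule: less_induct)
  case less
  show ?case
  proof (cases "m = 1")
    case True
    then show ?thesis by (intro exI[of _ 1] exI[of _ 0]) simp
  next
    case False
    \<comment> \<open>The residue of \<open>r\<close> closest to 0; it makes the norm of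
      \<open>s - \<omega>\<close> smaller than \<open>m^2\<close>.\<close>
    define s where "s = (r + m div 2) mod m - m div 2"
    have sr: "m dvd s - r"
    proof -
      have "m dvd (r + m div 2) mod m - (r + m div 2)"
        by (metis mod_eq_dvd_iff mod_mod_trivial)
      then show ?thesis by (simp add: s_def algebra_simps)
    qed
    have bounds: "- (m div 2) \<le> s" "s < m - m div 2"
      using less.prems(1) pos_mod_bound[of m "r + m div 2"] pos_mod_sign[of m "r + m div 2"]
      by (simp_all add: s_def)
    have "s^2 + s + 1 = (r^2 + r + 1) + (s - r) * (s + r + 1)" by algebra
    then have "m dvd s^2 + s + 1" using dvd_add[OF less.prems(2) dvd_mult2[OF sr]] by metis
    then obtain k where k: "s^2 + s + 1 = m * k" by (elim dvdE)
    have pos: "s^2 + s + 1 > 0"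
    proof -
      have eq: "4 * (s^2 + s + 1) = (2 * s + 1)^2 + 3" by algebra
      have "0 < 4 * (s^2 + s + 1)" unfolding eq using zero_le_power2[of "2 * s + 1"] by linarith
      then show ?thesis by simp
    qed
    then have k0: "k > 0" using k less.prems(1) by (metis zero_less_mult_pos)
    have "s^2 + s + 1 < m^2"
    proof -
      have "2 * s + 1 \<le> m" "- m \<le> 2 * s + 1" using bounds by linarith+
      then have "(2 * s + 1)^2 \<le> m^2" by (simp add: abs_le_square_iff[symmetric] abs_le_iff)
      moreover have "m^2 \<ge> 4" using False less.prems(1) power_mono[of 2 m 2] by simp
      moreover have eq: "4 * (s^2 + s + 1) = (2 * s + 1)^2 + 3" by algebra
      ultimately have "4 * (s^2 + s + 1) < 4 * m^2" unfolding eq by linarith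
      then show ?thesis by simp
    qed
    then have "k < m" using k less.prems(1) by (simp add: power2_eq_square)
    moreover have "k dvd s^2 + s + 1" using k by simp
    ultimately obtain a b where ab: "a^2 + a * b + b^2 = k" "k dvd a - s * b"
      using less.hyps[of k s] k0 by auto
    obtain q where q: "a - s * b = k * q" using ab(2) by (elim dvdE)
    \<comment> \<open>\<open>a' - b' \<omega>\<close> is \<open>(s - \<omega>)\<close> times the
      conjugate of \<open>a - b \<omega>\<close>, divided by \<open>k\<close>; the division is exact
      because \<open>k dvd a - s * b\<close>.\<close>
    define a' where "a' = q * s + m * b"
    define b' where "b' = q"
    have a': "k * a' = s * a + s * b + b" and b': "k * b' = a - s * b"
      using k q unfolding a'_def b'_def by algebra+
    have "k^2 * (a'^2 + a' * b' + b'^2 - m) = 0"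
      using a' b' ab(1) k by algebra
    then have "a'^2 + a' * b' + b'^2 = m" using k0 by simp
    moreover have "a' - r * b' = m * b + (s - r) * b'" by (simp add: a'_def b'_def algebra_simps)
    then have "m dvd a' - r * b'" using sr by simp
    ultimately show ?thesis by blast
  qed
qed


text \<open>Pairs \<open>(c, d)\<close> stand for the Eisenstein integers \<open>c - d \<omega>\<close>; the two polynomials below are the
  coordinates of the cube of \<open>a - b \<omega>\<close>.\<close>

definition cube_fst :: "int \<Rightarrow> int \<Rightarrow> int" where
  "cube_fst a b = a^3 - 3 * a * b^2 - b^3"

definition cube_snd :: "int \<Rightarrow> int \<Rightarrow> int" where
  "cube_snd a b = 3 * a * b * (a + b)"

lemma cube_minus: "cube_fst (- a) (- b) = - cube_fst a b" "cube_snd (- a) (- b) = - cube_snd a b"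
  by (simp_all add: cube_fst_def cube_snd_def algebra_simps power2_eq_square power3_eq_cube)

lemma cube_norm:
  "(cube_fst a b)^2 + cube_fst a b * cube_snd a b + (cube_snd a b)^2 = (a^2 + a * b + b^2)^3"
  unfolding cube_fst_def cube_snd_def by algebra

lemma eisenstein_units:
  fixes e f :: int
  assumes "e^2 + e * f + f^2 = 1"
  shows "(e, f) \<in> {(1, 0), (- 1, 0), (0, 1), (0, - 1), (1, - 1), (- 1, 1)}"
proof -
  have *: "(2 * x + y)^2 + 3 * y^2 = 4" if "x^2 + x * y + y^2 = 1" for x y :: int
    using that by algebra
  have bound: "\<bar>y\<bar> \<le> 1" if "x^2 + x * y + y^2 = 1" for x y :: int
  proof -
    have "3 * y^2 \<le> 4" using *[OF that] zero_le_power2[of "2 * x + y"] by linarith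
    then have "y^2 < 2^2" by simp
    then have "\<bar>y\<bar> < 2" using power2_less_imp_less[of "\<bar>y\<bar>" 2] by simp
    then show ?thesis by simp
  qed
  have "\<bar>f\<bar> \<le> 1" "\<bar>e\<bar> \<le> 1"
    using bound[of e f] bound[of f e] assms by (simp_all add: algebra_simps)
  then have "e \<in> {-1, 0, 1}" "f \<in> {-1, 0, 1}" by auto
  then show ?thesis using assms by auto
qed

text \<open>A primitive Eisenstein integer whose norm is a cube prime to 3 is a unit times a cube.
  Since - 1 is itself a cube, only the units 1, \<omega> and its square have to be
  distinguished.\<close>

lemma primitive_cube_norm:
  fixes c d m :: int
  assumes cop: "coprime c d" and norm: "c^2 + c * d + d^2 = m^3" and m: "m > 0" "\<not> 3 dvd m"
  obtains a b where "a^2 + a * b + b^2 = m"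
    "(c, d) \<in> {(cube_fst a b, cube_snd a b), (cube_snd a b, - cube_fst a b - cube_snd a b),
      (- cube_fst a b - cube_snd a b, cube_fst a b)}"
proof -
  have "coprime d (c^2)" using cop by (simp add: coprime_commute)
  moreover have "m^3 = c^2 + (c + d) * d" using norm by algebra
  ultimately have cop': "coprime (m^3) d"
    by (metis coprime_commute gcd_add_mult coprime_iff_gcd_eq_1 add.commute)
  then obtain i j where ij: "i * m^3 + j * d = 1" by (metis bezout_int coprime_iff_gcd_eq_1)
  \<comment> \<open>As \<open>j\<close> inverts \<open>d\<close> modulo \<open>m^3\<close>,
    \<open>r\<close> is the image of \<omega> under the reduction that kills
    \<open>c - d \<omega>\<close>.\<close>
  define r where "r = j * c"
  have cr: "c - r * d = m^3 * (i * c)" using ij unfolding r_def by algebra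
  have R: "m^3 dvd r^2 + r + 1"
  proof -
    have "d^2 * (r^2 + r + 1) = c^2 + c * d + d^2 - (c - r * d) * (c + r * d + d)" by algebra
    also have "\<dots> = m^3 * (1 - i * c * (c + r * d + d))" unfolding norm cr by algebra
    finally have "m^3 dvd d^2 * (r^2 + r + 1)" by simp
    then show ?thesis using cop' by (simp add: coprime_dvd_mult_right_iff)
  qed
  then obtain q where q: "r^2 + r + 1 = m^3 * q" by (elim dvdE)
  have "m dvd r^2 + r + 1" using R by (meson dvd_power dvd_trans zero_less_numeral)
  then obtain a b where ab: "a^2 + a * b + b^2 = m" "m dvd a - r * b"
    using eisenstein_norm_exists[OF m(1)] by blast
  obtain k where k: "a - r * b = m * k" using ab(2) by (elim dvdE)
  define X Y where "X = cube_fst a b" and "Y = cube_snd a b"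
  \<comment> \<open>\<open>u - v \<omega>\<close> is \<open>c - d \<omega>\<close> times the
    conjugate of the cube \<open>X - Y \<omega>\<close>. It is shown to be \<open>m^3\<close> times
    a unit.\<close>
  define u v where "u = c * (X + Y) + d * Y" and "v = d * X - c * Y"
  have 1: "m^3 dvd u - v * r"
  proof -
    have "u - v * r = m^3 * (i * c * (X + Y + r * Y) + q * d * Y)"
      using cr q unfolding u_def v_def by algebra
    then show ?thesis by simp
  qed
  \<comment> \<open>\<open>1\<close> and \<open>2\<close> evaluate \<open>u - v \<omega>\<close> at
    the two roots \<open>r\<close> and \<open>- 1 - r\<close> of \<open>x^2 + x + 1\<close> modulo
    \<open>m^3\<close>: the first kills \<open>c - d \<omega>\<close>, the second the conjugate
    cube.\<close>
  have 2: "m^3 dvd u + v * (1 + r)"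
  proof -
    have "X - r * Y = (a - r * b)^3 - (r^2 + r + 1) * (3 * a * b^2 - b^3 * (r - 1))"
      unfolding X_def Y_def cube_fst_def cube_snd_def by algebra
    also have "\<dots> = m^3 * (k^3 - q * (3 * a * b^2 - b^3 * (r - 1)))" unfolding k q by algebra
    finally have XrY: "X - r * Y = m^3 * (k^3 - q * (3 * a * b^2 - b^3 * (r - 1)))" .
    have "u + v * (1 + r) = (c - r * d) * (X - r * Y) + d * (1 + 2 * r) * (X - r * Y) + (r^2 + r + 1) * (d * Y)"
      unfolding u_def v_def by algebra
    then have "u + v * (1 + r) = m^3 * (i * c * (X - r * Y) + d * (1 + 2 * r) * (k^3 - q * (3 * a * b^2 - b^3 * (r - 1))) + q * (d * Y))"
      unfolding cr q XrY by algebra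
    then show ?thesis by simp
  qed
  have "m^3 dvd (u + v * (1 + r)) - (u - v * r)" using 1 2 by (rule dvd_diff[rotated])
  \<comment> \<open>The difference of the two values is \<open>v * (1 + 2 * r)\<close>, and the
    square of \<open>1 + 2 * r\<close> is - 3 modulo \<open>m^3\<close>.\<close>
  then have "m^3 dvd ((u + v * (1 + r)) - (u - v * r)) * (1 + 2 * r)" by simp
  moreover have "((u + v * (1 + r)) - (u - v * r)) * (1 + 2 * r) = m^3 * (4 * q * v) - 3 * v"
    using q by algebra
  ultimately have "m^3 dvd m^3 * (4 * q * v) - 3 * v" by (simp only:)
  then have "m^3 dvd m^3 * (4 * q * v) - (m^3 * (4 * q * v) - 3 * v)"
    by (rule dvd_diff[OF dvd_triv_left])
  then have "m^3 dvd 3 * v" by simp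
  moreover have "coprime (m^3) 3"
    using m(2) prime_imp_coprime[of 3 m] by (simp add: coprime_commute)
  ultimately have v: "m^3 dvd v" by (simp add: coprime_dvd_mult_right_iff)
  then have u: "m^3 dvd u" using dvd_add[OF 1 dvd_mult2[OF v, of r]] by simp
  obtain e f where ef: "u = m^3 * e" "v = m^3 * f" using u v by (elim dvdE)
  have XY: "X^2 + X * Y + Y^2 = m^3" using cube_norm[of a b] ab(1) by (simp add: X_def Y_def)
  have "u^2 + u * v + v^2 = (m^3)^2"
    using XY norm unfolding u_def v_def by algebra
  then have "(m^3)^2 * (e^2 + e * f + f^2 - 1) = 0" unfolding ef by algebra
  then have unit: "e^2 + e * f + f^2 = 1" using m by simp
  have "m^3 * (c - (e * X - f * Y)) = 0" "m^3 * (d - (e * Y + f * X + f * Y)) = 0"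
    using XY ef unfolding u_def v_def by algebra+
  then have cd: "c = e * X - f * Y" "d = e * Y + f * X + f * Y" using m by simp_all
  have "(c, d) \<in> {(X, Y), (Y, - X - Y), (- X - Y, X)} \<or> (c, d) \<in> {(- X, - Y), (- Y, X + Y), (X + Y, - X)}"
    unfolding cd using eisenstein_units[OF unit] by (elim insertE emptyE) simp_all
  then show ?thesis
  proof
    assume "(c, d) \<in> {(X, Y), (Y, - X - Y), (- X - Y, X)}"
    then show ?thesis using that[OF ab(1)] by (simp add: X_def Y_def)
  next
    assume "(c, d) \<in> {(- X, - Y), (- Y, X + Y), (X + Y, - X)}"
    then show ?thesis using that[of "- a" "- b"] ab(1) by (auto simp: X_def Y_def cube_minus)
  qed
qed

lemma cube_if_multiplicities:
  fixes n :: int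
  assumes "n > 0" "\<And>p. prime p \<Longrightarrow> 3 dvd multiplicity p n"
  obtains m where "n = m^3" "m > 0"
proof -
  have "is_nth_power 3 (normalize n)"
    using is_nth_power_conv_multiplicity[of 3 n] assms(2) by simp
  then obtain m where m: "n = m^3" using assms(1) by (auto elim!: is_nth_powerE)
  then have "m > 0" using assms(1) by (simp add: zero_less_power_eq)
  then show ?thesis using that m by blast
qed

section \<open>Norms of primitive Eisenstein integers modulo cubes\<close>

abbreviation eis_norm :: "int \<Rightarrow> int \<Rightarrow> int" where
  "eis_norm c d \<equiv> c^2 + c * d + d^2"

lemma eis_norm_pos:
  assumes "coprime c d"
  shows "eis_norm c d > 0"
proof -
  have eq: "4 * eis_norm c d = (2 * c + d)^2 + 3 * d^2" by algebra
  have "(2 * c + d)^2 + 3 * d^2 \<noteq> 0"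
  proof
    assume "(2 * c + d)^2 + 3 * d^2 = 0"
    then have "d^2 = 0" "(2 * c + d)^2 = 0"
      using zero_le_power2[of d] zero_le_power2[of "2 * c + d"] by linarith+
    then show False using assms by simp
  qed
  then have "0 < 4 * eis_norm c d" unfolding eq
    using zero_le_power2[of d] zero_le_power2[of "2 * c + d"] by linarith
  then show ?thesis by simp
qed

text \<open>Multiplication by \<open>1 + 3 \<omega>\<close>, which has norm \<open>7\<close>. The congruence modulo \<open>7\<close> says that
  \<open>c - d \<omega>\<close> is divisible by this prime, hence not by its conjugate, which makes the product primitive.\<close>

lemma multiply_seven:
  assumes "coprime c d" "7 dvd c - 2 * d"
  shows "coprime (c + 3 * d) (- 3 * c - 2 * d)" "7 dvd (c + 3 * d) - 2 * (- 3 * c - 2 * d)"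
    and "eis_norm (c + 3 * d) (- 3 * c - 2 * d) = 7 * eis_norm c d"
proof -
  obtain k where k: "c = 2 * d + 7 * k" using assms(2) by (metis dvdE add.commute diff_add_cancel)
  show "coprime (c + 3 * d) (- 3 * c - 2 * d)"
  proof (rule coprimeI)
    fix l assume l: "l dvd c + 3 * d" "l dvd - 3 * c - 2 * d"
    have "l dvd 3 * (c + 3 * d) + (- 3 * c - 2 * d)" "l dvd - 2 * (c + 3 * d) - 3 * (- 3 * c - 2 * d)"
      using dvd_add[OF dvd_mult[OF l(1), of 3] l(2)]
        dvd_diff[OF dvd_mult[OF l(1), of "- 2"] dvd_mult[OF l(2), of 3]] by blast+
    then have l7: "l dvd 7 * d" "l dvd 7 * c" by (simp_all add: algebra_simps)
    obtain u v where uv: "u * c + v * d = 1"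
      using assms(1) bezout_int[of c d] by auto
    have "7 = u * (7 * c) + v * (7 * d)" using uv by algebra
    then have "l dvd 7" using l7 by (metis dvd_add dvd_mult)
    moreover have "\<not> 7 dvd l"
    proof
      assume "7 dvd l"
      then have "7 dvd (c + 3 * d) - 7 * k" using l(1) by (meson dvd_diff dvd_trans dvd_triv_left)
      then have "7 dvd 5 * d" unfolding k by (simp add: algebra_simps)
      then have "7 dvd d" by presburger
      moreover from this have "7 dvd c" unfolding k by simp
      ultimately show False using assms(1) coprime_common_divisor[of c d 7] by simp
    qed
    then have "coprime 7 l" by (intro prime_imp_coprime) simp_all
    ultimately show "is_unit l" by (meson coprime_common_divisor dvd_refl)
  qed
  show "7 dvd (c + 3 * d) - 2 * (- 3 * c - 2 * d)" unfolding k by (simp add: algebra_simps)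
  show "eis_norm (c + 3 * d) (- 3 * c - 2 * d) = 7 * eis_norm c d" by algebra
qed


text \<open>5 is inert: \<open>x^2 + x + 1\<close> has no root modulo 5.\<close>

lemma five_dvd_eis_norm:
  assumes "5 dvd eis_norm c d"
  shows "5 dvd c \<and> 5 dvd d"
proof -
  have "eis_norm (c mod 5) (d mod 5) mod 5 = eis_norm c d mod 5"
    by (intro mod_add_cong mod_mult_cong) (simp_all add: power_mod)
  then have "eis_norm (c mod 5) (d mod 5) mod 5 = 0" using assms by simp
  moreover have "c mod 5 \<in> {0, 1, 2, 3, 4}" "d mod 5 \<in> {0, 1, 2, 3, 4}" by auto
  ultimately have "c mod 5 = 0 \<and> d mod 5 = 0" by auto
  then show ?thesis by auto
qed

text \<open>Cubes prime to 2 are 1 in the residue field F_4. This parity identifies the unit in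
  front of a cube.\<close>

lemma cube_parity:
  assumes "odd (a^2 + a * b + b^2)"
  shows "odd (cube_fst a b)" "even (cube_snd a b)"
  using assms unfolding cube_fst_def cube_snd_def
  by (cases "even a"; cases "even b"; simp; fail)+

lemma odd_eis_norm: "odd c \<or> odd d \<Longrightarrow> odd (eis_norm c d)"
  by (cases "even c"; cases "even d") simp_all

text \<open>A cube prime to 3 has its second coordinate divisible by 3 and its first not. So
  \<open>3 dvd d\<close> would force the trivial unit, whose second coordinate is even.\<close>

lemma not_three_dvd_snd:
  assumes cop: "coprime c d" and N: "\<not> 3 dvd eis_norm c d" and mult: "\<And>p. prime p \<Longrightarrow> 3 dvd multiplicity p (eis_norm c d)"
    and "odd d"
  shows "\<not> 3 dvd d"
proof -
  obtain m where m: "eis_norm c d = m^3" "m > 0"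
    using cube_if_multiplicities[OF eis_norm_pos[OF cop] mult] by blast
  have "\<not> 3 dvd m" using N m by (metis dvd_power dvd_trans zero_less_numeral)
  then obtain a b where ab: "a^2 + a * b + b^2 = m" "(c, d) \<in> {(cube_fst a b, cube_snd a b),
      (cube_snd a b, - cube_fst a b - cube_snd a b), (- cube_fst a b - cube_snd a b, cube_fst a b)}"
    using primitive_cube_norm[OF cop m(1,2)] by blast
  have "odd m" using odd_eis_norm[of c d] assms(4) m(1) by auto
  then have par: "even (cube_snd a b)" using cube_parity ab(1) by blast
  have "\<not> 3 dvd cube_fst a b"
  proof
    assume "3 dvd cube_fst a b"
    moreover have "cube_fst a b = (a - b)^3 + 3 * (a^2 * b - 2 * a * b^2)"
      unfolding cube_fst_def by algebra
    ultimately have "3 dvd (a - b)^3" by (metis dvd_add_left_iff dvd_triv_left)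
    then have "3 dvd a - b" using prime_dvd_power[of 3 "a - b" 3] by simp
    moreover have "m = (a - b) * (a - b) + 3 * (a * b)" unfolding ab(1)[symmetric] by algebra
    ultimately show False using \<open>\<not> 3 dvd m\<close> by simp
  qed
  moreover have "3 dvd cube_snd a b" by (simp add: cube_snd_def)
  ultimately show ?thesis using ab(2) par \<open>odd d\<close> by (auto simp: dvd_diff_left_iff)
qed

text \<open>If 3 divided \<open>d\<close>, the cubic field would have conductor 7, where 2 is inert,
  against \<open>d\<close> even. The proof multiplies by \<open>1 + 3 \<omega>\<close> until the
  norm is a cube.\<close>

lemma only_seven_ramified:
  assumes cop: "coprime c d" and d: "even d" and N: "\<not> 3 dvd eis_norm c d"
    and mult: "\<And>p. prime p \<Longrightarrow> p \<noteq> 7 \<Longrightarrow> 3 dvd multiplicity p (eis_norm c d)"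
    and seven: "\<not> 3 dvd multiplicity 7 (eis_norm c d)"
  shows "\<not> 3 dvd d"
proof -
  have main: "\<not> 3 dvd d" if cop: "coprime c d" and d: "even d" and N: "\<not> 3 dvd eis_norm c d"
    and mult: "\<And>p. prime p \<Longrightarrow> p \<noteq> 7 \<Longrightarrow> 3 dvd multiplicity p (eis_norm c d)"
    and seven: "\<not> 3 dvd multiplicity 7 (eis_norm c d)" and c: "7 dvd c - 2 * d" for c d
  proof
    assume d3: "3 dvd d"
    define c1 d1 c2 d2 where "c1 = c + 3 * d" and "d1 = - 3 * c - 2 * d"
      and "c2 = c1 + 3 * d1" and "d2 = - 3 * c1 - 2 * d1"
    note m1 = multiply_seven[OF cop c, folded c1_def d1_def]
    note m2 = multiply_seven[OF m1(1,2), folded c2_def d2_def]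
    have nz: "eis_norm c d \<noteq> 0" using eis_norm_pos[OF cop] by simp
    have "odd c" using cop d by (auto dest: coprime_common_divisor[of c d 2])
    then have odd: "odd d1" "odd d2" using d by (simp_all add: d1_def d2_def c1_def)
    have three: "3 dvd d1" "3 dvd d2" using d3 by (simp_all add: d1_def d2_def)
    have p7: "prime (7 :: int)" by simp
    have mult1: "multiplicity p (7 * n) = multiplicity p 7 + multiplicity p n" if "prime p" "n \<noteq> 0" for p n :: int
      using prime_elem_multiplicity_mult_distrib[OF prime_imp_prime_elem[OF that(1)]] that(2) by simp
    have other: "multiplicity p 7 = 0" if "prime p" "p \<noteq> 7" for p :: int
    proof -
      have "\<not> p dvd 7" using primes_dvd_imp_eq[OF that(1) p7] that(2) by blast
      then show ?thesis by (rule not_dvd_imp_multiplicity_0)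
    qed
    have same: "multiplicity 7 (7 :: int) = 1" by simp
    show False
    proof (cases "3 dvd multiplicity 7 (eis_norm c d) + 1")
      case True
      have "3 dvd multiplicity p (eis_norm c1 d1)" if "prime p" for p
        using True mult[OF that] mult1[OF that nz] other[OF that] same unfolding m1(3) by (cases "p = 7") auto
      moreover have "\<not> 3 dvd eis_norm c1 d1" using N unfolding m1(3) by presburger
      ultimately show False using not_three_dvd_snd[OF m1(1)] odd three by blast
    next
      case False
      then have "3 dvd multiplicity 7 (eis_norm c d) + 2" using seven by presburger
      then have "3 dvd multiplicity p (eis_norm c2 d2)" if "prime p" for p
        using mult[OF that] mult1[OF that nz] mult1[OF that, of "7 * eis_norm c d"] nz other[OF that] same
        unfolding m2(3) m1(3) by (cases "p = 7") auto
      moreover have "\<not> 3 dvd eis_norm c2 d2" using N unfolding m1(3) m2(3) by presburger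
      ultimately show False using not_three_dvd_snd[OF m2(1)] odd three by blast
    qed
  qed
  have "7 dvd eis_norm c d" using seven not_dvd_imp_multiplicity_0 by fastforce
  moreover have "eis_norm c d = (c - 2 * d) * (c - 4 * d) + 7 * (c * d - d^2)" by algebra
  ultimately have "7 dvd (c - 2 * d) * (c - 4 * d)" by (metis dvd_add_left_iff dvd_triv_left)
  then consider "7 dvd c - 2 * d" | "7 dvd c - 4 * d" using prime_dvd_mult_iff[of "7::int"] by auto
  then show ?thesis
  proof cases
    case 1
    then show ?thesis using main[OF cop d N mult seven] by blast
  next
    case 2
    \<comment> \<open>Conjugation exchanges the two primes above 7 and only changes the sign of
      \<open>d\<close>.\<close>
    have norm: "eis_norm (c + d) (- d) = eis_norm c d" by algebra
    have "coprime (c + d) (- d)" using cop by (simp add: coprime_iff_gcd_eq_1)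
    moreover have "7 dvd (c + d) - 2 * (- d)" using 2 by presburger
    ultimately show ?thesis using main[of "c + d" "- d", unfolded norm] d N mult seven by simp
  qed
qed

lemma primitive_norm_cases:
  assumes cop: "coprime c d" and d: "even d" and N: "\<not> 3 dvd eis_norm c d"
  obtains (cube) a b where "c = cube_fst a b" "d = cube_snd a b"
  | (large) p where "prime p" "p \<ge> 11" "\<not> 3 dvd multiplicity p (eis_norm c d)"
  | (seven) "\<not> 3 dvd multiplicity 7 (eis_norm c d)" "\<not> 3 dvd d"
proof (cases "\<exists>p. prime p \<and> p \<ge> 11 \<and> \<not> 3 dvd multiplicity p (eis_norm c d)")
  case True
  then show ?thesis using large by blast
next
  case False
  have c: "odd c" using cop d by (auto dest: coprime_common_divisor[of c d 2])
  have mult: "3 dvd multiplicity p (eis_norm c d)" if "prime p" "p \<noteq> 7" for p :: int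
  proof (cases "p dvd eis_norm c d")
    case True
    have "p \<ge> 11"
    proof (rule ccontr)
      assume "\<not> p \<ge> 11"
      then have "p \<in> {2, 3, 4, 5, 6, 8, 9, 10}" using prime_ge_2_int[OF that(1)] that(2) by auto
      then have "p \<in> {2, 3, 5}" using that(1) by auto
      then consider "p = 2" | "p = 3" | "p = 5" by blast
      then show False
      proof cases
        case 1
        then show ?thesis using True odd_eis_norm c by auto
      next
        case 2
        then show ?thesis using True N by simp
      next
        case 3
        then have "5 dvd c \<and> 5 dvd d" using five_dvd_eis_norm[of c d] True unfolding 3 by blast
        then show ?thesis using cop coprime_common_divisor[of c d 5] by simp
      qed
    qed
    then show ?thesis using False that by blast
  qed (simp add: not_dvd_imp_multiplicity_0)
  show ?thesis
  proof (cases "3 dvd multiplicity 7 (eis_norm c d)")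
    case True
    then have "3 dvd multiplicity p (eis_norm c d)" if "prime p" for p using mult that by blast
    then obtain m where m: "eis_norm c d = m^3" "m > 0"
      using cube_if_multiplicities[OF eis_norm_pos[OF cop]] by blast
    have "\<not> 3 dvd m" using N m by (metis dvd_power dvd_trans zero_less_numeral)
    then obtain a b where ab: "a^2 + a * b + b^2 = m" "(c, d) \<in> {(cube_fst a b, cube_snd a b),
        (cube_snd a b, - cube_fst a b - cube_snd a b), (- cube_fst a b - cube_snd a b, cube_fst a b)}"
      using primitive_cube_norm[OF cop m(1,2)] by blast
    have "odd m" using odd_eis_norm[of c d] c m(1) by auto
    then have "odd (cube_fst a b)" "even (cube_snd a b)" using cube_parity ab(1) by blast+
    then have "c = cube_fst a b \<and> d = cube_snd a b" using ab(2) d by auto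
    then show ?thesis using cube by blast
  next
    case no: False
    then show ?thesis using seven only_seven_ramified[OF cop d N mult no] by blast
  qed
qed

text \<open>In the last two outcomes both 3 and 7 ramify. They are separated by whether 3 divides
  the norm, because different models exhibit the ramification at 3.\<close>

theorem cyclic_cubic_cases:
  fixes c d :: int
  defines "N \<equiv> eis_norm c d"
  assumes cop: "coprime c d" and d: "even d"
  obtains (root) z where "z^3 - 9 * N * z + 9 * N * d = 0"
  | (large) p where "prime p" "p \<ge> 11" "\<not> 3 dvd multiplicity p N"
  | (seven_split) "\<not> 3 dvd multiplicity 7 N" "\<not> 3 dvd N" "\<not> 3 dvd d"
  | (seven_ramified) g where "\<not> 3 dvd multiplicity 7 N" "c = d + 3 * g" "\<not> 3 dvd d + 2 * g"
proof (cases "3 dvd N")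
  case False
  then show ?thesis
  proof (cases rule: primitive_norm_cases[OF cop d False[unfolded N_def], case_names cube large seven])
    case (cube a b)
    have "N = (a^2 + a * b + b^2)^3" unfolding N_def cube by (rule cube_norm)
    \<comment> \<open>Cardano's root: with \<open>m\<close> the norm of
      \<open>a - b \<omega>\<close>, the trace of \<open>sqrt (- 3) * m * (a - b \<omega>)\<close>
      is \<open>3 * m * b\<close>.\<close>
    then have "(3 * (a^2 + a * b + b^2) * b)^3 - 9 * N * (3 * (a^2 + a * b + b^2) * b) + 9 * N * d = 0"
      unfolding cube(2) cube_snd_def by algebra
    then show ?thesis by (rule root)
  next
    case (large p)
    then show ?thesis using that(2) N_def by blast
  next
    case seven
    then show ?thesis using seven_split False N_def by blast
  qed
next
  case True
  have "N = (c - d) * (c - d) + 3 * (c * d)" unfolding N_def by algebra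
  then have "3 dvd (c - d) * (c - d)" using True by (metis dvd_add_left_iff dvd_triv_left)
  then have "3 dvd c - d" using prime_dvd_mult_iff[of "3::int"] by auto
  then obtain g where g: "c = d + 3 * g" by (metis dvdE add.commute diff_add_cancel)
  \<comment> \<open>\<open>c - d \<omega>\<close> is \<open>- sqrt (- 3)\<close> times
    \<open>c' - d' \<omega>\<close>; this choice among the associates keeps the second coordinate
    even.\<close>
  define c' d' where "c' = d + g" and "d' = - (d + 2 * g)"
  have N': "N = 3 * eis_norm c' d'" unfolding N_def c'_def d'_def g by algebra
  have cop': "coprime c' d'"
  proof (rule coprimeI)
    fix l assume l: "l dvd c'" "l dvd d'"
    have "d = 2 * c' + d'" "g = - c' - d'" by (simp_all add: c'_def d'_def)
    then have "l dvd d" "l dvd c" using l unfolding g by simp_all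
    then show "is_unit l" using cop by (meson coprime_common_divisor)
  qed
  have d': "even d'" using d by (simp add: d'_def)
  have "\<not> 3 dvd d"
    using cop coprime_common_divisor[of c d 3] unfolding g by auto
  moreover have "eis_norm c' d' = d^2 + 3 * (d * g + g^2)" unfolding c'_def d'_def by algebra
  ultimately have N3: "\<not> 3 dvd eis_norm c' d'"
    using prime_dvd_power[of "3 :: int" d 2] by (auto simp: dvd_add_left_iff)
  have mult: "multiplicity p N = multiplicity p (eis_norm c' d')" if "prime p" "p \<noteq> 3" for p :: int
  proof -
    have "\<not> p dvd 3" using primes_dvd_imp_eq[OF that(1), of 3] that(2) by auto
    then have "multiplicity p 3 = 0" by (rule not_dvd_imp_multiplicity_0)
    moreover have "eis_norm c' d' \<noteq> 0" using eis_norm_pos[OF cop'] by simp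
    ultimately show ?thesis
      using prime_elem_multiplicity_mult_distrib[OF prime_imp_prime_elem[OF that(1)], of 3 "eis_norm c' d'"]
      unfolding N' by (simp del: distrib_left_numeral)
  qed
  show ?thesis
  proof (cases rule: primitive_norm_cases[OF cop' d' N3, case_names cube large seven])
    case (cube a b)
    define m where "m = a^2 + a * b + b^2"
    have N'': "N = 3 * m^3" unfolding N' cube m_def cube_norm ..
    have "d = 2 * cube_fst a b + cube_snd a b" using cube by (simp add: c'_def d'_def)
    then have "(a - b)^3 - 3 * m * (a - b) + d = 0"
      unfolding m_def cube_fst_def cube_snd_def by algebra
    \<comment> \<open>Cardano's cube root is now \<open>- 3 * m * (a - b \<omega>)\<close>;
      multiplied by \<omega>, it has trace \<open>3 * m * (a - b)\<close>.\<close>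
    then have "(3 * m * (a - b))^3 - 9 * N * (3 * m * (a - b)) + 9 * N * d = 0"
      unfolding N'' by algebra
    then show ?thesis by (rule root)
  next
    case (large p)
    then show ?thesis using that(2)[of p] mult[of p] by auto
  next
    case seven
    then have "\<not> 3 dvd d + 2 * g" unfolding d'_def dvd_minus_iff by blast
    then show ?thesis using seven_ramified[OF _ g] mult[of 7] seven(1) by simp
  qed
qed

section \<open>Curves with square discriminant\<close>

lemma change_variables_scale:
  "change_variables v 0 0 0 (change_variables u r s t E) = change_variables (u * v) r s t E"
  by (cases E) (simp add: power_mult_distrib)

lemma E_alt_1_0:
  "E_alt 1 0 c d = wcurve 0 (of_int (- 81 * (c^2 + c * d + d^2))) (of_int (243 * (c^2 + c * d + d^2) * d))"
  by (simp add: E_alt_def short_weierstrass_def)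

text \<open>With \<open>s^2 = - (4 a^3 + 27 b^2)\<close>, put \<open>d = - 3 a b k^2\<close> and
  \<open>2 c + d = a k^2 s\<close>. Then
  \<open>4 (c^2 + c d + d^2) = (2 c + d)^2 + 3 d^2 = - 4 a^5 k^4\<close>, and both coefficients
  match after scaling. The factor \<open>k = 2 e\<close> clears the denominator of \<open>s\<close>
  and makes \<open>c\<close> an integer.\<close>

lemma rational_to_E_alt:
  fixes A B :: int and q :: rat
  assumes "elliptic_curve (short_weierstrass (of_int A) (of_int B) :: rat weierstrass)"
    and q: "q^2 = of_int (- (2^4) * (4 * A^3 + 27 * B^2))"
  obtains u :: rat and c d :: int
  where "u \<noteq> 0" "change_variables u 0 0 0 (short_weierstrass (of_int A) (of_int B)) = E_alt 1 0 c d"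
proof -
  obtain n e where ne: "q / 4 = of_int n / of_int e" "e > 0" using rat_as_quotient .
  define a b s k :: rat where "a = of_int A" and "b = of_int B" and "s = q / 4" and "k = 2 * of_int e"
  have s2: "s^2 = - (4 * a^3 + 27 * b^2)" using q by (simp add: s_def a_def b_def power_divide)
  have "discriminant (short_weierstrass a b) \<noteq> 0"
    using assms(1) by (simp add: elliptic_curve_def a_def b_def)
  then have disc: "4 * a^3 + 27 * b^2 \<noteq> 0" by (auto simp: discriminant_short_weierstrass)
  have a0: "a \<noteq> 0"
  proof
    assume "a = 0"
    then have "s^2 + 27 * b^2 = 0" using s2 by simp
    then have "b^2 = 0" using zero_le_power2[of s] zero_le_power2[of b] by linarith
    then show False using disc \<open>a = 0\<close> by simp
  qed
  define c where "c = 2 * A * e * n + 6 * A * B * e^2"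
  define d where "d = - 12 * A * B * e^2"
  define u where "u = 1 / (3 * a * k)"
  have e0: "of_int e \<noteq> (0 :: rat)" using ne by simp
  have u0: "u \<noteq> 0" using a0 e0 by (simp add: u_def k_def)
  have se: "s * of_int e = of_int n" using ne(1) e0 by (simp add: s_def)
  define c' d' :: rat where "c' = of_int c" and "d' = of_int d"
  have d': "d' = - 3 * a * b * k^2" unfolding d'_def d_def a_def b_def k_def
    by (simp add: power2_eq_square)
  have c'2: "2 * c' = a * k^2 * s - d'"
  proof -
    have "2 * c' = 4 * a * of_int e * (s * of_int e) + 12 * a * b * (of_int e)^2"
      unfolding se by (simp add: c'_def c_def a_def b_def)
    also have "\<dots> = a * k^2 * s - d'" unfolding d' k_def by algebra
    finally show ?thesis .
  qed
  have "4 * (c'^2 + c' * d' + d'^2) = 4 * (- (a^5 * k^4))"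
    using c'2 d' s2 by algebra
  then have N: "c'^2 + c' * d' + d'^2 = - (a^5 * k^4)" by simp
  have "u^4 * (81 * a^4 * k^4) = (u * (3 * a * k))^4" "u^6 * (729 * a^6 * k^6) = (u * (3 * a * k))^6"
    by algebra+
  then have "u^4 * (81 * a^4 * k^4) = 1" "u^6 * (729 * a^6 * k^6) = 1"
    using a0 e0 by (simp_all add: u_def k_def)
  then have "a / u^4 = 81 * a^4 * k^4 * a" "b / u^6 = 729 * a^6 * k^6 * b"
    using u0 by (simp_all add: field_simps)
  moreover have "81 * a^4 * k^4 * a = of_int (- 81 * (c^2 + c * d + d^2))"
    using N unfolding c'_def d'_def by (simp add: power2_eq_square) algebra
  moreover have "729 * a^6 * k^6 * b = 243 * (c'^2 + c' * d' + d'^2) * d'"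
    unfolding N unfolding d' by algebra
  then have "729 * a^6 * k^6 * b = of_int (243 * (c^2 + c * d + d^2) * d)"
    by (simp add: c'_def d'_def)
  ultimately have "change_variables u 0 0 0 (short_weierstrass a b) = E_alt 1 0 c d"
    unfolding short_weierstrass_def E_alt_1_0 by simp
  then show ?thesis using that u0 unfolding a_def b_def by blast
qed

text \<open>The parameter \<open>k\<close> is a quadratic twist. It absorbs the common factor of
  \<open>c\<close> and \<open>d\<close> and multiplies the roots of the cubic by \<open>k\<close>,
  so it does not affect the field they generate.\<close>

definition cubic_curve :: "int \<Rightarrow> int \<Rightarrow> int \<Rightarrow> rat weierstrass" where
  "cubic_curve c d k = wcurve 0 (of_int (- 9 * eis_norm c d * k^2)) (of_int (9 * eis_norm c d * d * k^3))"

lemma E_alt_primitive: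
  assumes "elliptic_curve (E_alt 1 0 c d)"
  obtains c' d' k where "E_alt 1 0 c d = cubic_curve c' d' k" "coprime c' d'" "k \<noteq> 0"
proof -
  have "\<not> (c = 0 \<and> d = 0)"
  proof
    assume "c = 0 \<and> d = 0"
    then have "discriminant (E_alt 1 0 c d) = 0"
      by (simp add: E_alt_def discriminant_short_weierstrass)
    then show False using assms by (simp add: elliptic_curve_def)
  qed
  then have g: "gcd c d \<noteq> 0" by simp
  then obtain c' d' where cd: "c = c' * gcd c d" "d = d' * gcd c d" "coprime c' d'"
    using gcd_coprime_exists[of c d] by auto
  define g where "g = gcd c d"
  have c: "c = c' * g" and d: "d = d' * g" using cd by (simp_all add: g_def)
  have "- 81 * (c^2 + c * d + d^2) = - 9 * eis_norm c' d' * (3 * g)^2"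
    "243 * (c^2 + c * d + d^2) * d = 9 * eis_norm c' d' * d' * (3 * g)^3"
    unfolding c d by algebra+
  then have "E_alt 1 0 c d = cubic_curve c' d' (3 * g)"
    unfolding E_alt_1_0 cubic_curve_def by (simp only:)
  then show ?thesis using that[of c' d' "3 * g"] cd(3) g by (simp add: g_def)
qed

lemma cubic_curve_torsion:
  fixes c d k :: int and n :: nat
  defines "F \<equiv> cubic_curve c d k"
  assumes E: "elliptic_curve F" and cop: "coprime c d" and k: "k \<noteq> 0"
    and noroot: "\<And>z :: rat. z^3 + of_int (- 9 * eis_norm c d * k^2) * z + of_int (9 * eis_norm c d * d * k^3) \<noteq> 0"
    and n: "prime n \<and> n \<ge> 5 \<or> n = 9" and on: "on_curve F P"
    and tors: "P [^]\<^bsub>point_group F\<^esub> n = Infinity"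
  shows "P [^]\<^bsub>point_group F\<^esub> (3::nat) = Infinity"
proof (rule ccontr)
  assume three: "P [^]\<^bsub>point_group F\<^esub> (3::nat) \<noteq> Infinity"
  define N where "N = eis_norm c d"
  have N0: "N > 0" unfolding N_def by (rule eis_norm_pos[OF cop])
  have d0: "d \<noteq> 0"
  proof
    assume "d = 0"
    then show False using noroot[of 0] by simp
  qed
  define a b :: rat where "a = of_int (- 9 * N * k^2)" and "b = of_int (9 * N * d * k^3)"
  have F: "F = wcurve 0 a b" by (simp add: F_def cubic_curve_def a_def b_def N_def)
  have ab0: "a \<noteq> 0" "b \<noteq> 0" using N0 d0 k by (simp_all add: a_def b_def)
  have odd: "odd n" using n prime_odd_nat[of n] by auto
  have rval: "rval p a = int (multiplicity (int p) 9) + int (multiplicity (int p) N) + 2 * int (multiplicity (int p) k)"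
    "rval p b = int (multiplicity (int p) 9) + int (multiplicity (int p) N) + int (multiplicity (int p) d) + 3 * int (multiplicity (int p) k)"
    if p: "prime p" for p
  proof -
    have a: "a = - (of_int 9 * of_int N * (of_int k)^2)" and b: "b = of_int 9 * of_int N * of_int d * (of_int k)^3"
      by (simp_all add: a_def b_def)
    have nz: "of_int N \<noteq> (0::rat)" "of_int d \<noteq> (0::rat)" "of_int k \<noteq> (0::rat)" "of_int 9 \<noteq> (0::rat)"
      using N0 d0 k by simp_all
    note r = rval_mult[OF p] rval_uminus[OF p] rval_power[OF p] rval_of_int[OF p]
    show "rval p a = int (multiplicity (int p) 9) + int (multiplicity (int p) N) + 2 * int (multiplicity (int p) k)"
      unfolding a using nz N0 k by (simp add: r del: of_int_numeral)
    show "rval p b = int (multiplicity (int p) 9) + int (multiplicity (int p) N) + int (multiplicity (int p) d) + 3 * int (multiplicity (int p) k)"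
      unfolding b using nz N0 k d0 by (simp add: r del: of_int_numeral)
  qed
  have nine: "multiplicity (int p) 9 = 0" if "prime p" "p \<noteq> 3" for p
  proof -
    have "\<not> int p dvd 9"
    proof
      assume "int p dvd 9"
      then have "p dvd 3 * 3" by presburger
      then have "p dvd 3" using that(1) prime_dvd_mult_iff by blast
      then show False using that primes_dvd_imp_eq[of p 3] by simp
    qed
    then show ?thesis by (rule not_dvd_imp_multiplicity_0)
  qed
  have nine3: "multiplicity 3 (9 :: int) = 2"
    using multiplicity_prime_power[of "3 :: int" 2] by simp
  \<comment> \<open>These conditions say that the Newton polygon of the cubic at \<open>p\<close> is
    one segment of non-integral slope \<open>rval p b / 3\<close>.\<close>
  have tame: "p dvd n \<and> (p \<ge> 11 \<longrightarrow> n \<noteq> p)"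
    if p: "prime p" "p \<noteq> 2" "\<not> 3 dvd rval p b" "2 * rval p b < 3 * rval p a" for p
    using ramified_torsion[OF p(1) E[unfolded F] p(2) ab0(2) p(3) _ _ on[unfolded F] tors[unfolded F] three[unfolded F]]
      p(4) by (simp add: vgt3_def[OF p(1)])
  have local: "p dvd n \<and> (p \<ge> 11 \<longrightarrow> n \<noteq> p)"
    if p: "prime p" "p \<noteq> 2" "p \<noteq> 3" "\<not> 3 dvd multiplicity (int p) N" for p
  proof (rule tame[OF p(1,2)])
    have pN: "int p dvd N" using p(4) not_dvd_imp_multiplicity_0 by fastforce
    have "\<not> int p dvd d"
    proof
      assume pd: "int p dvd d"
      have "c^2 = N - (c + d) * d" unfolding N_def by algebra
      then have "int p dvd c^2" using pN pd by simp
      then have "int p dvd c" using p(1) prime_dvd_power[of "int p" c 2] by simp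
      then show False using pd cop p(1) coprime_common_divisor[of c d "int p"] by simp
    qed
    then have "multiplicity (int p) d = 0" by (rule not_dvd_imp_multiplicity_0)
    then have r: "rval p b = int (multiplicity (int p) N) + 3 * int (multiplicity (int p) k)"
      "rval p a = int (multiplicity (int p) N) + 2 * int (multiplicity (int p) k)"
      using rval[OF p(1)] nine[OF p(1,3)] by simp_all
    show "\<not> 3 dvd rval p b" unfolding r using p(4) by presburger
    have "multiplicity (int p) N > 0" using p(4) by (cases "multiplicity (int p) N") auto
    then show "2 * rval p b < 3 * rval p a" unfolding r by simp
  qed
  have only7: "n = 7" if "\<not> 3 dvd multiplicity 7 N"
  proof -
    have "prime (7 :: nat)" by simp
    then have "7 dvd n" using local[of 7] that by simp
    then show ?thesis using n primes_dvd_imp_eq[of 7 n] by auto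
  qed
  have three_nat: "prime (3 :: nat)" by simp
  show False
  proof (cases "even d")
    case False
    have "P [^]\<^bsub>point_group F\<^esub> (3::nat) = Infinity"
      unfolding F
    proof (rule odd_torsion_unramified_at_2[OF E[unfolded F] ab0 _ _ on[unfolded F] tors[unfolded F] odd])
      have "odd N" using odd_eis_norm[of c d] False by (simp add: N_def)
      then have "multiplicity 2 N = 0" "multiplicity 2 d = 0"
        using False by (simp_all add: not_dvd_imp_multiplicity_0)
      then show "rval 2 a = 2 * int (multiplicity 2 k)" "rval 2 b = 3 * int (multiplicity 2 k)"
        using rval[of 2] nine[of 2] by simp_all
    qed
    then show False using three by blast
  next
    case True
    show False
    proof (cases rule: cyclic_cubic_cases[OF cop True, case_names root large split ramified])
      case (root z)
      have "(k * z)^3 + (- 9 * eis_norm c d * k^2) * (k * z) + 9 * eis_norm c d * d * k^3 = 0"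
        using root by algebra
      then have "of_int ((k * z)^3 + (- 9 * eis_norm c d * k^2) * (k * z) + 9 * eis_norm c d * d * k^3) = (0 :: rat)"
        by simp
      then show False using noroot[of "of_int (k * z)"] by simp
    next
      case (large p)
      define p' where "p' = nat p"
      have p': "p = int p'" "p' \<ge> 11" using large(2) by (simp_all add: p'_def)
      moreover have "prime p'" using large(1) unfolding p'(1) by simp
      ultimately have p': "p = int p'" "prime p'" "p' \<ge> 11" by blast+
      have "p' dvd n \<and> n \<noteq> p'" using local[of p'] p' large(3) by (auto simp: N_def)
      then show False using n p' primes_dvd_imp_eq[of p' n] by (auto dest: dvd_imp_le)
    next
      case split
      have "n = 7" using only7 split(1) by (simp add: N_def)
      \<comment> \<open>The factor 9 leaves \<open>b\<close> with valuation 2 modulo 3, so the model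
        shows the ramification at 3 as it stands.\<close>
      moreover have "3 dvd n"
      proof -
        have "multiplicity 3 N = 0" "multiplicity 3 d = 0"
          using split by (simp_all add: N_def not_dvd_imp_multiplicity_0)
        then have "rval 3 a = 2 + 2 * int (multiplicity 3 k)" "rval 3 b = 2 + 3 * int (multiplicity 3 k)"
          using rval[OF three_nat] nine3 by simp_all
        then show ?thesis using tame[OF three_nat] by presburger
      qed
      ultimately show False by simp
    next
      case (ramified g)
      have "n = 7" using only7 ramified(1) by (simp add: N_def)
      \<comment> \<open>Here \<open>rval 3 b\<close> is a multiple of 3 and hides the ramification.
        Moving the origin to \<open>- 3 k d\<close>, which approximates the roots 3-adically, gives
        a constant term of valuation 1 modulo 3.\<close>
      define r :: rat where "r = of_int (- 3 * k * d)"
      define V where "V = wcurve (of_int (- 9 * k * d)) (of_int (- 81 * k^2 * (d * g + g^2))) (of_int (81 * k^3 * d * (d + 2 * g)^2) :: rat)"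
      have V: "change_variables 1 r 0 0 F = V"
      proof -
        have "3 * r = of_int (- 9 * k * d)" by (simp add: r_def)
        moreover have "a + 3 * r^2 = of_int (- 81 * k^2 * (d * g + g^2))"
        proof -
          have "a + 3 * r^2 = of_int (- 9 * N * k^2 + 3 * (- 3 * k * d)^2)"
            by (simp add: a_def r_def)
          also have "- 9 * N * k^2 + 3 * (- 3 * k * d)^2 = - 81 * k^2 * (d * g + g^2)"
            unfolding N_def ramified(2) by algebra
          finally show ?thesis .
        qed
        moreover have "b + r * a + r^3 = of_int (81 * k^3 * d * (d + 2 * g)^2)"
        proof -
          have "b + r * a + r^3 = of_int (9 * N * d * k^3 + (- 3 * k * d) * (- 9 * N * k^2) + (- 3 * k * d)^3)"
            by (simp add: a_def b_def r_def)
          also have "9 * N * d * k^3 + (- 3 * k * d) * (- 9 * N * k^2) + (- 3 * k * d)^3 = 81 * k^3 * d * (d + 2 * g)^2"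
            unfolding N_def ramified(2) by algebra
          finally show ?thesis .
        qed
        ultimately show ?thesis unfolding F V_def by simp
      qed
      have one: "(1 :: rat) \<noteq> 0" by simp
      define Q where "Q = transport 1 r 0 0 P"
      have EV: "elliptic_curve V" using elliptic_curve_change_variables[OF one, of r 0 0 F] E unfolding V by blast
      have onQ: "on_curve V Q" using on_curve_transport[OF one, of r 0 0 F P] on unfolding V Q_def by blast
      have pow: "Q [^]\<^bsub>point_group V\<^esub> i = transport 1 r 0 0 (P [^]\<^bsub>point_group F\<^esub> i)" for i :: nat
        using transport_pow[OF one E on, of r 0 0 i] unfolding V Q_def by simp
      have torsQ: "Q [^]\<^bsub>point_group V\<^esub> n = Infinity" unfolding pow tors by simp
      have threeQ: "Q [^]\<^bsub>point_group V\<^esub> (3::nat) \<noteq> Infinity" unfolding pow using three by simp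
      have "\<not> 3 dvd d"
        using cop coprime_common_divisor[of c d 3] unfolding ramified(2) by auto
      then have m3: "multiplicity 3 d = 0" "multiplicity 3 (d + 2 * g) = 0"
        using ramified(3) by (simp_all add: not_dvd_imp_multiplicity_0)
      have nz: "d + 2 * g \<noteq> 0" using ramified(3) by auto
      note rule3 = rval_mult[OF three_nat] rval_uminus[OF three_nat] rval_power[OF three_nat] rval_of_int[OF three_nat]
      define \<kappa> where "\<kappa> = int (multiplicity 3 k)"
      have m81: "multiplicity 3 (81 :: int) = 4" using multiplicity_prime_power[of "3 :: int" 4] by simp
      have c3: "rval 3 (of_int (81 * k^3 * d * (d + 2 * g)^2)) = 4 + 3 * \<kappa>"
      proof -
        have "(of_int (81 * k^3 * d * (d + 2 * g)^2) :: rat) = of_int 81 * (of_int k)^3 * of_int d * (of_int (d + 2 * g))^2"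
          by simp
        moreover have "of_int (d + 2 * g) \<noteq> (0 :: rat)" using nz by (simp only: of_int_eq_0_iff not_False_eq_True)
        ultimately show ?thesis
          using k d0 nz m3 m81 by (simp add: rule3 \<kappa>_def del: of_int_numeral of_int_add of_int_mult)
      qed
      have a3: "vge 3 (2 + \<kappa>) (of_int (- 9 * k * d))"
      proof -
        have "(of_int (- 9 * k * d) :: rat) = - (of_int 9 * of_int k * of_int d)" by simp
        then show ?thesis using k d0 m3 nine3
          by (simp add: vge_def rule3 \<kappa>_def del: of_int_numeral of_int_mult)
      qed
      have b3: "vge 3 (4 + 2 * \<kappa>) (of_int (- 81 * k^2 * (d * g + g^2)))"
      proof -
        have "(of_int (- 81 * k^2 * (d * g + g^2)) :: rat) = - (of_int 81 * (of_int k)^2) * of_int (d * g + g^2)" by simp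
        moreover have "vge 3 (4 + 2 * \<kappa>) (- (of_int 81 * (of_int k)^2))"
          using k m81 by (simp add: vge_def rule3 \<kappa>_def del: of_int_numeral)
        ultimately show ?thesis using vge_mult0(2)[OF three_nat _ vge_of_int[OF three_nat]] by metis
      qed
      have "of_int (81 * k^3 * d * (d + 2 * g)^2) \<noteq> (0 :: rat)"
        unfolding of_int_eq_0_iff using k d0 nz by simp
      moreover have "\<not> 3 dvd rval 3 (of_int (81 * k^3 * d * (d + 2 * g)^2))"
        unfolding c3 by presburger
      moreover have "vgt3 3 (rval 3 (of_int (81 * k^3 * d * (d + 2 * g)^2))) (of_int (- 9 * k * d))"
        unfolding c3 using a3 by (auto simp: vgt3_def[OF three_nat] vge_def)
      moreover have "vgt3 3 (2 * rval 3 (of_int (81 * k^3 * d * (d + 2 * g)^2))) (of_int (- 81 * k^2 * (d * g + g^2)))"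
        unfolding c3 using b3 by (auto simp: vgt3_def[OF three_nat] vge_def)
      ultimately have "3 dvd n"
        by (rule ramified_torsion(1)[OF three_nat EV[unfolded V_def] _ _ _ _ _
          onQ[unfolded V_def] torsQ[unfolded V_def] threeQ[unfolded V_def], rotated]) simp
      then show False using \<open>n = 7\<close> by simp
    qed
  qed
qed

section \<open>Cyclic torsion subgroups\<close>

text \<open>Order 3 is permitted, so 9 takes the place of the prime 3 in the list of orders to
  exclude.\<close>

lemma odd_order_divisor:
  fixes n :: nat
  assumes "odd n" "n > 3"
  obtains m where "m dvd n" "prime m \<and> m \<ge> 5 \<or> m = 9"
proof (cases "\<exists>p. prime p \<and> p \<ge> 5 \<and> p dvd n")
  case True
  then show ?thesis using that by blast
next
  case False
  have three: "p = 3" if "prime p" "p dvd n" for p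
  proof -
    have "p \<noteq> 2" using that(2) assms(1) by auto
    moreover have "\<not> p \<ge> 5" using that False by blast
    moreover have "p \<noteq> 4" using that(1) by auto
    ultimately show ?thesis using prime_ge_2_nat[OF that(1)] by linarith
  qed
  obtain p where "prime p" "p dvd n" using prime_factor_nat[of n] assms(2) by auto
  then obtain k where k: "n = 3 * k" using three by blast
  then obtain q where "prime q" "q dvd k" using prime_factor_nat[of k] assms(2) by auto
  then have "3 dvd k" using three k by (metis dvd_mult)
  then have "9 dvd n" unfolding k by auto
  then show ?thesis using that by blast
qed

context comm_group
begin

lemma torsion_subgroup_is_subgroup: "subgroup {x \<in> carrier G. \<exists>n::nat. n > 0 \<and> x [^] n = \<one>} G"
proof (rule subgroupI)
  show "{x \<in> carrier G. \<exists>n::nat. n > 0 \<and> x [^] n = \<one>} \<noteq> {}"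
    by (auto intro!: exI[of _ "\<one>"] exI[of _ "1::nat"])
next
  fix x assume "x \<in> {x \<in> carrier G. \<exists>n::nat. n > 0 \<and> x [^] n = \<one>}"
  then show "inv x \<in> {x \<in> carrier G. \<exists>n::nat. n > 0 \<and> x [^] n = \<one>}"
    by (auto simp: nat_pow_inv)
next
  fix x y
  assume "x \<in> {x \<in> carrier G. \<exists>n::nat. n > 0 \<and> x [^] n = \<one>}"
    "y \<in> {x \<in> carrier G. \<exists>n::nat. n > 0 \<and> x [^] n = \<one>}"
  then obtain m n :: nat where x: "x \<in> carrier G" "m > 0" "x [^] m = \<one>" and y: "y \<in> carrier G" "n > 0" "y [^] n = \<one>"
    by auto
  have "x [^] (m * n) = \<one>" using nat_pow_pow[OF x(1), of m n] x(3) by simp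
  moreover have "y [^] (m * n) = \<one>" using nat_pow_pow[OF y(1), of n m] y(3) by (simp add: mult.commute)
  ultimately have "(x \<otimes> y) [^] (m * n) = \<one>"
    using pow_mult_distrib[OF m_comm[OF x(1) y(1)] x(1) y(1)] by simp
  then show "x \<otimes> y \<in> {x \<in> carrier G. \<exists>n::nat. n > 0 \<and> x [^] n = \<one>}"
    using x(1,2) y(1,2) by (auto intro!: exI[of _ "m * n"])
qed auto

text \<open>A generator of the torsion subgroup is itself torsion, so its order \<open>n\<close> is
  positive and its first \<open>n\<close> powers exhaust the subgroup.\<close>

lemma cyclic_torsion_subgroup:
  assumes "cyclic_group (torsion_subgroup G)"
  obtains g and n :: nat where "g \<in> carrier G" "n > 0" "\<And>k::nat. g [^] k = \<one> \<longleftrightarrow> n dvd k"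
    "carrier (torsion_subgroup G) = (\<lambda>k. g [^] k) ` {..<n::nat}"
proof -
  define H where "H = {x \<in> carrier G. \<exists>n::nat. n > 0 \<and> x [^] n = \<one>}"
  have T: "torsion_subgroup G = G\<lparr>carrier := H\<rparr>" by (simp add: torsion_subgroup_def H_def)
  have sub: "subgroup H G" unfolding H_def by (rule torsion_subgroup_is_subgroup)
  then interpret T: group "torsion_subgroup G" unfolding T by (rule subgroup_imp_group)
  obtain g where g: "g \<in> carrier (torsion_subgroup G)"
    "carrier (torsion_subgroup G) = range (\<lambda>n::int. g [^]\<^bsub>torsion_subgroup G\<^esub> n)"
    using assms T.cyclic_group by blast
  have gH: "g \<in> H" using g(1) by (simp add: T)
  then have gG: "g \<in> carrier G" by (simp add: H_def)
  have range: "H = range (\<lambda>n::int. g [^] n)"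
    using g(2) int_pow_consistent[OF sub gH] by (simp add: T)
  define n where "n = (LEAST n::nat. n > 0 \<and> g [^] n = \<one>)"
  have n: "n > 0" "g [^] n = \<one>"
    using gH LeastI_ex[of "\<lambda>n::nat. n > 0 \<and> g [^] n = \<one>"] by (auto simp: H_def n_def)
  have mod: "g [^] k = g [^] (k mod n)" for k :: nat
  proof -
    have "g [^] k = g [^] (n * (k div n) + k mod n)" by simp
    also have "\<dots> = (g [^] n) [^] (k div n) \<otimes> g [^] (k mod n)"
      using gG by (simp add: nat_pow_mult nat_pow_pow del: mult_div_mod_eq)
    finally show ?thesis using n(2) gG by simp
  qed
  have dvd: "g [^] k = \<one> \<longleftrightarrow> n dvd k" for k :: nat
  proof
    assume "g [^] k = \<one>"
    then have "g [^] (k mod n) = \<one>" using mod by simp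
    then have "\<not> k mod n > 0"
      using not_less_Least[of "k mod n" "\<lambda>n. n > 0 \<and> g [^] n = \<one>"] mod_less_divisor[OF n(1), of k]
      by (auto simp: n_def)
    then show "n dvd k" by auto
  next
    assume "n dvd k"
    then show "g [^] k = \<one>" using mod[of k] gG by simp
  qed
  have "H = (\<lambda>k. g [^] k) ` {..<n}"
  proof
    show "(\<lambda>k. g [^] k) ` {..<n} \<subseteq> H"
      using range by (auto simp: int_pow_int[symmetric])
    show "H \<subseteq> (\<lambda>k. g [^] k) ` {..<n}"
    proof
      fix x assume "x \<in> H"
      then obtain i :: int where i: "x = g [^] i" using range by auto
      have "g [^] (int n * (i div int n)) = (g [^] int n) [^] (i div int n)"
        using int_pow_pow[OF gG] by simp
      also have "\<dots> = \<one>" using n(2) by (simp add: int_pow_int)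
      finally have "g [^] (int n * (i div int n) + i mod int n) = g [^] (i mod int n)"
        using int_pow_mult[OF gG, of "int n * (i div int n)" "i mod int n"] gG
        by (simp del: mult_div_mod_eq)
      then have "g [^] i = g [^] (i mod int n)" by simp
      also have "i mod int n = int (nat (i mod int n))" using n(1) by simp
      finally have "x = g [^] nat (i mod int n)" using i by (simp only: int_pow_int)
      moreover have "nat (i mod int n) < n" using n(1) by (simp add: nat_less_iff)
      ultimately show "x \<in> (\<lambda>k. g [^] k) ` {..<n}" by blast
    qed
  qed
  then show ?thesis using that[OF gG n(1) dvd] by (simp add: T)
qed

lemma torsion_subgroup_involution_unique:
  assumes "cyclic_group (torsion_subgroup G)"
    and x: "x \<in> carrier G" "x \<noteq> \<one>" "x \<otimes> x = \<one>" and y: "y \<in> carrier G" "y \<noteq> \<one>" "y \<otimes> y = \<one>"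
  shows "x = y"
proof -
  obtain g and n :: nat where g: "g \<in> carrier G" "n > 0" "\<And>k::nat. g [^] k = \<one> \<longleftrightarrow> n dvd k"
    "carrier (torsion_subgroup G) = (\<lambda>k. g [^] k) ` {..<n::nat}"
    using cyclic_torsion_subgroup[OF assms(1)] by blast
  have "\<exists>k. z = g [^] k \<and> 2 * k = n" if z: "z \<in> carrier G" "z \<noteq> \<one>" "z \<otimes> z = \<one>" for z
  proof -
    have "z [^] (2::nat) = \<one>" using z by (simp add: numeral_2_eq_2)
    then have "z \<in> carrier (torsion_subgroup G)"
      using z(1) by (auto simp: torsion_subgroup_def intro!: exI[of _ "2::nat"])
    then obtain k where k: "z = g [^] k" "k < n" using g(4) by auto
    have "g [^] (2 * k) = \<one>" using z(3) g(1) unfolding k(1) by (simp add: nat_pow_mult mult_2)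
    then have "n dvd 2 * k" using g(3) by blast
    moreover have "k > 0" using z(2) k(1) by (cases k) auto
    moreover obtain q where q: "2 * k = n * q" using calculation(1) by (elim dvdE)
    moreover have "q < 2"
    proof (rule ccontr)
      assume "\<not> q < 2"
      then have "n * 2 \<le> n * q" by (intro mult_le_mono2) simp
      then show False using q k(2) by linarith
    qed
    ultimately have "2 * k = n" by (cases q) auto
    then show ?thesis using k(1) by blast
  qed
  from this[OF x] this[OF y] show ?thesis by auto
qed

lemma torsion_subgroup_order_3:
  assumes "cyclic_group (torsion_subgroup G)"
    and three: "\<And>x. x \<in> carrier (torsion_subgroup G) \<Longrightarrow> x [^] (3::nat) = \<one>"
  shows "trivial_group (torsion_subgroup G) \<or> torsion_subgroup G \<cong> integer_mod_group 3"
proof -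
  obtain g and n :: nat where g: "g \<in> carrier G" "n > 0" "\<And>k::nat. g [^] k = \<one> \<longleftrightarrow> n dvd k"
    "carrier (torsion_subgroup G) = (\<lambda>k. g [^] k) ` {..<n::nat}"
    using cyclic_torsion_subgroup[OF assms(1)] by blast
  interpret T: group "torsion_subgroup G"
    using torsion_subgroup_is_subgroup by (simp add: torsion_subgroup_def subgroup_imp_group)
  have gT: "g \<in> carrier (torsion_subgroup G)"
    using g by (auto simp: torsion_subgroup_def intro!: exI[of _ n])
  then have "n dvd 3" using g(3) three by blast
  moreover have "prime (3::nat)" by simp
  ultimately consider "n = 1" | "n = 3" using prime_nat_iff by blast
  then show ?thesis
  proof cases
    case 1
    then have "carrier (torsion_subgroup G) = {\<one>}" using g by (auto simp: lessThan_Suc)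
    then have "trivial_group (torsion_subgroup G)"
      using T.is_group by (simp add: trivial_group_def) (simp add: torsion_subgroup_def)
    then show ?thesis ..
  next
    case 3: 2
    have one: "\<one>\<^bsub>torsion_subgroup G\<^esub> = \<one>" and mult: "x \<otimes>\<^bsub>torsion_subgroup G\<^esub> y = x \<otimes> y" for x y
      by (simp_all add: torsion_subgroup_def)
    have carrier: "carrier (torsion_subgroup G) = (\<lambda>i. g [^] nat i) ` {0..<3::int}"
    proof -
      have "{..<3} = nat ` {0..<3::int}" by (auto simp: image_iff intro!: bexI[of _ "int _"])
      then show ?thesis unfolding g(4) 3 by (simp add: image_image)
    qed
    have pow3: "g [^] (k mod 3) = g [^] k" for k :: nat
    proof -
      have "g [^] k = g [^] (3 * (k div 3) + k mod 3)" by simp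
      also have "\<dots> = (g [^] (3::nat)) [^] (k div 3) \<otimes> g [^] (k mod 3)"
        using g(1) by (simp add: nat_pow_mult nat_pow_pow del: mult_div_mod_eq)
      also have "g [^] (3::nat) = \<one>" using g(3) 3 by simp
      finally show ?thesis using g(1) by simp
    qed
    have "inj_on (\<lambda>i. g [^] nat i) {0..<3::int}"
    proof -
      have ne: "g [^] (i::nat) \<noteq> g [^] j" if "i < j" "j < 3" for i j
      proof
        assume eq: "g [^] i = g [^] j"
        have "g [^] j = g [^] i \<otimes> g [^] (j - i)" using that g(1) by (simp add: nat_pow_mult)
        then have "g [^] (j - i) = \<one>" using eq g(1) by (metis l_cancel_one nat_pow_closed r_one)
        then have "3 dvd j - i" using g(3) 3 by blast
        then show False using that by (auto dest: dvd_imp_le)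
      qed
      show ?thesis
      proof (rule inj_onI)
        fix i j :: int
        assume ij: "i \<in> {0..<3}" "j \<in> {0..<3}" "g [^] nat i = g [^] nat j"
        have "nat i < 3" "nat j < 3" using ij by auto
        then have "nat i = nat j" using ne[of "nat i" "nat j"] ne[of "nat j" "nat i"] ij(3) by (metis linorder_neqE_nat)
        then show "i = j" using ij(1,2) by (simp add: eq_nat_nat_iff)
      qed
    qed
    moreover define h where "h = (\<lambda>i. g [^] nat i)"
    ultimately have "bij_betw h {0..<3} (carrier (torsion_subgroup G))"
      unfolding bij_betw_def carrier by blast
    moreover have "h ((i + j) mod 3) = h i \<otimes> h j" if "i \<ge> 0" "j \<ge> 0" for i j
    proof -
      have "nat ((i + j) mod 3) = (nat i + nat j) mod 3"
        using that by (simp add: nat_mod_distrib nat_add_distrib)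
      then show ?thesis unfolding h_def using pow3 nat_pow_mult[OF g(1)] by simp
    qed
    ultimately have "h \<in> iso (integer_mod_group 3) (torsion_subgroup G)"
      by (auto simp: iso_def hom_def carrier_integer_mod_group mult bij_betw_def)
    then have "integer_mod_group 3 \<cong> torsion_subgroup G" by (auto simp: is_iso_def)
    then show ?thesis using group.iso_sym[OF group_integer_mod_group] by blast
  qed
qed

end


text \<open>The other two roots are \<open>(- z + w) / 2\<close> and \<open>(- z - w) / 2\<close>
  with \<open>w^2 = - 3 z^2 - 4 a\<close>. By \<open>disc\<close> this differs from the discriminant
  of the cubic by a nonzero square, so \<open>w\<close> is rational.\<close>

lemma cubic_curve_two_roots:
  fixes c d k :: int and z :: rat
  defines "N \<equiv> eis_norm c d"
  assumes E: "elliptic_curve (cubic_curve c d k)"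
    and z: "z^3 + of_int (- 9 * N * k^2) * z + of_int (9 * N * d * k^3) = 0"
  obtains z' where "z' \<noteq> z" "z'^3 + of_int (- 9 * N * k^2) * z' + of_int (9 * N * d * k^3) = 0"
proof -
  define a b :: rat where "a = of_int (- 9 * N * k^2)" and "b = of_int (9 * N * d * k^3)"
  have root: "z^3 + a * z + b = 0" using z by (simp add: a_def b_def)
  have disc: "- (4 * a^3 + 27 * b^2) = (3 * z^2 + a)^2 * (- 3 * z^2 - 4 * a)"
    using root by algebra
  have "cubic_curve c d k = short_weierstrass a b"
    by (simp add: cubic_curve_def short_weierstrass_def a_def b_def N_def)
  then have "4 * a^3 + 27 * b^2 \<noteq> 0"
    using E by (auto simp: elliptic_curve_def discriminant_short_weierstrass)
  then have ne: "3 * z^2 + a \<noteq> 0" using disc by auto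
  \<comment> \<open>The square root comes from \<open>4 N - 3 d^2 = (2 c + d)^2\<close>.\<close>
  define s :: rat where "s = of_int (27 * N * k^3 * (2 * c + d))"
  have s: "s^2 = - (4 * a^3 + 27 * b^2)"
  proof -
    have "(27 * N * k^3 * (2 * c + d))^2 = - (4 * (- 9 * N * k^2)^3 + 27 * (9 * N * d * k^3)^2)"
      unfolding N_def by algebra
    then have "of_int ((27 * N * k^3 * (2 * c + d))^2) = (of_int (- (4 * (- 9 * N * k^2)^3 + 27 * (9 * N * d * k^3)^2)) :: rat)"
      by (simp only:)
    then show ?thesis unfolding s_def a_def b_def
      by (simp only: of_int_power of_int_minus of_int_add of_int_mult of_int_numeral)
  qed
  define w where "w = s / (3 * z^2 + a)"
  have "(3 * z^2 + a)^2 * w^2 = (3 * z^2 + a)^2 * (- 3 * z^2 - 4 * a)"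
    using s disc ne by (simp add: w_def power_divide)
  then have w: "w^2 = - 3 * z^2 - 4 * a" using ne by simp
  define z' where "z' = (w - z) / 2"
  have z': "2 * z' = w - z" by (simp add: z'_def)
  have "8 * (z'^3 + a * z' + b) = 0" using z' w root by algebra
  then have "z'^3 + a * z' + b = 0" by simp
  moreover have "z' \<noteq> z"
  proof
    assume "z' = z"
    then have "w = 3 * z" using z' by simp
    then have "4 * (3 * z^2 + a) = 0" using w by algebra
    then show False using ne by simp
  qed
  ultimately show ?thesis using that by (simp add: a_def b_def)
qed

theorem proposition5:
  fixes E :: "rat weierstrass"
  assumes "elliptic_curve E"
    and "square_discriminant E"
  shows "(\<exists>a b c d :: int.
            elliptic_curve (E_alt a b c d) \<and> weierstrass_isomorphic E (E_alt a b c d)) \<and>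
         (trivial_group (torsion_subgroup (point_group E)) \<or>
          \<not> cyclic_group (torsion_subgroup (point_group E)) \<or>
          torsion_subgroup (point_group E) \<cong> integer_mod_group 3)"
proof -
  obtain A B :: int and q u r s t :: rat where short: "u \<noteq> 0"
    "change_variables u r s t E = short_weierstrass (of_int A) (of_int B)"
    "q^2 = of_int (- (2^4) * (4 * A^3 + 27 * B^2))"
    using assms(2) unfolding square_discriminant_def weierstrass_isomorphic_def by metis
  have "elliptic_curve (short_weierstrass (of_int A) (of_int B) :: rat weierstrass)"
    using elliptic_curve_change_variables[OF short(1), of r s t E] assms(1) short(2) by simp
  then obtain v and c d :: int where v: "v \<noteq> 0"
    "change_variables v 0 0 0 (short_weierstrass (of_int A) (of_int B)) = E_alt 1 0 c d"
    using rational_to_E_alt[OF _ short(3)] by blast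
  define x where "x = u * v"
  have x: "x \<noteq> 0" "change_variables x r s t E = E_alt 1 0 c d"
    using short v unfolding x_def change_variables_scale[symmetric] by simp_all
  have alt: "elliptic_curve (E_alt 1 0 c d)"
    using elliptic_curve_change_variables[OF x(1), of r s t E] assms(1) x(2) by simp
  obtain c' d' k where ck: "E_alt 1 0 c d = cubic_curve c' d' k" "coprime c' d'" "k \<noteq> 0"
    using E_alt_primitive[OF alt] by blast
  define F where "F = cubic_curve c' d' k"
  define \<phi> where "\<phi> = transport x r s t"
  have EF: "elliptic_curve F" using alt ck F_def by simp
  have F: "change_variables x r s t E = F" using x ck F_def by simp
  interpret comm_group "point_group E" using comm_group_point_group[OF assms(1)] .
  have on: "on_curve F (\<phi> P) \<longleftrightarrow> on_curve E P" for P
    using on_curve_transport[OF x(1), of r s t E P] by (simp add: F \<phi>_def)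
  have add: "\<phi> (add_point E P Q) = add_point F (\<phi> P) (\<phi> Q)" if "on_curve E P" "on_curve E Q" for P Q
    using transport_add_point[OF x(1) that, of r s t] by (simp add: F \<phi>_def)
  have pow: "\<phi> (P [^]\<^bsub>point_group E\<^esub> n) = \<phi> P [^]\<^bsub>point_group F\<^esub> n" if "on_curve E P" for P and n :: nat
    using transport_pow[OF x(1) assms(1) that, of r s t n] by (simp add: F \<phi>_def)
  have inf: "\<phi> P = Infinity \<longleftrightarrow> P = Infinity" for P by (simp add: \<phi>_def)
  have bij: "bij \<phi>" unfolding \<phi>_def by (rule bij_transport[OF x(1)])
  define f where "f z = z^3 + of_int (- 9 * eis_norm c' d' * k^2) * z + of_int (9 * eis_norm c' d' * d' * k^3)" for z :: rat
  have f: "on_curve F (Affine z 0) \<longleftrightarrow> f z = 0" for z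
    unfolding F_def cubic_curve_def on_wcurve f_def by (auto simp: algebra_simps)
  have double: "add_point F (Affine z 0) (Affine z 0) = Infinity" for z
    by (simp add: F_def cubic_curve_def add_point.simps(3))
  have "trivial_group (torsion_subgroup (point_group E)) \<or> torsion_subgroup (point_group E) \<cong> integer_mod_group 3"
    if cyc: "cyclic_group (torsion_subgroup (point_group E))"
  proof -
    \<comment> \<open>A rational root brings a second one, and two distinct points of order 2
      contradict cyclicity.\<close>
    have noroot: "f z \<noteq> 0" for z
    proof
      assume z: "f z = 0"
      then obtain z' where z': "z' \<noteq> z" "f z' = 0"
        using cubic_curve_two_roots[OF EF[unfolded F_def]] unfolding f_def by metis
      obtain P Q where PQ: "\<phi> P = Affine z 0" "\<phi> Q = Affine z' 0"
        using bij by (metis bij_pointE)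
      have "on_curve E P" "on_curve E Q" using z z' f on PQ by metis+
      moreover from this have "add_point E P P = Infinity" "add_point E Q Q = Infinity"
        using add[of P P] add[of Q Q] double PQ inf by metis+
      moreover have "P \<noteq> Infinity" "Q \<noteq> Infinity" using PQ inf by (metis point.distinct(1))+
      ultimately have "P = Q" using torsion_subgroup_involution_unique[OF cyc, of P Q] by simp
      then show False using PQ z'(1) by simp
    qed
    obtain g and n :: nat where g: "g \<in> carrier (point_group E)" "n > 0"
      "\<And>k::nat. g [^]\<^bsub>point_group E\<^esub> k = \<one>\<^bsub>point_group E\<^esub> \<longleftrightarrow> n dvd k"
      "carrier (torsion_subgroup (point_group E)) = (\<lambda>k. g [^]\<^bsub>point_group E\<^esub> k) ` {..<n::nat}"
      using cyclic_torsion_subgroup[OF cyc] by blast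
    have on_pow: "on_curve E (g [^]\<^bsub>point_group E\<^esub> k)" for k :: nat
      using nat_pow_closed[OF g(1), of k] by simp
    have "odd n"
    proof
      assume "even n"
      then obtain m where m: "n = m + m" by (metis evenE mult_2)
      define P where "P = g [^]\<^bsub>point_group E\<^esub> m"
      have "P \<noteq> Infinity" using g(3)[of m] g(2) m by (auto simp: P_def dest: dvd_imp_le)
      moreover have PP: "add_point E P P = Infinity"
        using nat_pow_mult[OF g(1), of m m] g(3)[of n] m by (simp add: P_def)
      ultimately obtain a b where ab: "\<phi> P = Affine a b" using inf[of P] by (cases "\<phi> P") auto
      have onP: "on_curve E P" unfolding P_def by (rule on_pow)
      then have "add_point F (Affine a b) (Affine a b) = Infinity"
        using add[OF onP onP] PP inf ab by metis
      then have "b = - b" by (auto simp: F_def cubic_curve_def add_point.simps(3) Let_def split: if_splits)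
      then have "b = 0" by simp
      then show False using on onP ab f noroot by metis
    qed
    have three: "n dvd 3"
    proof (rule ccontr)
      assume n3: "\<not> n dvd 3"
      then have "n \<noteq> 1" "n \<noteq> 3" by auto
      moreover have "n \<noteq> 2" using \<open>odd n\<close> by auto
      ultimately have "n > 3" using g(2) by linarith
      then obtain m where m: "m dvd n" "prime m \<and> m \<ge> 5 \<or> m = 9"
        using odd_order_divisor[OF \<open>odd n\<close>] by blast
      then obtain l where l: "n = l * m" by (metis dvdE mult.commute)
      \<comment> \<open>\<open>P\<close> has order exactly \<open>m\<close>, which does not divide
        3.\<close>
      define P where "P = g [^]\<^bsub>point_group E\<^esub> l"
      have onP: "on_curve E P" unfolding P_def by (rule on_pow)
      have Pm: "P [^]\<^bsub>point_group E\<^esub> i = g [^]\<^bsub>point_group E\<^esub> (l * i)" for i :: nat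
        unfolding P_def using nat_pow_pow[OF g(1), of l i] by simp
      have "\<phi> P [^]\<^bsub>point_group F\<^esub> m = Infinity"
      proof -
        have "P [^]\<^bsub>point_group E\<^esub> m = Infinity" using Pm[of m] g(3)[of n] l by simp
        then show ?thesis using pow[OF onP, of m] inf by metis
      qed
      then have "\<phi> P [^]\<^bsub>point_group F\<^esub> (3::nat) = Infinity"
        using cubic_curve_torsion[OF EF[unfolded F_def] ck(2,3) noroot[unfolded f_def] m(2), of "\<phi> P"] on onP
        unfolding F_def by blast
      then have "P [^]\<^bsub>point_group E\<^esub> (3::nat) = Infinity" using pow[OF onP, of 3] inf by metis
      then have "n dvd l * 3" using g(3)[of "l * 3"] Pm[of 3] by simp
      then have "m dvd 3" using l g(2) by simp
      then have "m \<le> 3" by (rule dvd_imp_le) simp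
      then show False using m(2) by auto
    qed
    have "P [^]\<^bsub>point_group E\<^esub> (3::nat) = \<one>\<^bsub>point_group E\<^esub>"
      if P: "P \<in> carrier (torsion_subgroup (point_group E))" for P
    proof -
      obtain k :: nat where k: "P = g [^]\<^bsub>point_group E\<^esub> k" using P g(4) by auto
      show ?thesis unfolding k using nat_pow_pow[OF g(1), of k 3] g(3)[of "k * 3"] three by simp
    qed
    then show ?thesis using torsion_subgroup_order_3[OF cyc] by blast
  qed
  moreover have "weierstrass_isomorphic E (E_alt 1 0 c d)"
    unfolding weierstrass_isomorphic_def using x by metis
  ultimately show ?thesis using alt by blast
qed

end
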